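(* Let $\Omega$, $F$, $U$, $P$, $A$, and the linear system (L) for $x_h^1\in\underline V^h$ be as in the context. Suppose that the curve shortening problem (P) of the context has a smooth solution $x$ on $[0,T]$ satisfying $c_0\le|x_\rho|\le C_0$ in $I\times[0,T]$ for some constants $c_0,C_0\in\mathbb R_{>0}$. Then there exist $0<\gamma\le1$ and $h_0>0$ such that (L) has a unique solution $x_h^1\in\underline V^h$ satisfying $$\|I_hx(\cdot,t_1)-x_h^1\|_1^2\le c\bigl(h^4+(\Delta t)^4\bigr),$$ provided that $0<\Delta t\le\gamma h$ and $0<h\le h_0$. Here $t_1=\Delta t$ and the constant $c>0$ is independent of $h$ and $\Delta t$.
   Context: **Domain.** $n\ge2$ and $\Omega\subset\mathbb R^n$ is a domain; $U$ is an open neighbourhood of $\partial\Omega$ and $F\in C^3(U)$ satisfies $\partial\Omega=\{z\in U:F(z)=0\}$ and $|\nabla F(z)|=1$ for all $z\in\partial\Omega$. For $z\in\partial\Omega$ (where $|\nabla F(z)|=1$), $$P(z)=I\!d-\frac{\nabla F(z)}{|\nabla F(z)|}\otimes\frac{\nabla F(z)}{|\nabla F(z)|},\qquad A(z)=\frac1{|\nabla F(z)|}P(z)D^2F(z)P(z).$$ **Continuous problem (P).** $I=(0,1)$, $\partial I=\{0,1\}$. Find $x:\overline I\times[0,T]\to\mathbb R^n$ with $|x_\rho|^2x_t-x_{\rho\rho}=0$ in $I\times(0,T]$, $x(\cdot,0)=x_0$ in $\overline I$, and, for all $(\rho,t)\in\partial I\times(0,T]$, $x(\rho,t)\in\partial\Omega$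 and $x_\rho(\rho,t)\cdot v=0$ for all $v\in T_{x(\rho,t)}\partial\Omega$ (the tangent space). Also $F(x_0)=0$ on $\partial I$. **Discretization.** $\|\cdot\|_1$ is the $H^1(I)$ norm. $J\ge2$, $h=1/J$, $\rho_j=jh$, $I_j=[\rho_{j-1},\rho_j]$; $V^h=\{\chi\in C^0(\overline I):\chi|_{I_j}\text{ affine},\ j=1,\dots,J\}$, $\underline V^h=[V^h]^n$; $I_h:[C^0(\overline I)]^n\to\underline V^h$ is Lagrange interpolation at the nodes. $\Delta t=T/M$ with $M$ a positive integer. For a grid function $v$ with values $v_j=v(\rho_j)$: $\delta^-v_j=(v_j-v_{j-1})/h$, $\delta^+v_j=(v_{j+1}-v_j)/h$, $\delta^2v_j=(\delta^+v_j-\delta^-v_j)/h$. Write $x_j^0=x_0(\rho_j)$, $q_j^0=|\delta^-x_j^0|$ ($j=1,\dots,J$), and $x_{h,j}^1=x_h^1(\rho_j)$. **Linear system (L)** for $x_h^1\in\underline V^h$: $$\tfrac12\bigl((q_j^0)^2+(q_{j+1}^0)^2\bigr)\frac{x_{h,j}^1-x_j^0}{\Delta t}-\delta^2x_{h,j}^1=0,\quad j=1,\dots,J-1,$$ $$\frac{x_{h,0}^1-x_0^0}{\Delta t}\cdot\Bigl\{\nabla F(x_0^0)+\frac{2\Delta t}{h(q_1^0)^2}A(x_0^0)\delta^+x_0^0\Bigr\}=0,$$ $$\frac{x_{h,J}^1-x_J^0}{\Delta t}\cdot\Bigl\{\nabla F(x_J^0)-\frac{2\Delta t}{h(q_J^0)^2}A(x_J^0)\delta^-x_J^0\Bigr\}=0,$$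 $$(q_1^0)^2\Bigl(I\!d+\frac{2\Delta t}{h(q_1^0)^2}\bigl(\delta^+x_0^0\cdot\nabla F(x_0^0)\bigr)A(x_0^0)\Bigr)P(x_0^0)\frac{x_{h,0}^1-x_0^0}{\Delta t}-\frac2hP(x_0^0)\delta^+x_{h,0}^1=0,$$ $$(q_J^0)^2\Bigl(I\!d-\frac{2\Delta t}{h(q_J^0)^2}\bigl(\delta^-x_J^0\cdot\nabla F(x_J^0)\bigr)A(x_J^0)\Bigr)P(x_J^0)\frac{x_{h,J}^1-x_J^0}{\Delta t}+\frac2hP(x_J^0)\delta^-x_{h,J}^1=0.$$ Here $x_0^0=x_0(\rho_0)$ and $x_J^0=x_0(\rho_J)$ are the end points of the initial curve. The constants $\gamma,h_0,c$ may depend on $x$, $F$, $\Omega$, $T$, $c_0$, $C_0$. *)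

theory Defs
  imports "HOL-Analysis.Analysis"
begin

section \<open>Derivatives of the level set function\<close>

definition partial :: "'n \<Rightarrow> (real^'n \<Rightarrow> real) \<Rightarrow> real^'n::finite \<Rightarrow> real" where
  "partial i f z = frechet_derivative f (at z) (axis i 1)"

primrec Ck_on :: "nat \<Rightarrow> (real^'n::finite \<Rightarrow> real) \<Rightarrow> (real^'n) set \<Rightarrow> bool" where
  "Ck_on 0 f U \<longleftrightarrow> continuous_on U f"
| "Ck_on (Suc k) f U \<longleftrightarrow>
     (\<forall>z\<in>U. f differentiable (at z)) \<and> (\<forall>i. Ck_on k (partial i f) U)"

definition grad :: "(real^'n \<Rightarrow> real) \<Rightarrow> real^'n::finite \<Rightarrow> real^'n" where
  "grad f z = (\<chi> i. partial i f z)"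

definition hessian :: "(real^'n \<Rightarrow> real) \<Rightarrow> real^'n::finite \<Rightarrow> real^'n^'n" where
  "hessian f z = (\<chi> i j. partial j (partial i f) z)"

definition outer :: "real^'n \<Rightarrow> real^'n \<Rightarrow> real^'n^'n::finite" where
  "outer u v = (\<chi> i j. u $ i * v $ j)"

definition Pmat :: "(real^'n \<Rightarrow> real) \<Rightarrow> real^'n::finite \<Rightarrow> real^'n^'n" where
  "Pmat F z = mat 1 - outer (grad F z /\<^sub>R norm (grad F z)) (grad F z /\<^sub>R norm (grad F z))"

definition Amat :: "(real^'n \<Rightarrow> real) \<Rightarrow> real^'n::finite \<Rightarrow> real^'n^'n" where
  "Amat F z = (1 / norm (grad F z)) *\<^sub>R (Pmat F z ** hessian F z ** Pmat F z)"


section \<open>The continuous problem\<close>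

text \<open>Tangent vectors are the velocities of differentiable curves that stay in the surface.\<close>

definition tangent_space :: "'a::real_normed_vector set \<Rightarrow> 'a \<Rightarrow> 'a set" where
  "tangent_space S p = {v. \<exists>\<epsilon>>0. \<exists>\<gamma>. (\<forall>s\<in>{-\<epsilon><..<\<epsilon>}. \<gamma> s \<in> S \<and> \<gamma> differentiable (at s))
      \<and> \<gamma> 0 = p \<and> (\<gamma> has_vector_derivative v) (at 0)}"

text \<open>Derivatives are taken within the closed parameter intervals, so they are one-sided at the
  end points.\<close>

definition d_rho :: "(real \<Rightarrow> real \<Rightarrow> 'a::real_normed_vector) \<Rightarrow> real \<Rightarrow> real \<Rightarrow> 'a" where
  "d_rho x \<rho> t = vector_derivative (\<lambda>r. x r t) (at \<rho> within {0..1})"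

definition d_time :: "real \<Rightarrow> (real \<Rightarrow> real \<Rightarrow> 'a::real_normed_vector) \<Rightarrow> real \<Rightarrow> real \<Rightarrow> 'a" where
  "d_time T x \<rho> t = vector_derivative (\<lambda>s. x \<rho> s) (at t within {0..T})"

text \<open>Smooth up to the boundary on \<open>[0,1] \<times> [0,T]\<close>: here \<open>D i j\<close> is
  the partial derivative of order \<open>i\<close> in \<open>\<rho>\<close> and \<open>j\<close> in \<open>t\<close>.\<close>

definition smooth_evolution :: "real \<Rightarrow> (real \<Rightarrow> real \<Rightarrow> 'a::real_normed_vector) \<Rightarrow> bool" where
  "smooth_evolution T x \<longleftrightarrow> (\<exists>D :: nat \<Rightarrow> nat \<Rightarrow> real \<Rightarrow> real \<Rightarrow> 'a.
     (\<forall>\<rho>\<in>{0..1}. \<forall>t\<in>{0..T}. D 0 0 \<rho> t = x \<rho> t) \<and>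
     (\<forall>i j. continuous_on ({0..1} \<times> {0..T}) (\<lambda>(\<rho>, t). D i j \<rho> t) \<and>
       (\<forall>\<rho>\<in>{0..1}. \<forall>t\<in>{0..T}.
          ((\<lambda>r. D i j r t) has_vector_derivative D (Suc i) j \<rho> t) (at \<rho> within {0..1}) \<and>
          ((\<lambda>s. D i j \<rho> s) has_vector_derivative D i (Suc j) \<rho> t) (at t within {0..T}))))"

definition solves_csf ::
  "(real^'n::finite) set \<Rightarrow> real \<Rightarrow> (real \<Rightarrow> real^'n) \<Rightarrow> (real \<Rightarrow> real \<Rightarrow> real^'n) \<Rightarrow> bool" where
  "solves_csf \<Omega> T x0 x \<longleftrightarrow>
     (\<forall>\<rho>\<in>{0<..<1}. \<forall>t\<in>{0<..T}.
        (norm (d_rho x \<rho> t))\<^sup>2 *\<^sub>R d_time T x \<rho> t - d_rho (d_rho x) \<rho> t = 0) \<and>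
     (\<forall>\<rho>\<in>{0..1}. x \<rho> 0 = x0 \<rho>) \<and>
     (\<forall>\<rho>\<in>{0, 1}. \<forall>t\<in>{0<..T}. x \<rho> t \<in> frontier \<Omega> \<and>
        (\<forall>v\<in>tangent_space (frontier \<Omega>) (x \<rho> t). d_rho x \<rho> t \<bullet> v = 0))"


section \<open>Finite element space, interpolation and Sobolev norm\<close>

definition node :: "nat \<Rightarrow> nat \<Rightarrow> real" where
  "node J j = real j * (1 / real J)"

definition fe_space :: "nat \<Rightarrow> (real \<Rightarrow> real) set" where
  "fe_space J = {f. continuous_on {0..1} f \<and>
     (\<forall>j\<in>{1..J}. \<exists>a b. \<forall>\<rho>\<in>{node J (j - 1)..node J j}. f \<rho> = a + b * \<rho>)}"

definition fe_space_vec :: "nat \<Rightarrow> (real \<Rightarrow> real^'n::finite) set" where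
  "fe_space_vec J = {X. \<forall>i. (\<lambda>\<rho>. X \<rho> $ i) \<in> fe_space J}"

text \<open>Lagrange interpolation, written in the nodal basis of hat functions.\<close>

definition hat :: "nat \<Rightarrow> nat \<Rightarrow> real \<Rightarrow> real" where
  "hat J j \<rho> = max 0 (1 - real J * \<bar>\<rho> - node J j\<bar>)"

definition interp :: "nat \<Rightarrow> (real \<Rightarrow> 'a::real_vector) \<Rightarrow> real \<Rightarrow> 'a" where
  "interp J f \<rho> = (\<Sum>j\<le>J. hat J j \<rho> *\<^sub>R f (node J j))"

text \<open>The test functions are the \<open>C\<^sup>1\<close> functions with compact support in the open unit interval,
  extended by zero to the real line.\<close>

definition test_fun :: "(real \<Rightarrow> real) \<Rightarrow> (real \<Rightarrow> real) \<Rightarrow> bool" where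
  "test_fun \<phi> \<phi>' \<longleftrightarrow> (\<forall>\<rho>. (\<phi> has_real_derivative \<phi>' \<rho>) (at \<rho>)) \<and> continuous_on UNIV \<phi>' \<and>
     (\<exists>a b. 0 < a \<and> a < b \<and> b < 1 \<and> (\<forall>\<rho>. \<rho> \<notin> {a..b} \<longrightarrow> \<phi> \<rho> = 0))"

definition L2_fun :: "(real \<Rightarrow> 'a::euclidean_space) \<Rightarrow> bool" where
  "L2_fun g \<longleftrightarrow> g \<in> borel_measurable (lebesgue_on {0<..<1}) \<and>
     integrable (lebesgue_on {0<..<1}) (\<lambda>\<rho>. (norm (g \<rho>))\<^sup>2)"

definition weak_derivative :: "(real \<Rightarrow> 'a::euclidean_space) \<Rightarrow> (real \<Rightarrow> 'a) \<Rightarrow> bool" where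
  "weak_derivative f g \<longleftrightarrow> (\<forall>\<phi> \<phi>'. test_fun \<phi> \<phi>' \<longrightarrow>
     (LINT \<rho>|lebesgue_on {0<..<1}. \<phi>' \<rho> *\<^sub>R f \<rho>) =
     - (LINT \<rho>|lebesgue_on {0<..<1}. \<phi> \<rho> *\<^sub>R g \<rho>))"

text \<open>The weak derivative is unique almost everywhere, so the norm does not depend on the choice.
  It is meaningful only for functions in \<open>H\<^sup>1(0,1)\<close>.\<close>

definition H1_norm :: "(real \<Rightarrow> 'a::euclidean_space) \<Rightarrow> real" where
  "H1_norm f = (let g = (SOME g. L2_fun g \<and> weak_derivative f g) in
     sqrt ((LINT \<rho>|lebesgue_on {0<..<1}. (norm (f \<rho>))\<^sup>2) +
           (LINT \<rho>|lebesgue_on {0<..<1}. (norm (g \<rho>))\<^sup>2)))"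


section \<open>The linear system of the first time step\<close>

definition dminus :: "real \<Rightarrow> (nat \<Rightarrow> 'a::real_vector) \<Rightarrow> nat \<Rightarrow> 'a" where
  "dminus h v j = (v j - v (j - 1)) /\<^sub>R h"

definition dplus :: "real \<Rightarrow> (nat \<Rightarrow> 'a::real_vector) \<Rightarrow> nat \<Rightarrow> 'a" where
  "dplus h v j = (v (j + 1) - v j) /\<^sub>R h"

definition d2 :: "real \<Rightarrow> (nat \<Rightarrow> 'a::real_vector) \<Rightarrow> nat \<Rightarrow> 'a" where
  "d2 h v j = (dplus h v j - dminus h v j) /\<^sub>R h"

definition linear_system ::
  "(real^'n::finite \<Rightarrow> real) \<Rightarrow> (real \<Rightarrow> real^'n) \<Rightarrow> nat \<Rightarrow> real \<Rightarrow> (real \<Rightarrow> real^'n) \<Rightarrow> bool" where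
  "linear_system F x0 J dt X \<longleftrightarrow>
    (let h = 1 / real J;
         y = (\<lambda>j. x0 (node J j));
         Y = (\<lambda>j. X (node J j));
         q = (\<lambda>j. norm (dminus h y j))
     in
      (\<forall>j\<in>{1..J - 1}.
         (1/2 * ((q j)\<^sup>2 + (q (j + 1))\<^sup>2)) *\<^sub>R ((Y j - y j) /\<^sub>R dt) - d2 h Y j = 0) \<and>
      ((Y 0 - y 0) /\<^sub>R dt) \<bullet>
        (grad F (y 0) + (2 * dt / (h * (q 1)\<^sup>2)) *\<^sub>R (Amat F (y 0) *v dplus h y 0)) = 0 \<and>
      ((Y J - y J) /\<^sub>R dt) \<bullet>
        (grad F (y J) - (2 * dt / (h * (q J)\<^sup>2)) *\<^sub>R (Amat F (y J) *v dminus h y J)) = 0 \<and>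
      (q 1)\<^sup>2 *\<^sub>R
        ((mat 1 + (2 * dt / (h * (q 1)\<^sup>2) * (dplus h y 0 \<bullet> grad F (y 0))) *\<^sub>R Amat F (y 0))
          *v (Pmat F (y 0) *v ((Y 0 - y 0) /\<^sub>R dt)))
        - (2 / h) *\<^sub>R (Pmat F (y 0) *v dplus h Y 0) = 0 \<and>
      (q J)\<^sup>2 *\<^sub>R
        ((mat 1 - (2 * dt / (h * (q J)\<^sup>2) * (dminus h y J \<bullet> grad F (y J))) *\<^sub>R Amat F (y J))
          *v (Pmat F (y J) *v ((Y J - y J) /\<^sub>R dt)))
        + (2 / h) *\<^sub>R (Pmat F (y J) *v dminus h Y J) = 0)"

end

theory Submission
  imports Defs
begin

text \<open>The numerical solution \<open>X\<close> is compared with \<open>Z = x\<^sub>0 + \<Delta>t x\<^sub>t + \<Delta>t\<^sup>2 x\<^sub>\<rho>\<^sub>\<rho>\<^sub>t / |x\<^sub>\<rho>|\<^sup>2\<close>, all derivatives taken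
  at time \<open>0\<close>, which differs from \<open>x(\<cdot>, \<Delta>t)\<close> by \<open>O(\<Delta>t\<^sup>2)\<close> in \<open>C\<^sup>1\<close>. The last term is what a backward
  Euler step adds. It makes the interior residual \<open>O(h\<^sup>2 + \<Delta>t\<^sup>2)\<close>, and its normal part at the end points,
  \<open>- x\<^sub>t \<cdot> A x\<^sub>t\<close>, is exactly what the extra term in the normal boundary condition asks for. Hence the
  normal residual is only \<open>O(h \<Delta>t)\<close> and no boundary layer appears. The difference \<open>X - Z\<close> is then
  estimated by testing the scheme with \<open>X - Z\<close> itself; the tangential boundary equation contributes the
  coercive term \<open>(h / \<Delta>t) |P (X - Z)|\<^sup>2\<close>, which for \<open>\<Delta>t \<le> \<gamma> h\<close> with small \<open>\<gamma>\<close> absorbs the indefinite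
  curvature term. The same estimate gives uniqueness. Existence follows because a solution of the interior
  equations is determined by its first two nodal values, so the boundary conditions form a square linear
  system of a fixed size.\<close>

section \<open>Interpolation\<close>

text \<open>What shapes the proof is the price of a normal defect at the end points. There the
  normal part of the error e multiplies the normal part of the difference quotient d, for which no
  boundary equation gives a bound. The product can only be absorbed as h |d|^2 / 4 into the gradient
  sum, and this costs the square of the normal part of e divided by h. A defect of size dt^2 would
  cost dt^4 / h, too much. The exact solution has such a defect: its normal increment is, to leading
  order, half of dt^2 times the normal part of x_tt, while the scheme asks for the whole. The
  correction supplies the whole, because x_t is tangential at the ends, so that the time derivative
  of |x_\<rho>|^2 x_t = x_\<rho>\<rho> has normal part |x_\<rho>|^2 times that of x_tt. The factor 1
  / h in the boundary coefficients is harmless for a similar reason: x_\<rho> is normal and A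
  annihilates normal vectors, so A maps the first difference quotient of the initial curve to a
  vector of size O(h).\<close>

lemma hat_zero:
  assumes "J > 0" "j \<in> {1..J}" "\<rho> \<in> {node J (j - 1)..node J j}" "i \<noteq> j" "i \<noteq> j - 1"
  shows "hat J i \<rho> = 0"
proof -
  have r: "real j - 1 \<le> real J * \<rho>" "real J * \<rho> \<le> real j"
    using assms(1-3) by (auto simp: node_def field_simps of_nat_diff)
  have "real i + 1 \<le> real j - 1 \<or> real j + 1 \<le> real i"
    using assms(2,4,5) by (cases "i < j") auto
  then have "1 \<le> \<bar>real J * \<rho> - real i\<bar>" using r by linarith
  also have "\<dots> = real J * \<bar>\<rho> - node J i\<bar>"
    using assms(1) by (simp add: node_def abs_if field_simps)
  finally show ?thesis by (simp add: hat_def)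
qed

text \<open>On a cell only the hat functions of its two end nodes survive, and there they add up to
  one.\<close>

lemma interp_on_cell:
  assumes "j \<in> {1..J}" "\<rho> \<in> {node J (j - 1)..node J j}"
  shows "interp J f \<rho> = f (node J (j - 1)) +
    (real J * (\<rho> - node J (j - 1))) *\<^sub>R (f (node J j) - f (node J (j - 1)))"
proof -
  have J: "J > 0" using assms by auto
  have "interp J f \<rho> = (\<Sum>i\<in>{j - 1, j}. hat J i \<rho> *\<^sub>R f (node J i))"
    unfolding interp_def using assms J
    by (intro sum.mono_neutral_right) (auto simp: hat_zero)
  also have "\<dots> = hat J (j - 1) \<rho> *\<^sub>R f (node J (j - 1)) + hat J j \<rho> *\<^sub>R f (node J j)"
    using assms by auto
  also have "hat J (j - 1) \<rho> = 1 - real J * (\<rho> - node J (j - 1))"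
  proof -
    have "real J * (\<rho> - node J (j - 1)) \<le> 1"
      using assms J by (auto simp: node_def field_simps of_nat_diff)
    then show ?thesis using assms by (simp add: hat_def)
  qed
  also have "hat J j \<rho> = real J * (\<rho> - node J (j - 1))"
  proof -
    have "1 - real J * (node J j - \<rho>) = real J * (\<rho> - node J (j - 1))"
      using assms J by (auto simp: node_def field_simps of_nat_diff)
    moreover have "0 \<le> real J * (\<rho> - node J (j - 1))" using assms by simp
    ultimately show ?thesis using assms by (cases "\<rho> = node J j") (simp_all add: hat_def abs_if)
  qed
  finally show ?thesis by (simp add: algebra_simps)
qed

lemma node_0 [simp]: "node J 0 = 0" by (simp add: node_def)
lemma node_last [simp]: "J > 0 \<Longrightarrow> node J J = 1" by (simp add: node_def)
lemma node_mono: "i \<le> j \<Longrightarrow> node J i \<le> node J j" by (simp add: node_def divide_right_mono)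
lemma node_in: "j \<le> J \<Longrightarrow> J > 0 \<Longrightarrow> node J j \<in> {0..1}" by (simp add: node_def)
lemma node_step: "j \<ge> 1 \<Longrightarrow> J > 0 \<Longrightarrow> node J j = node J (j - 1) + 1 / real J"
  by (simp add: node_def of_nat_diff field_simps)

lemma in_cell:
  assumes "J > 0" "\<rho> \<in> {0..1}"
  obtains j where "j \<in> {1..J}" "\<rho> \<in> {node J (j - 1)..node J j}"
proof -
  \<comment> \<open>The claim is generalized to all prefixes \<open>{0..node J k}\<close>, so that
    the induction step only has to place the points of one further cell.\<close>
  have "\<exists>j\<ge>1. j \<le> k \<and> \<rho> \<in> {node J (j - 1)..node J j}" if "k > 0" "\<rho> \<in> {0..node J k}" for k
    using that
  proof (induction k)
    case (Suc k)
    show ?case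
    proof (cases "\<rho> \<le> node J k \<and> k > 0")
      case True then show ?thesis using Suc by force
    next
      case False
      then show ?thesis using Suc by (intro exI[of _ "Suc k"]) auto
    qed
  qed simp
  from this[of J] obtain j where "j \<ge> 1" "j \<le> J" "\<rho> \<in> {node J (j - 1)..node J j}"
    using assms by auto
  then show ?thesis by (intro that[of j]) simp_all
qed

lemma interp_node:
  assumes "j \<le> J" "J > 0"
  shows "interp J f (node J j) = f (node J j)"
proof (cases "j = 0")
  case True
  with assms have "node J j \<in> {node J (1 - 1)..node J 1}" by (auto simp: node_def)
  from interp_on_cell[OF _ this, of f] show ?thesis using True assms by auto
next
  case False
  with assms have "node J j \<in> {node J (j - 1)..node J j}" by (auto intro: node_mono)
  from interp_on_cell[OF _ this, of f] show ?thesis 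
    using False assms by (auto simp: node_step[of j J])
qed

lemma continuous_interp:
  fixes f :: "real \<Rightarrow> 'a::real_normed_vector"
  shows "continuous_on A (interp J f)"
  unfolding interp_def[abs_def] hat_def
  by (intro continuous_on_sum continuous_on_scaleR continuous_on_max continuous_intros)

lemma interp_in_fe_space_vec: "interp J f \<in> fe_space_vec J"
proof -
  have "\<exists>a b. \<forall>\<rho>\<in>{node J (j - 1)..node J j}. interp J f \<rho> $ i = a + b * \<rho>" if "j \<in> {1..J}" for i j
    using that
    by (intro exI[of _ "f (node J (j - 1)) $ i - real J * node J (j - 1) * (f (node J j) - f (node J (j - 1))) $ i"]
              exI[of _ "real J * (f (node J j) - f (node J (j - 1))) $ i"])
       (simp add: interp_on_cell algebra_simps)
  then show ?thesis
    by (auto simp: fe_space_vec_def fe_space_def intro!: continuous_intros continuous_interp)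
qed

text \<open>Reduces uniqueness of the discrete solution to its nodal values. Members of
  \<open>fe_space_vec\<close> are arbitrary outside \<open>{0..1}\<close>, hence the restriction on
  \<rho>.\<close>

lemma fe_space_vec_eq_interp:
  assumes "Y \<in> fe_space_vec J" "J > 0" "\<rho> \<in> {0..1}"
  shows "Y \<rho> = interp J Y \<rho>"
proof -
  obtain j where j: "j \<in> {1..J}" "\<rho> \<in> {node J (j - 1)..node J j}"
    using in_cell assms by blast
  have "Y \<rho> $ i = interp J Y \<rho> $ i" for i
  proof -
    obtain a b where ab: "\<forall>\<rho>\<in>{node J (j - 1)..node J j}. Y \<rho> $ i = a + b * \<rho>"
      using assms(1) j(1) unfolding fe_space_vec_def fe_space_def by blast
    have "node J (j - 1) \<le> node J j" by (simp add: node_mono)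
    with ab have "Y (node J (j - 1)) $ i = a + b * node J (j - 1)" "Y (node J j) $ i = a + b * node J j"
      by auto
    then show ?thesis using ab j assms(2) 
      by (simp add: interp_on_cell node_step[of j J] field_simps)
  qed
  then show ?thesis by (simp add: vec_eq_iff)
qed

lemma interp_cong: "J > 0 \<Longrightarrow> (\<And>j. j \<le> J \<Longrightarrow> f (node J j) = g (node J j)) \<Longrightarrow> interp J f = interp J g"
  by (auto simp: interp_def intro!: sum.cong)

lemma interp_diff: "interp J f \<rho> - interp J g \<rho> = interp J (\<lambda>r. f r - g r) \<rho>"
  by (simp add: interp_def sum_subtractf scaleR_diff_right)

section \<open>The Sobolev norm of piecewise affine functions\<close>

abbreviation unit_measure :: "real measure" where
  "unit_measure \<equiv> lebesgue_on {0<..<1}"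

lemma finite_unit_measure: "finite_measure unit_measure"
  by (intro finite_measure_lebesgue_on) simp

lemma continuous_unit_measurable:
  fixes f :: "real \<Rightarrow> 'a::euclidean_space"
  assumes "continuous_on {0..1} f"
  shows "f \<in> borel_measurable unit_measure"
  by (rule continuous_imp_measurable_on_sets_lebesgue) (auto intro: continuous_on_subset[OF assms])

lemma bounded_unit_integrable:
  fixes f :: "real \<Rightarrow> 'a::euclidean_space"
  assumes "f \<in> borel_measurable unit_measure" "\<And>\<rho>. \<rho> \<in> {0<..<1} \<Longrightarrow> norm (f \<rho>) \<le> B"
  shows "integrable unit_measure f"
  by (rule finite_measure.integrable_const_bound[OF finite_unit_measure, of _ B])
     (use assms in \<open>auto intro!: AE_I2\<close>)

lemma continuous_unit_integrable:
  fixes f :: "real \<Rightarrow> 'a::euclidean_space"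
  assumes "continuous_on {0..1} f"
  shows "integrable unit_measure f"
proof -
  have "bounded (f ` {0..1})" using assms by (intro compact_imp_bounded compact_continuous_image) auto
  then obtain B where "\<forall>\<rho>\<in>{0..1}. norm (f \<rho>) \<le> B" unfolding bounded_iff by auto
  then show ?thesis using assms
    by (intro bounded_unit_integrable[of _ B] continuous_unit_measurable) auto
qed

text \<open>The measure is finite and t \<le> 1 + t^2, so square integrability provides an
  integrable majorant.\<close>

lemma L2_fun_integrable:
  fixes g :: "real \<Rightarrow> 'a::euclidean_space"
  assumes "L2_fun g"
  shows "integrable unit_measure g"
proof (rule Bochner_Integration.integrable_bound[of _ "\<lambda>\<rho>. 1 + (norm (g \<rho>))\<^sup>2"])
  show "integrable unit_measure (\<lambda>\<rho>. 1 + (norm (g \<rho>))\<^sup>2)"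
    using assms by (intro Bochner_Integration.integrable_add) (auto simp: L2_fun_def intro: continuous_unit_integrable)
  have "norm (g \<rho>) \<le> 1 + (norm (g \<rho>))\<^sup>2" for \<rho>
  proof -
    have "0 \<le> (norm (g \<rho>) - 1)\<^sup>2" by simp
    then have "2 * norm (g \<rho>) \<le> 1 + (norm (g \<rho>))\<^sup>2" by (simp add: power2_diff)
    then show ?thesis using norm_ge_zero[of "g \<rho>"] by linarith
  qed
  then show "AE \<rho> in unit_measure. norm (g \<rho>) \<le> norm (1 + (norm (g \<rho>))\<^sup>2)"
    by (auto intro!: AE_I2 simp: abs_of_nonneg add_nonneg_nonneg)
qed (use assms in \<open>simp add: L2_fun_def\<close>)

text \<open>Squaring removes the kink of the positive part: at 0 the difference quotient is bounded
  by |h|. Since \<open>test_fun\<close> asks for C^1 only, this is smooth enough to build cut-off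
  functions.\<close>

lemma DERIV_max0_square:
  assumes "(u has_real_derivative u') (at x)"
  shows "((\<lambda>x. (max 0 (u x))\<^sup>2) has_real_derivative 2 * max 0 (u x) * u') (at x)"
proof -
  have "((\<lambda>y::real. (max 0 y)\<^sup>2) has_real_derivative 2 * max 0 y) (at y)" for y
  proof -
    consider "y > 0" | "y < 0" | "y = 0" by linarith
    then show ?thesis
    proof cases
      case 1
      have "((\<lambda>y::real. y\<^sup>2) has_real_derivative 2 * max 0 y) (at y)"
        using 1 by (auto intro!: derivative_eq_intros)
      then show ?thesis
        by (rule has_field_derivative_transform_within_open[of _ _ _ "{0<..}"]) (use 1 in auto)
    next
      case 2
      have "((\<lambda>y::real. 0) has_real_derivative 2 * max 0 y) (at y)"
        using 2 by (auto intro!: derivative_eq_intros)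
      then show ?thesis
        by (rule has_field_derivative_transform_within_open[of _ _ _ "{..<0}"]) (use 2 in auto)
    next
      case 3
      have "((\<lambda>h::real. (max 0 h)\<^sup>2 / h) \<longlongrightarrow> 0) (at 0)"
      proof (rule Lim_null_comparison)
        have "norm ((max 0 h)\<^sup>2 / h) \<le> \<bar>h\<bar>" for h :: real
          by (cases "h > 0") (auto simp: power2_eq_square max_def)
        then show "\<forall>\<^sub>F h::real in at 0. norm ((max 0 h)\<^sup>2 / h) \<le> \<bar>h\<bar>" by (rule always_eventually[OF allI])
        show "((\<lambda>h::real. \<bar>h\<bar>) \<longlongrightarrow> 0) (at 0)" by (intro tendsto_eq_intros) auto
      qed
      then show ?thesis using 3 by (simp add: DERIV_def)
    qed
  qed
  from DERIV_chain2[OF this assms] show ?thesis .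
qed

text \<open>The functions \<open>1 - (1 - p\<^sup>2)^n\<close> with \<open>p = max 0 ((\<rho> - a) (b - \<rho>))\<close> are test functions that
  increase to the indicator of \<open>(a, b)\<close>.\<close>

lemma weak_zero_interval:
  fixes k :: "real \<Rightarrow> 'a::euclidean_space"
  assumes int: "integrable unit_measure k"
    and zero: "\<And>\<phi> \<phi>'. test_fun \<phi> \<phi>' \<Longrightarrow> (LINT \<rho>|unit_measure. \<phi> \<rho> *\<^sub>R k \<rho>) = 0"
    and ab: "0 < a" "a < b" "b < 1"
  shows "(LINT \<rho>|unit_measure. indicator {a<..<b} \<rho> *\<^sub>R k \<rho>) = 0"
proof -
  define p where "p \<rho> = max 0 ((\<rho> - a) * (b - \<rho>))" for \<rho> :: real
  define \<phi> where "\<phi> n \<rho> = 1 - (1 - (p \<rho>)\<^sup>2) ^ n" for n :: nat and \<rho>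
  have der: "((\<lambda>\<rho>. (p \<rho>)\<^sup>2) has_real_derivative 2 * p \<rho> * (a + b - 2 * \<rho>)) (at \<rho>)" for \<rho>
    unfolding p_def by (rule DERIV_max0_square) (auto intro!: derivative_eq_intros)
  have contp: "continuous_on A p" for A unfolding p_def by (intro continuous_on_max continuous_intros)
  have out: "p \<rho> = 0" if "\<rho> \<notin> {a<..<b}" for \<rho>
  proof -
    have "(\<rho> - a) * (b - \<rho>) \<le> 0" using that ab
      by (cases "\<rho> \<le> a") (auto intro: mult_nonpos_nonneg mult_nonneg_nonpos)
    then show ?thesis by (simp add: p_def)
  qed
  have inside: "0 < p \<rho>" if "\<rho> \<in> {a<..<b}" for \<rho>
    using that by (auto simp: p_def)
  have le1: "p \<rho> < 1" "0 \<le> p \<rho>" for \<rho>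
  proof -
    show "0 \<le> p \<rho>" by (simp add: p_def)
    \<comment> \<open>Both factors are below 1 inside (a, b), so 1 - p^2 lies in (0, 1] and its
      powers tend to 0 exactly where p is positive.\<close>
    show "p \<rho> < 1"
    proof (cases "\<rho> \<in> {a<..<b}")
      case True
      then have "(\<rho> - a) * (b - \<rho>) < 1 * 1" using ab by (intro mult_strict_mono) auto
      then show ?thesis by (simp add: p_def)
    qed (simp add: out)
  qed
  have sq: "(p \<rho>)\<^sup>2 \<le> 1" for \<rho> using le1[of \<rho>] by (simp add: power_le_one)
  have test: "test_fun (\<phi> n) (\<lambda>\<rho>. - (of_nat n * (1 - (p \<rho>)\<^sup>2) ^ (n - 1) * (- (2 * p \<rho> * (a + b - 2 * \<rho>)))))" for n
    unfolding test_fun_def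
  proof (intro conjI allI)
    show "(\<phi> n has_real_derivative - (of_nat n * (1 - (p \<rho>)\<^sup>2) ^ (n - 1) * (- (2 * p \<rho> * (a + b - 2 * \<rho>))))) (at \<rho>)" for \<rho>
      unfolding \<phi>_def[abs_def] by (rule derivative_eq_intros der refl | simp)+
    show "continuous_on UNIV (\<lambda>\<rho>. - (of_nat n * (1 - (p \<rho>)\<^sup>2) ^ (n - 1) * (- (2 * p \<rho> * (a + b - 2 * \<rho>)))))"
      by (intro continuous_intros contp)
    show "\<exists>a b. 0 < a \<and> a < b \<and> b < 1 \<and> (\<forall>\<rho>. \<rho> \<notin> {a..b} \<longrightarrow> \<phi> n \<rho> = 0)"
      using ab out by (intro exI[of _ a] exI[of _ b]) (auto simp: \<phi>_def)
  qed
  have "(\<lambda>n. LINT \<rho>|unit_measure. \<phi> n \<rho> *\<^sub>R k \<rho>) \<longlonglongrightarrow> (LINT \<rho>|unit_measure. indicator {a<..<b} \<rho> *\<^sub>R k \<rho>)"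
  \<comment> \<open>All \<phi> n take values in [0, 1], which makes the norm of k a
    majorant.\<close>
  proof (rule integral_dominated_convergence[where w = "\<lambda>\<rho>. norm (k \<rho>)"])
    have km: "k \<in> borel_measurable unit_measure" using int by auto
    show "(\<lambda>\<rho>. indicator {a<..<b} \<rho> *\<^sub>R k \<rho>) \<in> borel_measurable unit_measure"
      by (intro borel_measurable_scaleR borel_measurable_indicator km)
         (simp add: sets_restrict_space, rule image_eqI[of _ _ "{a<..<b}"], use ab in auto)
    have "\<phi> n \<in> borel_measurable unit_measure" for n
      unfolding \<phi>_def[abs_def] by (intro continuous_unit_measurable continuous_intros contp)
    then show "(\<lambda>\<rho>. \<phi> n \<rho> *\<^sub>R k \<rho>) \<in> borel_measurable unit_measure" for n
      by (intro borel_measurable_scaleR km)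
    show "integrable unit_measure (\<lambda>\<rho>. norm (k \<rho>))" using int by simp
    have b: "0 \<le> \<phi> n \<rho>" "\<phi> n \<rho> \<le> 1" for n \<rho>
      using sq[of \<rho>] by (auto simp: \<phi>_def power_le_one)
    have "norm (\<phi> n \<rho> *\<^sub>R k \<rho>) \<le> norm (k \<rho>)" for n \<rho>
      using b[of n \<rho>] mult_right_mono[of "\<phi> n \<rho>" 1 "norm (k \<rho>)"] by simp
    then show "AE \<rho> in unit_measure. norm (\<phi> n \<rho> *\<^sub>R k \<rho>) \<le> norm (k \<rho>)" for n by simp
    have "(\<lambda>n. \<phi> n \<rho>) \<longlonglongrightarrow> indicator {a<..<b} \<rho>" for \<rho>
    proof (cases "\<rho> \<in> {a<..<b}")
      case True
      have "0 < (p \<rho>)\<^sup>2" using inside[OF True] by simp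
      then have "norm (1 - (p \<rho>)\<^sup>2) < 1" using sq[of \<rho>] by simp
      then have "(\<lambda>n. 1 - (1 - (p \<rho>)\<^sup>2) ^ n) \<longlonglongrightarrow> 1 - 0" by (intro tendsto_intros LIMSEQ_power_zero)
      then show ?thesis using True by (simp add: \<phi>_def)
    qed (simp add: \<phi>_def out)
    then show "AE \<rho> in unit_measure. (\<lambda>n. \<phi> n \<rho> *\<^sub>R k \<rho>) \<longlonglongrightarrow> indicator {a<..<b} \<rho> *\<^sub>R k \<rho>"
      by (auto intro!: tendsto_scaleR)
  qed
  moreover have "(LINT \<rho>|unit_measure. \<phi> n \<rho> *\<^sub>R k \<rho>) = 0" for n by (rule zero[OF test])
  ultimately show ?thesis by (simp add: LIMSEQ_const_iff)
qed

text \<open>The integral of \<open>k\<close> over every interval compactly inside (0, 1) vanishes by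
  \<open>weak_zero_interval\<close>. Almost every point is the limit of averages over shrinking
  intervals to its right, so \<open>k\<close> vanishes there.\<close>

lemma weak_zero_AE:
  fixes k :: "real \<Rightarrow> 'a::euclidean_space"
  assumes int: "integrable unit_measure k"
    and zero: "\<And>\<phi> \<phi>'. test_fun \<phi> \<phi>' \<Longrightarrow> (LINT \<rho>|unit_measure. \<phi> \<rho> *\<^sub>R k \<rho>) = 0"
  shows "AE \<rho> in unit_measure. k \<rho> = 0"
proof -
  \<comment> \<open>Extension by zero, because the differentiation theorem is applied to a function
    on the whole line.\<close>
  define K where "K \<rho> = indicator {0<..<1} \<rho> *\<^sub>R k \<rho>" for \<rho>
  have K: "integrable lebesgue K"
    using int unfolding K_def by (subst (asm) integrable_restrict_space) auto
  have "K integrable_on cbox a b" for a b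
    using integrable_on_lebesgue[OF K] integrable_on_subcbox by blast
  then obtain N where N: "negligible N"
    "\<And>x e. x \<notin> N \<Longrightarrow> 0 < e \<Longrightarrow> \<exists>d>0. \<forall>h. 0 < h \<and> h < d \<longrightarrow>
        norm (integral (cbox x (x + h *\<^sub>R One)) K /\<^sub>R h ^ DIM(real) - K x) < e"
    using integrable_ccontinuous_explicit[of K] by blast
  have int0: "integral {a..b} K = 0" if ab: "0 < a" "a < b" "b < 1" for a b
  proof -
    have "set_integrable lebesgue {a<..<b} K"
      unfolding set_integrable_def by (rule integrable_mult_indicator[OF _ K]) simp
    then have "integral {a<..<b} K = (LINT x:{a<..<b}|lebesgue. K x)"
      by (rule set_lebesgue_integral_eq_integral(2)[symmetric])
    also have "\<dots> = (LINT \<rho>|unit_measure. indicator {a<..<b} \<rho> *\<^sub>R k \<rho>)"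
      unfolding set_lebesgue_integral_def K_def
      by (subst integral_restrict_space) (auto simp: mult.commute)
    also have "\<dots> = 0" by (rule weak_zero_interval[OF int zero ab])
    finally show ?thesis by (simp add: integral_open_interval_real)
  qed
  have "k x = 0" if x: "x \<in> {0<..<1}" "x \<notin> N" for x
  proof (rule ccontr)
    assume "k x \<noteq> 0"
    then obtain d where d: "d > 0" "\<And>h. 0 < h \<Longrightarrow> h < d \<Longrightarrow>
        norm (integral (cbox x (x + h *\<^sub>R One)) K /\<^sub>R h ^ DIM(real) - K x) < norm (k x)"
      using N(2)[OF x(2), of "norm (k x)"] by auto
    \<comment> \<open>The second entry keeps x + h below 1, as \<open>int0\<close> requires.\<close>
    define h where "h = min (d / 2) ((1 - x) / 2)"
    have h: "0 < h" "h < d" "x + h < 1" using d x by (auto simp: h_def min_def field_simps)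
    then have "integral {x..x + h} K = 0" using x by (intro int0) auto
    then show False using d(2)[OF h(1,2)] x by (simp add: K_def)
  qed
  moreover have "N \<inter> {0<..<1} \<in> null_sets lebesgue"
    unfolding negligible_iff_null_sets[symmetric] by (rule negligible_subset[OF N(1)]) simp
  then have "N \<inter> {0<..<1} \<in> null_sets unit_measure"
    by (subst null_sets_restrict_space) simp_all
  ultimately show ?thesis
    by (intro AE_I'[of "N \<inter> {0<..<1}" _ "\<lambda>\<rho>. k \<rho> = 0"]) auto
qed

lemma weak_derivative_unique:
  assumes "L2_fun g" "L2_fun g'" "weak_derivative f g" "weak_derivative f g'"
  shows "AE \<rho> in unit_measure. g \<rho> = g' \<rho>"
proof -
  have i: "integrable unit_measure g" "integrable unit_measure g'" using assms L2_fun_integrable by auto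
  have "AE \<rho> in unit_measure. g \<rho> - g' \<rho> = 0"
  proof (rule weak_zero_AE)
    show "integrable unit_measure (\<lambda>\<rho>. g \<rho> - g' \<rho>)" using i by simp
    fix \<phi> \<phi>' assume t: "test_fun \<phi> \<phi>'"
    have c: "continuous_on {0..1} \<phi>"
      using t unfolding test_fun_def
      by (meson DERIV_continuous_on has_field_derivative_at_within)
    have b: "\<exists>B. \<forall>\<rho>\<in>{0..1}. norm (\<phi> \<rho>) \<le> B"
      using compact_imp_bounded[OF compact_continuous_image[OF c]] unfolding bounded_iff by auto
    then obtain B where B: "\<And>\<rho>. \<rho> \<in> {0..1} \<Longrightarrow> norm (\<phi> \<rho>) \<le> B" by blast
    have p: "integrable unit_measure (\<lambda>\<rho>. \<phi> \<rho> *\<^sub>R w \<rho>)" if "integrable unit_measure w" for w :: "real \<Rightarrow> 'a"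
    proof (rule Bochner_Integration.integrable_bound[of _ "\<lambda>\<rho>. B * norm (w \<rho>)"])
      show "integrable unit_measure (\<lambda>\<rho>. B * norm (w \<rho>))" using that by simp
      show "(\<lambda>\<rho>. \<phi> \<rho> *\<^sub>R w \<rho>) \<in> borel_measurable unit_measure"
        by (rule borel_measurable_scaleR[OF continuous_unit_measurable[OF c] borel_measurable_integrable[OF that]])
      have "norm (\<phi> 0) \<le> B" using B[of 0] by simp
      then have "B \<ge> 0" using norm_ge_zero[of "\<phi> 0"] by linarith
      then show "AE x in unit_measure. norm (\<phi> x *\<^sub>R w x) \<le> norm (B * norm (w x))"
        using B by (auto intro!: AE_I2 mult_right_mono simp: abs_mult)
    qed
    have "(LINT \<rho>|unit_measure. \<phi> \<rho> *\<^sub>R g \<rho>) = (LINT \<rho>|unit_measure. \<phi> \<rho> *\<^sub>R g' \<rho>)"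
      using assms(3)[unfolded weak_derivative_def, rule_format, OF t]
        assms(4)[unfolded weak_derivative_def, rule_format, OF t] by simp
    then show "(LINT \<rho>|unit_measure. \<phi> \<rho> *\<^sub>R (g \<rho> - g' \<rho>)) = 0"
      using p[OF i(1)] p[OF i(2)] by (simp add: scaleR_diff_right)
  qed
  then show ?thesis by simp
qed

text \<open>\<open>H1_norm\<close> selects some weak derivative by \<open>SOME\<close>. Almost
  everywhere uniqueness allows the selected one to be exchanged for any explicit witness, here later
  a step function.\<close>

lemma H1_norm_eq:
  assumes "L2_fun g" "weak_derivative f g"
  shows "(H1_norm f)\<^sup>2 = (LINT \<rho>|unit_measure. (norm (f \<rho>))\<^sup>2) + (LINT \<rho>|unit_measure. (norm (g \<rho>))\<^sup>2)"
proof -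
  define g' where "g' = (SOME g. L2_fun g \<and> weak_derivative f g)"
  have g': "L2_fun g'" "weak_derivative f g'"
    using someI[of "\<lambda>g. L2_fun g \<and> weak_derivative f g" g] assms unfolding g'_def by auto
  have "(LINT \<rho>|unit_measure. (norm (g' \<rho>))\<^sup>2) = (LINT \<rho>|unit_measure. (norm (g \<rho>))\<^sup>2)"
  proof (rule integral_cong_AE)
    show "AE \<rho> in unit_measure. (norm (g' \<rho>))\<^sup>2 = (norm (g \<rho>))\<^sup>2"
      using weak_derivative_unique[OF g'(1) assms(1) g'(2) assms(2)] by auto
  qed (use g' assms in \<open>auto simp: L2_fun_def\<close>)
  moreover have "0 \<le> (LINT \<rho>|unit_measure. (norm (h \<rho>))\<^sup>2)" for h :: "real \<Rightarrow> 'a"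
    by simp
  ultimately show ?thesis
    unfolding H1_norm_def Let_def g'_def[symmetric] by simp
qed

section \<open>Step functions as weak derivatives of interpolants\<close>

definition step_fun :: "nat \<Rightarrow> (nat \<Rightarrow> 'a::real_vector) \<Rightarrow> real \<Rightarrow> 'a" where
  "step_fun J d \<rho> = (\<Sum>j\<in>{1..J}. indicator {node J (j - 1)<..<node J j} \<rho> *\<^sub>R d j)"

lemma cells_disjoint:
  assumes "\<rho> \<in> {node J (j - 1)<..<node J j}" "i \<noteq> j" "i \<ge> 1" "j \<ge> 1"
  shows "\<rho> \<notin> {node J (i - 1)<..<node J i}"
proof (cases "i < j")
  case True
  then have "node J i \<le> node J (j - 1)" by (intro node_mono) auto
  then show ?thesis using assms(1) by auto
next
  case False
  then have "node J j \<le> node J (i - 1)" using assms(2) by (intro node_mono) auto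
  then show ?thesis using assms(1) by auto
qed

lemma step_fun_on_cell:
  assumes "j \<in> {1..J}" "\<rho> \<in> {node J (j - 1)<..<node J j}"
  shows "step_fun J d \<rho> = d j"
proof -
  have "step_fun J d \<rho> = (\<Sum>i\<in>{1..J}. if i = j then d j else 0)"
    unfolding step_fun_def
  proof (rule sum.cong)
    fix i assume "i \<in> {1..J}"
    then show "indicator {node J (i - 1)<..<node J i} \<rho> *\<^sub>R d i = (if i = j then d j else 0)"
      using cells_disjoint[OF assms(2), of i] assms by auto
  qed simp
  also have "\<dots> = d j" using assms by simp
  finally show ?thesis .
qed

text \<open>The cells are open, so a node lies in none of them and the sum is empty of
  contributions. This convention keeps the cells disjoint and matters only on a finite, hence null,
  set.\<close>

lemma step_fun_at_node: "step_fun J d (node J i) = 0"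
proof -
  have "node J i \<notin> {node J (j - 1)<..<node J j}" for j
  proof (cases "i < j")
    case True
    then have "node J i \<le> node J (j - 1)" by (intro node_mono) auto
    then show ?thesis by auto
  next
    case False
    then have "node J j \<le> node J i" by (intro node_mono) auto
    then show ?thesis by auto
  qed
  then show ?thesis by (simp add: step_fun_def)
qed

lemma in_open_cell:
  assumes "J > 0" "\<rho> \<in> {0..1}" "\<rho> \<notin> node J ` {..J}"
  obtains j where "j \<in> {1..J}" "\<rho> \<in> {node J (j - 1)<..<node J j}"
proof -
  obtain j where j: "j \<in> {1..J}" "\<rho> \<in> {node J (j - 1)..node J j}" using in_cell assms(1,2) by blast
  then have "\<rho> \<noteq> node J (j - 1)" "\<rho> \<noteq> node J j" using assms(3) by auto
  then show ?thesis using j by (intro that[of j]) auto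
qed

lemma cell_subset: "j \<le> J \<Longrightarrow> J > 0 \<Longrightarrow> {node J (j - 1)<..<node J j} \<subseteq> {0<..<1}"
proof -
  assume "j \<le> J" "J > 0"
  then have "0 \<le> node J (j - 1)" "node J j \<le> 1" by (simp_all add: node_def)
  then show ?thesis by auto
qed

lemma cell_measurable: "j \<le> J \<Longrightarrow> J > 0 \<Longrightarrow> {node J (j - 1)<..<node J j} \<in> sets unit_measure"
  unfolding sets_restrict_space
  by (rule image_eqI[of _ _ "{node J (j - 1)<..<node J j}"]) (use cell_subset[of j J] in auto)

lemma step_fun_measurable:
  fixes d :: "nat \<Rightarrow> 'a::euclidean_space"
  assumes "J > 0" shows "step_fun J d \<in> borel_measurable unit_measure"
  unfolding step_fun_def[abs_def]
  by (intro borel_measurable_sum borel_measurable_scaleR borel_measurable_indicator cell_measurable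
      borel_measurable_const) (use assms in auto)

lemma measure_cell:
  assumes "j \<in> {1..J}"
  shows "measure unit_measure {node J (j - 1)<..<node J j} = 1 / real J"
proof -
  have "{node J (j - 1)<..<node J j} \<subseteq> {0<..<1}"
    using assms by (intro cell_subset) auto
  then have "measure unit_measure {node J (j - 1)<..<node J j} = measure lebesgue {node J (j - 1)<..<node J j}"
    by (intro measure_restrict_space) auto
  also have "\<dots> = node J j - node J (j - 1)" using node_mono[of "j - 1" j J] by simp
  also have "\<dots> = 1 / real J" using assms node_step[of j J] by auto
  finally show ?thesis .
qed

lemma integral_step_fun:
  fixes d :: "nat \<Rightarrow> real"
  assumes J: "J > 0"
  shows "integrable unit_measure (step_fun J d)"
    "(LINT \<rho>|unit_measure. step_fun J d \<rho>) = (\<Sum>j\<in>{1..J}. d j / real J)"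
proof -
  have i: "integrable unit_measure (\<lambda>\<rho>. indicator {node J (j - 1)<..<node J j} \<rho> *\<^sub>R d j)"
    if "j \<in> {1..J}" for j
  proof (rule bounded_unit_integrable)
    show "(\<lambda>\<rho>. indicator {node J (j - 1)<..<node J j} \<rho> *\<^sub>R d j) \<in> borel_measurable unit_measure"
      using that J by (intro borel_measurable_scaleR borel_measurable_indicator cell_measurable borel_measurable_const) auto
    show "norm (indicator {node J (j - 1)<..<node J j} \<rho> *\<^sub>R d j) \<le> \<bar>d j\<bar>" for \<rho>
      by (simp add: indicator_def)
  qed
  then show "integrable unit_measure (step_fun J d)"
    unfolding step_fun_def[abs_def] by (intro Bochner_Integration.integrable_sum) auto
  have "(LINT \<rho>|unit_measure. indicator {node J (j - 1)<..<node J j} \<rho> *\<^sub>R d j) = d j / real J"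
    if j: "j \<in> {1..J}" for j
  proof -
    have "{node J (j - 1)<..<node J j} \<subseteq> {0<..<1}"
      using j by (intro cell_subset) auto
    then have "space unit_measure \<inter> {node J (j - 1)<..<node J j} = {node J (j - 1)<..<node J j}" by auto
    then show ?thesis using measure_cell[OF j] by (simp add: Int_commute)
  qed
  then show "(LINT \<rho>|unit_measure. step_fun J d \<rho>) = (\<Sum>j\<in>{1..J}. d j / real J)"
    unfolding step_fun_def using i by (subst Bochner_Integration.integral_sum) auto
qed

lemma norm_step_fun_sq:
  fixes d :: "nat \<Rightarrow> 'a::real_normed_vector"
  assumes "J > 0" "\<rho> \<in> {0<..<1}"
  shows "(norm (step_fun J d \<rho>))\<^sup>2 = step_fun J (\<lambda>j. (norm (d j))\<^sup>2) \<rho>"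
proof (cases "\<rho> \<in> node J ` {..J}")
  case True
  then show ?thesis by (auto simp: step_fun_at_node)
next
  case False
  then obtain j where "j \<in> {1..J}" "\<rho> \<in> {node J (j - 1)<..<node J j}"
    using in_open_cell[of J \<rho>] assms by auto
  then show ?thesis by (simp add: step_fun_on_cell)
qed

lemma L2_step_fun:
  fixes d :: "nat \<Rightarrow> 'a::euclidean_space"
  assumes "J > 0"
  shows "L2_fun (step_fun J d)"
    "(LINT \<rho>|unit_measure. (norm (step_fun J d \<rho>))\<^sup>2) = (\<Sum>j\<in>{1..J}. (norm (d j))\<^sup>2 / real J)"
proof -
  have eq: "(norm (step_fun J d \<rho>))\<^sup>2 = step_fun J (\<lambda>j. (norm (d j))\<^sup>2) \<rho>" if "\<rho> \<in> space unit_measure" for \<rho>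
    using norm_step_fun_sq[OF assms, of \<rho> d] that by simp
  have "integrable unit_measure (\<lambda>\<rho>. (norm (step_fun J d \<rho>))\<^sup>2)"
    using integral_step_fun(1)[OF assms, of "\<lambda>j. (norm (d j))\<^sup>2"]
      Bochner_Integration.integrable_cong[OF refl eq, of unit_measure "\<lambda>\<rho>. \<rho>"] by simp
  then show "L2_fun (step_fun J d)"
    using step_fun_measurable[OF assms, of d] by (simp add: L2_fun_def)
  show "(LINT \<rho>|unit_measure. (norm (step_fun J d \<rho>))\<^sup>2) = (\<Sum>j\<in>{1..J}. (norm (d j))\<^sup>2 / real J)"
    using integral_step_fun(2)[OF assms, of "\<lambda>j. (norm (d j))\<^sup>2"]
      Bochner_Integration.integral_cong[OF refl eq, of unit_measure "\<lambda>\<rho>. \<rho>"] by simp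
qed

lemma interp_has_vector_derivative:
  fixes f :: "real \<Rightarrow> 'a::real_normed_vector"
  assumes "j \<in> {1..J}" "\<rho> \<in> {node J (j - 1)<..<node J j}"
  shows "(interp J f has_vector_derivative real J *\<^sub>R (f (node J j) - f (node J (j - 1)))) (at \<rho>)"
proof -
  have "((\<lambda>\<rho>. f (node J (j - 1)) + (real J * (\<rho> - node J (j - 1))) *\<^sub>R (f (node J j) - f (node J (j - 1))))
    has_vector_derivative real J *\<^sub>R (f (node J j) - f (node J (j - 1)))) (at \<rho>)"
    by (auto intro!: derivative_eq_intros)
  then show ?thesis
    by (rule has_vector_derivative_transform_within_open[of _ _ _ "{node J (j - 1)<..<node J j}"])
       (use assms interp_on_cell[OF assms(1), of _ f] in auto)
qed

text \<open>Integration by parts: the product of the test function and the interpolant is continuous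
  and differentiable off the finite set of nodes, which is enough for the fundamental theorem of
  calculus. The boundary terms vanish with the test function.\<close>

lemma weak_derivative_interp:
  fixes f :: "real \<Rightarrow> 'a::euclidean_space"
  assumes J: "J > 0"
  shows "weak_derivative (interp J f) (step_fun J (dminus (1 / real J) (\<lambda>j. f (node J j))))"
  unfolding weak_derivative_def
proof (intro allI impI)
  let ?g = "step_fun J (dminus (1 / real J) (\<lambda>j. f (node J j)))"
  let ?f = "interp J f"
  fix \<phi> \<phi>' assume t: "test_fun \<phi> \<phi>'"
  then have der: "(\<phi> has_real_derivative \<phi>' \<rho>) (at \<rho>)" for \<rho> by (simp add: test_fun_def)
  have c: "continuous_on {0..1} \<phi>"
    using der by (meson DERIV_continuous_on has_field_derivative_at_within)
  have c': "continuous_on {0..1} \<phi>'"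
    using t unfolding test_fun_def by (auto intro: continuous_on_subset)
  have i1: "integrable unit_measure (\<lambda>\<rho>. \<phi>' \<rho> *\<^sub>R ?f \<rho>)"
    by (intro continuous_unit_integrable continuous_intros c' continuous_interp)
  have "\<exists>B. \<forall>\<rho>\<in>{0..1}. norm (\<phi> \<rho>) \<le> B"
    using compact_imp_bounded[OF compact_continuous_image[OF c]] unfolding bounded_iff by auto
  then obtain B where B: "\<And>\<rho>. \<rho> \<in> {0..1} \<Longrightarrow> norm (\<phi> \<rho>) \<le> B" by blast
  have i2: "integrable unit_measure (\<lambda>\<rho>. \<phi> \<rho> *\<^sub>R ?g \<rho>)"
  proof (rule Bochner_Integration.integrable_bound[of _ "\<lambda>\<rho>. B * norm (?g \<rho>)"])
    show "integrable unit_measure (\<lambda>\<rho>. B * norm (?g \<rho>))"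
      using L2_fun_integrable[OF L2_step_fun(1)[OF J]] by (intro integrable_mult_right integrable_norm)
    show "(\<lambda>\<rho>. \<phi> \<rho> *\<^sub>R ?g \<rho>) \<in> borel_measurable unit_measure"
      by (rule borel_measurable_scaleR[OF continuous_unit_measurable[OF c] step_fun_measurable[OF J]])
    have "norm (\<phi> 0) \<le> B" using B[of 0] by simp
    then have "B \<ge> 0" using norm_ge_zero[of "\<phi> 0"] by linarith
    then show "AE x in unit_measure. norm (\<phi> x *\<^sub>R ?g x) \<le> norm (B * norm (?g x))"
      using B by (auto intro!: AE_I2 mult_right_mono simp: abs_mult)
  qed
  have "\<phi> 0 = 0" "\<phi> 1 = 0" using t unfolding test_fun_def by fastforce+
  moreover have "((\<lambda>\<rho>. \<phi> \<rho> *\<^sub>R ?g \<rho> + \<phi>' \<rho> *\<^sub>R ?f \<rho>) has_integral \<phi> 1 *\<^sub>R ?f 1 - \<phi> 0 *\<^sub>R ?f 0) {0..1}"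
  proof (rule fundamental_theorem_of_calculus_interior_strong[of "node J ` {..J}"])
    show "continuous_on {0..1} (\<lambda>\<rho>. \<phi> \<rho> *\<^sub>R ?f \<rho>)"
      by (intro continuous_intros c continuous_interp)
    fix \<rho> :: real assume "\<rho> \<in> {0<..<1} - node J ` {..J}"
    then obtain j where j: "j \<in> {1..J}" "\<rho> \<in> {node J (j - 1)<..<node J j}"
      using in_open_cell[of J \<rho>] J by auto
    have "?g \<rho> = real J *\<^sub>R (f (node J j) - f (node J (j - 1)))"
      using J by (simp add: step_fun_on_cell[OF j] dminus_def)
    then show "((\<lambda>\<rho>. \<phi> \<rho> *\<^sub>R ?f \<rho>) has_vector_derivative \<phi> \<rho> *\<^sub>R ?g \<rho> + \<phi>' \<rho> *\<^sub>R ?f \<rho>) (at \<rho>)"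
      using has_vector_derivative_scaleR[OF der interp_has_vector_derivative[OF j, of f]] by simp
  qed auto
  ultimately have "integral {0..1} (\<lambda>\<rho>. \<phi> \<rho> *\<^sub>R ?g \<rho> + \<phi>' \<rho> *\<^sub>R ?f \<rho>) = 0"
    by (intro integral_unique) simp
  then have "integral {0<..<1} (\<lambda>\<rho>. \<phi> \<rho> *\<^sub>R ?g \<rho> + \<phi>' \<rho> *\<^sub>R ?f \<rho>) = 0"
    by (simp only: integral_open_interval_real)
  then have "(LINT \<rho>|unit_measure. \<phi> \<rho> *\<^sub>R ?g \<rho> + \<phi>' \<rho> *\<^sub>R ?f \<rho>) = 0"
    by (subst lebesgue_integral_eq_integral) (use i1 i2 in auto)
  then show "(LINT \<rho>|unit_measure. \<phi>' \<rho> *\<^sub>R ?f \<rho>) = - (LINT \<rho>|unit_measure. \<phi> \<rho> *\<^sub>R ?g \<rho>)"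
    using i1 i2 by (simp add: add_eq_0_iff)
qed

text \<open>A convex combination is bounded by the larger of its two end values, whose square is at
  most the sum of both squares.\<close>

lemma interp_norm_sq_le:
  fixes f :: "real \<Rightarrow> 'a::real_normed_vector"
  assumes "j \<in> {1..J}" "\<rho> \<in> {node J (j - 1)..node J j}"
  shows "(norm (interp J f \<rho>))\<^sup>2 \<le> (norm (f (node J (j - 1))))\<^sup>2 + (norm (f (node J j)))\<^sup>2"
proof -
  let ?a = "f (node J (j - 1))" and ?b = "f (node J j)"
  define s where "s = real J * (\<rho> - node J (j - 1))"
  have "s \<le> real J * (node J j - node J (j - 1))"
    unfolding s_def using assms by (intro mult_left_mono) auto
  also have "\<dots> = 1" using assms node_step[of j J] by simp
  finally have s: "0 \<le> s" "s \<le> 1" using assms by (auto simp: s_def)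
  have "interp J f \<rho> = (1 - s) *\<^sub>R ?a + s *\<^sub>R ?b"
    using interp_on_cell[OF assms, of f] by (simp add: s_def algebra_simps)
  then have "norm (interp J f \<rho>) \<le> (1 - s) * norm ?a + s * norm ?b"
    using s norm_triangle_ineq[of "(1 - s) *\<^sub>R ?a" "s *\<^sub>R ?b"] by simp
  also have "\<dots> \<le> (1 - s) * max (norm ?a) (norm ?b) + s * max (norm ?a) (norm ?b)"
    using s by (intro add_mono mult_left_mono) auto
  also have "\<dots> = max (norm ?a) (norm ?b)" by (simp add: algebra_simps)
  finally have "(norm (interp J f \<rho>))\<^sup>2 \<le> (max (norm ?a) (norm ?b))\<^sup>2" by (intro power_mono) auto
  also have "\<dots> \<le> (norm ?a)\<^sup>2 + (norm ?b)\<^sup>2" by (auto simp: max_def)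
  finally show ?thesis .
qed

text \<open>The passage from the Sobolev norm to sums over nodes. The gradient part is computed
  exactly; the function part uses a crude bound on each cell, which loses only a constant
  factor.\<close>

lemma H1_norm_interp_le:
  fixes f :: "real \<Rightarrow> 'a::euclidean_space"
  assumes J: "J > 0"
  shows "(H1_norm (interp J f))\<^sup>2 \<le> (\<Sum>j\<in>{1..J}. ((norm (f (node J (j - 1))))\<^sup>2 + (norm (f (node J j)))\<^sup>2) / real J)
     + (\<Sum>j\<in>{1..J}. (norm (dminus (1 / real J) (\<lambda>j. f (node J j)) j))\<^sup>2 / real J)"
proof -
  let ?d = "\<lambda>j. (norm (f (node J (j - 1))))\<^sup>2 + (norm (f (node J j)))\<^sup>2"
  have "AE \<rho> in unit_measure. (norm (interp J f \<rho>))\<^sup>2 \<le> step_fun J ?d \<rho>"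
  proof (rule AE_I'[of "node J ` {..J} \<inter> {0<..<1}"])
    have "node J ` {..J} \<inter> {0<..<1} \<in> null_sets lebesgue"
      unfolding negligible_iff_null_sets[symmetric] by (rule negligible_finite) simp
    then show "node J ` {..J} \<inter> {0<..<1} \<in> null_sets unit_measure"
      by (subst null_sets_restrict_space) simp_all
    show "{\<rho> \<in> space unit_measure. \<not> (norm (interp J f \<rho>))\<^sup>2 \<le> step_fun J ?d \<rho>} \<subseteq> node J ` {..J} \<inter> {0<..<1}"
    proof (safe, rule ccontr)
      fix \<rho> assume \<rho>: "\<rho> \<in> space unit_measure" "\<not> (norm (interp J f \<rho>))\<^sup>2 \<le> step_fun J ?d \<rho>" "\<rho> \<notin> node J ` {..J}"
      then obtain j where j: "j \<in> {1..J}" "\<rho> \<in> {node J (j - 1)<..<node J j}"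
        using in_open_cell[of J \<rho>] J by auto
      then have "(norm (interp J f \<rho>))\<^sup>2 \<le> step_fun J ?d \<rho>"
        using interp_norm_sq_le[of j J \<rho> f] by (simp add: step_fun_on_cell)
      then show False using \<rho> by simp
    qed simp
  qed
  then have "(LINT \<rho>|unit_measure. (norm (interp J f \<rho>))\<^sup>2) \<le> (LINT \<rho>|unit_measure. step_fun J ?d \<rho>)"
    by (intro integral_mono_AE integral_step_fun J continuous_unit_integrable continuous_intros continuous_interp)
  then show ?thesis
    by (simp add: H1_norm_eq[OF L2_step_fun(1)[OF J] weak_derivative_interp[OF J]]
        L2_step_fun(2)[OF J] integral_step_fun(2)[OF J])
qed

section \<open>Level sets\<close>

lemma has_derivative_grad:
  fixes F :: "real^'n::finite \<Rightarrow> real"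
  assumes "F differentiable (at z)"
  shows "(F has_derivative (\<lambda>v. grad F z \<bullet> v)) (at z)"
proof -
  let ?D = "frechet_derivative F (at z)"
  have D: "(F has_derivative ?D) (at z)" using assms frechet_derivative_works by blast
  interpret linear ?D using D by (rule has_derivative_linear)
  have "?D v = grad F z \<bullet> v" for v
  proof -
    have "?D v = ?D (\<Sum>i\<in>UNIV. v $ i *\<^sub>R axis i 1)"
      using basis_expansion[of v] by (simp add: scalar_mult_eq_scaleR)
    also have "\<dots> = (\<Sum>i\<in>UNIV. v $ i * partial i F z)" by (simp add: sum scaleR partial_def)
    also have "\<dots> = grad F z \<bullet> v" by (simp add: inner_vec_def grad_def mult.commute)
    finally show ?thesis .
  qed
  then show ?thesis using D by (metis ext)
qed

text \<open>By the index order in \<open>hessian\<close>, its row \<open>i\<close> is the gradient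
  of \<open>partial i F\<close>, so the matrix product collects the directional derivatives of the
  components of \<open>grad F\<close>.\<close>

lemma has_derivative_grad_hessian:
  fixes F :: "real^'n::finite \<Rightarrow> real"
  assumes "\<And>i. partial i F differentiable (at z)"
  shows "(grad F has_derivative (\<lambda>v. hessian F z *v v)) (at z)"
proof -
  have "((\<lambda>z. grad F z $ i) has_derivative (\<lambda>v. (hessian F z *v v) $ i)) (at z)" for i
    using has_derivative_grad[OF assms[of i]]
    by (simp add: grad_def hessian_def matrix_vector_mult_def inner_vec_def)
  then show ?thesis by (simp add: has_derivative_componentwise_within[of "grad F"] Basis_vec_def cart_eq_inner_axis inner_commute)
qed

text \<open>The boundary condition of the continuous problem speaks of velocities of curves in the
  surface. To exploit it, each vector orthogonal to the gradient must be realized as such a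
  velocity. The inverse function theorem is applied to \<Phi> (s, r) = (s, F (p + s v + r \<nu>)) in
  the plane spanned by \<open>v\<close> and \<nu>; the curve is the preimage of the axis r = 0 under
  the second component.\<close>

lemma tangent_space_level_set:
  fixes F :: "real^'n::finite \<Rightarrow> real"
  assumes U: "open U" "p \<in> U" and diff: "\<And>z. z \<in> U \<Longrightarrow> F differentiable (at z)"
    and cont: "continuous_on U (grad F)"
    and p: "F p = 0" "norm (grad F p) = 1" and v: "grad F p \<bullet> v = 0"
  shows "v \<in> tangent_space {z \<in> U. F z = 0} p"
proof -
  define \<nu> where "\<nu> = grad F p"
  have \<nu>: "\<nu> \<bullet> \<nu> = 1" using p(2) by (simp add: \<nu>_def norm_eq_1)
  define \<Psi> :: "real \<times> real \<Rightarrow> real^'n" where "\<Psi> y = p + fst y *\<^sub>R v + snd y *\<^sub>R \<nu>" for y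
  define W where "W = \<Psi> -` U"
  \<comment> \<open>Writing the derivative of \<Phi> as a combination of three fixed operators
    reduces its continuity in \<open>y\<close> to that of the two scalar coefficients.\<close>
  define A0 A1 A2 :: "(real \<times> real) \<Rightarrow>\<^sub>L (real \<times> real)"
    where "A0 = Blinfun (\<lambda>y. (fst y, 0))" and "A1 = Blinfun (\<lambda>y. (0, fst y))" and "A2 = Blinfun (\<lambda>y. (0, snd y))"
  have A: "blinfun_apply A0 y = (fst y, 0)" "blinfun_apply A1 y = (0, fst y)" "blinfun_apply A2 y = (0, snd y)" for y
    unfolding A0_def A1_def A2_def
    by (subst bounded_linear_Blinfun_apply,
        (intro bounded_linear_Pair bounded_linear_fst bounded_linear_snd bounded_linear_zero), simp)+
  define \<Phi> where "\<Phi> y = (fst y, F (\<Psi> y))" for y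
  define \<Phi>' where "\<Phi>' y = A0 + (grad F (\<Psi> y) \<bullet> v) *\<^sub>R A1 + (grad F (\<Psi> y) \<bullet> \<nu>) *\<^sub>R A2" for y
  have \<Psi>0: "\<Psi> (0, 0) = p" by (simp add: \<Psi>_def)
  have cont\<Psi>: "continuous_on S \<Psi>" for S unfolding \<Psi>_def[abs_def] by (intro continuous_intros)
  have W: "open W" unfolding W_def by (rule open_vimage[OF U(1) cont\<Psi>])
  have der: "(\<Phi> has_derivative blinfun_apply (\<Phi>' y)) (at y)" if "y \<in> W" for y
  proof -
    have \<Psi>: "(\<Psi> has_derivative (\<lambda>w. fst w *\<^sub>R v + snd w *\<^sub>R \<nu>)) (at y)"
      unfolding \<Psi>_def[abs_def] by (auto intro!: derivative_eq_intros)
    have "((\<lambda>y. F (\<Psi> y)) has_derivative (\<lambda>w. grad F (\<Psi> y) \<bullet> (fst w *\<^sub>R v + snd w *\<^sub>R \<nu>))) (at y)"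
      using has_derivative_compose[OF \<Psi> has_derivative_grad[OF diff]] that by (simp add: W_def)
    then have "(\<Phi> has_derivative (\<lambda>w. (fst w, grad F (\<Psi> y) \<bullet> (fst w *\<^sub>R v + snd w *\<^sub>R \<nu>)))) (at y)"
      unfolding \<Phi>_def[abs_def] by (auto intro!: derivative_eq_intros)
    moreover have "blinfun_apply (\<Phi>' y) = (\<lambda>w. (fst w, grad F (\<Psi> y) \<bullet> (fst w *\<^sub>R v + snd w *\<^sub>R \<nu>)))"
      by (rule ext) (simp add: \<Phi>'_def A blinfun.add_left blinfun.scaleR_left inner_add_right mult.commute)
    ultimately show ?thesis by simp
  qed
  have "continuous_on W (\<lambda>y. grad F (\<Psi> y))"
    by (rule continuous_on_compose2[OF cont cont\<Psi>]) (auto simp: W_def)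
  then have cont\<Phi>: "continuous_on W \<Phi>'" unfolding \<Phi>'_def[abs_def] by (intro continuous_intros)
  \<comment> \<open>At the base point F has derivative 0 along \<open>v\<close> and 1 along
    \<nu>.\<close>
  have id: "\<Phi>' (0, 0) = id_blinfun"
    by (rule blinfun_eqI) (simp add: \<Phi>'_def A blinfun.add_left blinfun.scaleR_left \<Psi>0 v \<nu> flip: \<nu>_def,
      simp add: \<nu>_def v)
  have "id_blinfun o\<^sub>L \<Phi>' (0, 0) = id_blinfun" unfolding id by (rule blinfun_eqI) simp
  moreover have "(0, 0) \<in> W" using U(2) by (simp add: W_def \<Psi>0)
  ultimately obtain U' V g g' where *: "open U'" "U' \<subseteq> W" "(0, 0) \<in> U'" "open V" "\<Phi> (0, 0) \<in> V" "homeomorphism U' V \<Phi> g"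
    "\<And>y. y \<in> V \<Longrightarrow> (g has_derivative (g' y)) (at y)"
    "\<And>y. y \<in> V \<Longrightarrow> g' y = inv (blinfun_apply (\<Phi>' (g y)))"
    using inverse_function_theorem[OF W der cont\<Phi>, of "(0, 0)" id_blinfun] by metis
  have \<Phi>0: "\<Phi> (0, 0) = (0, 0)" by (simp add: \<Phi>_def \<Psi>0 p)
  have g0: "g (0, 0) = (0, 0)" using homeomorphism_apply1[OF *(6) *(3)] \<Phi>0 by simp
  \<comment> \<open>Hence the local inverse moves along the first axis with unit speed, and the
    curve starts with velocity \<open>v\<close>.\<close>
  have g'0: "g' (0, 0) = (\<lambda>w. w)" using *(8)[OF *(5)] by (simp add: \<Phi>0 g0 id inv_id[unfolded id_def])
  have inV: "open ((\<lambda>s::real. (s, 0::real)) -` V)"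
    by (rule open_vimage[OF *(4)]) (intro continuous_intros)
  then obtain \<epsilon> where \<epsilon>: "\<epsilon> > 0" "ball 0 \<epsilon> \<subseteq> (\<lambda>s::real. (s, 0::real)) -` V"
    using *(5) \<Phi>0 unfolding open_contains_ball by force
  define \<gamma> where "\<gamma> s = \<Psi> (g (s, 0))" for s
  have V: "(s, 0) \<in> V" if "s \<in> {-\<epsilon><..<\<epsilon>}" for s using \<epsilon> that by (auto simp: subset_iff dist_real_def)
  have level: "\<gamma> s \<in> {z \<in> U. F z = 0}" if "s \<in> {-\<epsilon><..<\<epsilon>}" for s
  proof -
    have "\<Phi> (g (s, 0)) = (s, 0)" "g (s, 0) \<in> U'"
      using homeomorphism_apply2[OF *(6) V[OF that]] *(6) V[OF that] by (auto simp: homeomorphism_def)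
    then show ?thesis using *(2) by (auto simp: \<gamma>_def \<Phi>_def W_def)
  qed
  have \<gamma>der: "(\<gamma> has_derivative (\<lambda>h. fst (g' (s, 0) (h, 0)) *\<^sub>R v + snd (g' (s, 0) (h, 0)) *\<^sub>R \<nu>)) (at s)"
    if "s \<in> {-\<epsilon><..<\<epsilon>}" for s
  proof -
    have "((\<lambda>s. (s, 0::real)) has_derivative (\<lambda>h. (h, 0))) (at s)" by (auto intro!: derivative_eq_intros)
    from has_derivative_compose[OF this *(7)[OF V[OF that]]]
    have "((\<lambda>s. g (s, 0)) has_derivative (\<lambda>h. g' (s, 0) (h, 0))) (at s)" .
    then show ?thesis unfolding \<gamma>_def[abs_def] \<Psi>_def[abs_def] by (auto intro!: derivative_eq_intros)
  qed
  have "\<gamma> 0 = p" by (simp add: \<gamma>_def g0 \<Psi>0)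
  moreover have "(\<gamma> has_vector_derivative v) (at 0)"
    using \<gamma>der[of 0] \<epsilon> by (simp add: has_vector_derivative_def g'0)
  moreover have "\<gamma> differentiable (at s)" if "s \<in> {-\<epsilon><..<\<epsilon>}" for s
    using \<gamma>der[OF that] differentiable_def by blast
  ultimately show ?thesis using level \<epsilon>(1) unfolding tangent_space_def by blast
qed

section \<open>The energy estimate\<close>

text \<open>The coordinate-free form of \<open>Pmat\<close> for a unit vector \<nu>. It lets the
  stability and consistency arguments run in an arbitrary real inner product space;
  \<open>Pmat_mult\<close> makes the connection.\<close>

definition proj :: "'a::real_inner \<Rightarrow> 'a \<Rightarrow> 'a" where
  "proj \<nu> v = v - (v \<bullet> \<nu>) *\<^sub>R \<nu>"

lemma proj_add: "proj \<nu> (v + w) = proj \<nu> v + proj \<nu> w"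
  by (simp add: proj_def inner_add_left scaleR_left_distrib)

lemma proj_diff: "proj \<nu> (v - w) = proj \<nu> v - proj \<nu> w"
  by (simp add: proj_def inner_diff_left scaleR_left_diff_distrib)

lemma proj_scaleR: "proj \<nu> (c *\<^sub>R v) = c *\<^sub>R proj \<nu> v"
  by (simp add: proj_def scaleR_right_diff_distrib)

lemma inner_proj_normal: "norm \<nu> = 1 \<Longrightarrow> proj \<nu> v \<bullet> \<nu> = 0"
  by (simp add: proj_def inner_diff_left norm_eq_1)

lemma proj_tangential: "v \<bullet> \<nu> = 0 \<Longrightarrow> proj \<nu> v = v"
  by (simp add: proj_def)

lemma inner_proj_split: "norm \<nu> = 1 \<Longrightarrow> v \<bullet> w = proj \<nu> v \<bullet> proj \<nu> w + (v \<bullet> \<nu>) * (w \<bullet> \<nu>)"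
  by (simp add: proj_def inner_diff_left inner_diff_right norm_eq_1 inner_commute algebra_simps)

lemma norm_proj_sq: "norm \<nu> = 1 \<Longrightarrow> (norm v)\<^sup>2 = (norm (proj \<nu> v))\<^sup>2 + (v \<bullet> \<nu>)\<^sup>2"
  unfolding power2_norm_eq_inner by (simp add: inner_proj_split[of \<nu> v v] power2_eq_square)

lemma norm_proj_le: "norm \<nu> = 1 \<Longrightarrow> norm (proj \<nu> v) \<le> norm v"
  by (rule power2_le_imp_le[OF _ norm_ge_zero]) (simp only: norm_proj_sq[of \<nu> v], simp)

text \<open>Discrete Green formula. The two boundary terms are the only ones without a sign, and the
  boundary conditions have to control them.\<close>

lemma summation_by_parts:
  fixes E :: "nat \<Rightarrow> 'a::real_inner"
  assumes "h > 0" "J \<ge> 1"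
  shows "(\<Sum>j\<in>{1..<J}. h * (d2 h E j \<bullet> E j)) =
    - (\<Sum>j\<in>{1..J}. h * (norm (dminus h E j))\<^sup>2) + dminus h E J \<bullet> E J - dplus h E 0 \<bullet> E 0"
  using assms(2)
proof (induction J rule: nat_induct_at_least)
  case base
  have "E 1 = E 0 + h *\<^sub>R dminus h E 1" using assms(1) by (simp add: dminus_def)
  moreover have "dplus h E 0 = dminus h E 1" by (simp add: dminus_def dplus_def)
  ultimately show ?case by (simp add: power2_norm_eq_inner inner_add_right inner_commute)
next
  case (Suc J)
  have eq: "dplus h E J = dminus h E (Suc J)" by (simp add: dminus_def dplus_def)
  have E: "E (Suc J) = E J + h *\<^sub>R dminus h E (Suc J)" using assms(1) by (simp add: dminus_def)
  have "h * (d2 h E J \<bullet> E J) = dminus h E (Suc J) \<bullet> E J - dminus h E J \<bullet> E J"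
    using assms(1) by (simp add: d2_def eq inner_diff_left)
  moreover have "dminus h E (Suc J) \<bullet> E (Suc J) = dminus h E (Suc J) \<bullet> E J + h * (norm (dminus h E (Suc J)))\<^sup>2"
    by (simp add: E inner_add_right power2_norm_eq_inner)
  moreover have "{1..Suc J} = insert (Suc J) {1..J}" "{1..<Suc J} = insert J {1..<J}" using Suc by auto
  ultimately show ?case using Suc.IH by simp
qed

text \<open>Each interior equation is multiplied by h E j and summed. The hypotheses
  \<open>left\<close> and \<open>right\<close> may each lose a quarter of the h-weighted squared
  quotient in the adjacent cell; these losses are paid from the gradient sum, which keeps the factor
  1/2. In both, the quotient points into the interval, hence the minus sign at
  \<open>J\<close>.\<close>

lemma energy_estimate:
  fixes E r :: "nat \<Rightarrow> 'a::real_inner"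
  assumes h: "h > 0" and dt: "dt > 0" and m: "m > 0" and J: "J \<ge> 1"
    and interior: "\<And>j. j \<in> {1..<J} \<Longrightarrow> (p j / dt) *\<^sub>R E j - d2 h E j = r j"
    and p: "\<And>j. j \<in> {1..<J} \<Longrightarrow> m \<le> p j" and r: "\<And>j. j \<in> {1..<J} \<Longrightarrow> norm (r j) \<le> \<epsilon>"
    and left: "E 0 \<bullet> dplus h E 0 \<ge> a - h / 4 * (norm (dplus h E 0))\<^sup>2 - B"
    and right: "E J \<bullet> (- dminus h E J) \<ge> b - h / 4 * (norm (- dminus h E J))\<^sup>2 - B"
  shows "m / (2 * dt) * (\<Sum>j\<in>{1..<J}. h * (norm (E j))\<^sup>2) + 1/2 * (\<Sum>j\<in>{1..J}. h * (norm (dminus h E j))\<^sup>2) + a + b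
    \<le> dt / (2 * m) * (h * real J) * \<epsilon>\<^sup>2 + 2 * B"
proof -
  define D where "D = (\<Sum>j\<in>{1..J}. h * (norm (dminus h E j))\<^sup>2)"
  have pt: "m / (2 * dt) * (h * (norm (E j))\<^sup>2) \<le> h * (d2 h E j \<bullet> E j) + dt / (2 * m) * (h * \<epsilon>\<^sup>2)"
    if j: "j \<in> {1..<J}" for j
  proof -
    define u where "u = m / (2 * dt) * (norm (E j))\<^sup>2"
    define v where "v = p j / dt * (norm (E j))\<^sup>2"
    define s where "s = dt / (2 * m) * \<epsilon>\<^sup>2"
    have "v - d2 h E j \<bullet> E j = r j \<bullet> E j"
      unfolding v_def using interior[OF j, symmetric] by (simp add: inner_diff_left power2_norm_eq_inner)
    moreover have "m / dt * (norm (E j))\<^sup>2 \<le> v"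
      unfolding v_def using p[OF j] dt by (intro mult_right_mono divide_right_mono) auto
    moreover have "r j \<bullet> E j \<le> u + s"
    proof -
      \<comment> \<open>Young's inequality, weighted so that the residual consumes half of the mass
        term m / dt.\<close>
      have "0 \<le> (m * norm (E j) - dt * norm (r j))\<^sup>2 / (2 * dt * m)" using dt m by simp
      then have "norm (r j) * norm (E j) \<le> m / (2 * dt) * (norm (E j))\<^sup>2 + dt / (2 * m) * (norm (r j))\<^sup>2"
        using dt m by (simp add: power2_diff field_simps power2_eq_square)
      moreover have "r j \<bullet> E j \<le> norm (r j) * norm (E j)" by (rule norm_cauchy_schwarz)
      moreover have "dt / (2 * m) * (norm (r j))\<^sup>2 \<le> dt / (2 * m) * \<epsilon>\<^sup>2"
        using r[OF j] dt m by (intro mult_left_mono power_mono) auto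
      ultimately show ?thesis unfolding u_def s_def by linarith
    qed
    moreover have "m / dt * (norm (E j))\<^sup>2 = u + u"
      by (simp add: u_def field_simps)
    ultimately have "u \<le> d2 h E j \<bullet> E j + s" by linarith
    then have "h * u \<le> h * (d2 h E j \<bullet> E j + s)"
      using h by (intro mult_left_mono) auto
    then show ?thesis by (simp add: algebra_simps u_def s_def)
  qed
  have "m / (2 * dt) * (\<Sum>j\<in>{1..<J}. h * (norm (E j))\<^sup>2)
      \<le> (\<Sum>j\<in>{1..<J}. h * (d2 h E j \<bullet> E j)) + (\<Sum>j\<in>{1..<J}. dt / (2 * m) * (h * \<epsilon>\<^sup>2))"
    unfolding sum_distrib_left sum.distrib[symmetric] by (rule sum_mono[OF pt])
  moreover have "(\<Sum>j\<in>{1..<J}. dt / (2 * m) * (h * \<epsilon>\<^sup>2)) \<le> dt / (2 * m) * (h * real J) * \<epsilon>\<^sup>2"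
  proof -
    have "(\<Sum>j\<in>{1..<J}. dt / (2 * m) * (h * \<epsilon>\<^sup>2)) = real (J - 1) * (dt / (2 * m) * (h * \<epsilon>\<^sup>2))" by simp
    also have "\<dots> \<le> real J * (dt / (2 * m) * (h * \<epsilon>\<^sup>2))" using dt m h by (intro mult_right_mono) auto
    finally show ?thesis by (simp add: algebra_simps)
  qed
  moreover have "(\<Sum>j\<in>{1..<J}. h * (d2 h E j \<bullet> E j)) = - D - E J \<bullet> (- dminus h E J) - E 0 \<bullet> dplus h E 0"
    using summation_by_parts[OF h J, of E] by (simp add: D_def inner_commute)
  \<comment> \<open>The boundary quotient is the summand of \<open>D\<close> for the first
    cell.\<close>
  moreover have "h * (norm (dplus h E 0))\<^sup>2 \<le> D"
  proof -
    have "h * (norm (dminus h E 1))\<^sup>2 \<le> D" unfolding D_def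
      by (rule member_le_sum[of 1]) (use h J in auto)
    then show ?thesis by (simp add: dplus_def dminus_def)
  qed
  moreover have "h * (norm (- dminus h E J))\<^sup>2 \<le> D" unfolding D_def norm_minus_cancel
    by (rule member_le_sum[of J]) (use h J in auto)
  ultimately show ?thesis using left right unfolding D_def[symmetric] by linarith
qed

text \<open>Split the product of \<open>e\<close> and \<open>d\<close> into tangential and normal
  parts. Tangentially, \<open>T\<close> replaces the quotient by h Q / (2 dt) times the projected
  error, and this factor is at least m / (2 \<gamma>). Normally, \<open>d\<close> is only known
  through its norm, so Young's inequality trades it for h |d|^2 / 4 and the squared normal error
  divided by h. The threshold in \<open>Q\<close> adds up what must be paid: K for the curvature
  term \<open>w\<close>, 1/2 for the residual \<open>R\<close>, 8 K^2 for the normal error, and 1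
  for the square that is kept.\<close>

lemma boundary_coercive:
  fixes e d \<nu> w R :: "'a::real_inner"
  assumes \<nu>: "norm \<nu> = 1" and h: "0 < h" "h \<le> 1" and dt: "0 < dt" "dt \<le> \<gamma> * h" and \<gamma>: "0 < \<gamma>" "\<gamma> \<le> 1" and K: "0 \<le> K"
    and N: "\<bar>e \<bullet> \<nu>\<bar> \<le> K * dt * norm e + Rn" "K * dt \<le> 1/2" "0 \<le> Rn"
    and T: "proj \<nu> d = (h * Q / (2 * dt)) *\<^sub>R proj \<nu> e + w + R" "norm w \<le> K * norm (proj \<nu> e)" "norm R \<le> Rt"
    and Q: "m \<le> Q" "K + 3/2 + 8 * K\<^sup>2 \<le> m / (2 * \<gamma>)"
  shows "e \<bullet> d \<ge> (norm (proj \<nu> e))\<^sup>2 - h / 4 * (norm d)\<^sup>2 - (Rt\<^sup>2 / 2 + 8 * Rn\<^sup>2 / h)"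
    and "norm e \<le> 2 * norm (proj \<nu> e) + 2 * Rn"
proof -
  define t where "t = norm (proj \<nu> e)"
  define n where "n = \<bar>e \<bullet> \<nu>\<bar>"
  have t0: "t \<ge> 0" and n0: "n \<ge> 0" by (auto simp: t_def n_def)
  have "norm e \<le> norm (proj \<nu> e) + norm ((e \<bullet> \<nu>) *\<^sub>R \<nu>)"
    unfolding proj_def by (metis diff_add_cancel norm_triangle_ineq)
  then have e1: "norm e \<le> t + n" using \<nu> by (simp add: t_def n_def)
  \<comment> \<open>With K dt at most 1/2, half of the norm of \<open>e\<close> can be absorbed, so
    the tangential part controls all of \<open>e\<close> up to \<open>Rn\<close>.\<close>
  have "K * dt * norm e \<le> 1/2 * norm e" using N(2) by (intro mult_right_mono) auto
  then have nR: "n \<le> 1/2 * norm e + Rn" using N(1) by (simp add: n_def)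
  then show e2: "norm e \<le> 2 * norm (proj \<nu> e) + 2 * Rn" using e1 by (simp add: t_def)
  have mpos: "m \<ge> 0"
  proof (rule ccontr)
    assume "\<not> m \<ge> 0"
    then have "m / (2 * \<gamma>) < 0" using \<gamma> by (simp add: divide_neg_pos)
    then show False using Q(2) K zero_le_power2[of K] by linarith
  qed
  have "n \<le> K * dt * (2 * t + 2 * Rn) + Rn"
  proof -
    have "K * dt * norm e \<le> K * dt * (2 * t + 2 * Rn)"
      using e2 K dt by (intro mult_left_mono) (auto simp: t_def)
    then show ?thesis using N(1) by (simp add: n_def)
  qed
  also have "\<dots> = 2 * (K * dt * t) + (2 * (K * dt) * Rn + Rn)" by (simp add: algebra_simps)
  also have "2 * (K * dt) * Rn \<le> 2 * (1/2) * Rn" using N(2,3) by (intro mult_right_mono) auto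
  finally have "n \<le> 2 * (K * dt * t) + 2 * Rn" by simp
  then have "n\<^sup>2 \<le> (2 * (K * dt * t) + 2 * Rn)\<^sup>2" using n0 by (intro power_mono) auto
  also have "\<dots> \<le> 8 * (K * dt * t)\<^sup>2 + 8 * Rn\<^sup>2"
    using zero_le_power2[of "K * dt * t - Rn"] by (simp add: power2_diff power2_sum power_mult_distrib)
  finally have "n\<^sup>2 / h \<le> (8 * (K * dt * t)\<^sup>2 + 8 * Rn\<^sup>2) / h" using h by (intro divide_right_mono) auto
  also have "\<dots> = 8 * K\<^sup>2 * t\<^sup>2 * (dt\<^sup>2 / h) + 8 * Rn\<^sup>2 / h"
    by (simp add: power_mult_distrib add_divide_distrib mult_ac)
  \<comment> \<open>This compensates the division by h: the feedback of the tangential error into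
    the normal one carries a factor dt.\<close>
  also have "dt\<^sup>2 / h \<le> 1"
  proof -
    have "dt \<le> h" using dt(2) \<gamma> h mult_right_mono[of \<gamma> 1 h] by linarith
    then have "dt * dt \<le> h * 1" using dt h by (intro mult_mono) auto
    then show ?thesis using h by (simp add: power2_eq_square)
  qed
  then have "8 * K\<^sup>2 * t\<^sup>2 * (dt\<^sup>2 / h) \<le> 8 * K\<^sup>2 * t\<^sup>2 * 1" by (intro mult_left_mono) auto
  finally have n2: "n\<^sup>2 / h \<le> 8 * K\<^sup>2 * t\<^sup>2 + 8 * Rn\<^sup>2 / h" by simp
  have nd: "\<bar>(e \<bullet> \<nu>) * (d \<bullet> \<nu>)\<bar> \<le> h / 4 * (norm d)\<^sup>2 + n\<^sup>2 / h"
  proof -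
    have "\<bar>(e \<bullet> \<nu>) * (d \<bullet> \<nu>)\<bar> \<le> n * norm d"
      unfolding abs_mult n_def using Cauchy_Schwarz_ineq2[of d \<nu>] \<nu> by (intro mult_left_mono) auto
    also have "\<dots> \<le> h / 4 * (norm d)\<^sup>2 + n\<^sup>2 / h"
    proof -
      have "0 \<le> (h * norm d - 2 * n)\<^sup>2 / (4 * h)" using h by simp
      then show ?thesis using h by (simp add: power2_diff field_simps power2_eq_square)
    qed
    finally show ?thesis .
  qed
  \<comment> \<open>The only place where the step restriction dt \<le> \<gamma> h yields a large
    coercivity constant.\<close>
  have "m / (2 * \<gamma>) * t\<^sup>2 \<le> h * Q / (2 * dt) * t\<^sup>2"
  proof -
    have "m * dt \<le> m * (\<gamma> * h)" using dt mpos by (intro mult_left_mono) auto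
    also have "\<dots> \<le> Q * (\<gamma> * h)" using Q \<gamma> h by (intro mult_right_mono) auto
    finally have "m / (2 * \<gamma>) \<le> h * Q / (2 * dt)" using \<gamma> dt by (simp add: field_simps)
    then show ?thesis by (intro mult_right_mono) auto
  qed
  moreover have "proj \<nu> e \<bullet> proj \<nu> d = h * Q / (2 * dt) * t\<^sup>2 + proj \<nu> e \<bullet> w + proj \<nu> e \<bullet> R"
    unfolding T(1) by (simp add: inner_add_right t_def power2_norm_eq_inner)
  moreover have "\<bar>proj \<nu> e \<bullet> w\<bar> \<le> K * t\<^sup>2"
  proof -
    have "\<bar>proj \<nu> e \<bullet> w\<bar> \<le> t * norm w" unfolding t_def by (rule Cauchy_Schwarz_ineq2)
    also have "\<dots> \<le> t * (K * t)" using T(2) t0 by (intro mult_left_mono) (auto simp: t_def)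
    finally show ?thesis by (simp add: power2_eq_square mult_ac)
  qed
  moreover have "\<bar>proj \<nu> e \<bullet> R\<bar> \<le> t\<^sup>2 / 2 + Rt\<^sup>2 / 2"
  proof -
    have "\<bar>proj \<nu> e \<bullet> R\<bar> \<le> t * norm R" unfolding t_def by (rule Cauchy_Schwarz_ineq2)
    also have "\<dots> \<le> t * Rt" using T(3) t0 by (intro mult_left_mono) auto
    also have "\<dots> \<le> t\<^sup>2 / 2 + Rt\<^sup>2 / 2"
      using zero_le_power2[of "t - Rt"] by (simp add: power2_diff)
    finally show ?thesis .
  qed
  moreover have "(K + 3/2 + 8 * K\<^sup>2) * t\<^sup>2 \<le> m / (2 * \<gamma>) * t\<^sup>2"
    using Q(2) by (intro mult_right_mono) auto
  then have "K * t\<^sup>2 + 3/2 * t\<^sup>2 + 8 * K\<^sup>2 * t\<^sup>2 \<le> m / (2 * \<gamma>) * t\<^sup>2" by (simp add: algebra_simps)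
  ultimately show "e \<bullet> d \<ge> (norm (proj \<nu> e))\<^sup>2 - h / 4 * (norm d)\<^sup>2 - (Rt\<^sup>2 / 2 + 8 * Rn\<^sup>2 / h)"
    using nd n2 inner_proj_split[OF \<nu>, of e d] unfolding t_def[symmetric] by linarith
qed

section \<open>Shooting: solvability of the interior equations with two boundary conditions\<close>

fun march :: "(nat \<Rightarrow> real) \<Rightarrow> real \<Rightarrow> (nat \<Rightarrow> 'a::real_vector) \<Rightarrow> 'a \<Rightarrow> 'a \<Rightarrow> nat \<Rightarrow> 'a" where
  "march p h g a b 0 = a"
| "march p h g a b (Suc 0) = b"
| "march p h g a b (Suc (Suc n)) = 2 *\<^sub>R march p h g a b (Suc n) - march p h g a b n +
     h\<^sup>2 *\<^sub>R (p (Suc n) *\<^sub>R march p h g a b (Suc n) - g (Suc n))"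

text \<open>\<open>march\<close> is the equation at node \<open>j\<close> solved for the value at
  node \<open>j + 1\<close>; its arguments \<open>a\<close> and \<open>b\<close> are the free values
  at the nodes 0 and 1.\<close>

lemma march_solves:
  assumes "h \<noteq> 0" "j \<ge> 1"
  shows "p j *\<^sub>R march p h g a b j - d2 h (march p h g a b) j = g j"
proof -
  obtain n where n: "j = Suc n" using assms(2) by (cases j) auto
  let ?Y = "march p h g a b"
  have "d2 h ?Y j = (1 / h\<^sup>2) *\<^sub>R (?Y (Suc (Suc n)) - 2 *\<^sub>R ?Y (Suc n) + ?Y n)"
  proof -
    have "(u - v) /\<^sub>R h - (v - w) /\<^sub>R h = (u - 2 *\<^sub>R v + w) /\<^sub>R h" for u v w :: 'a
      unfolding scaleR_diff_right[symmetric] by (simp add: scaleR_2)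
    then show ?thesis
      by (simp add: d2_def dplus_def dminus_def n power2_eq_square divide_inverse)
  qed
  also have "\<dots> = (1 / h\<^sup>2) *\<^sub>R h\<^sup>2 *\<^sub>R (p j *\<^sub>R ?Y j - g j)"
    by (simp only: march.simps n) (simp add: algebra_simps)
  also have "\<dots> = p j *\<^sub>R ?Y j - g j" using assms(1) by simp
  finally show ?thesis by simp
qed

lemma march_add:
  "march p h (\<lambda>j. g j + g' j) (a + a') (b + b') n = march p h g a b n + march p h g' a' b' n"
  by (induction p h g a b n rule: march.induct) (simp_all add: algebra_simps)

lemma march_scaleR:
  "march p h (\<lambda>_. 0) (c *\<^sub>R a) (c *\<^sub>R b) n = c *\<^sub>R march p h (\<lambda>_. 0) a b n"
  by (induction p h "\<lambda>_::nat. 0::'a" a b n rule: march.induct) (simp_all add: algebra_simps)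

text \<open>The initial pair (a, b) is sent to the pair of boundary values of the homogeneous march.
  This is a linear endomorphism of a finite-dimensional space whose dimension does not grow with
  \<open>J\<close>, so the injectivity assumed in \<open>inj\<close> gives surjectivity. At both
  ends the boundary map receives the end value before that of its neighbour.\<close>

lemma two_point_problem_solvable:
  fixes L0 L1 :: "'a::euclidean_space \<times> 'a \<Rightarrow> 'a"
  assumes h: "h \<noteq> 0" and lin: "linear L0" "linear L1"
    and inj: "\<And>E. (\<And>j. j \<in> {1..<J} \<Longrightarrow> p j *\<^sub>R E j - d2 h E j = 0) \<Longrightarrow>
      L0 (E 0, E 1) = 0 \<Longrightarrow> L1 (E J, E (J - 1)) = 0 \<Longrightarrow> E 0 = 0 \<and> E 1 = 0"
  obtains Y where "\<And>j. j \<in> {1..<J} \<Longrightarrow> p j *\<^sub>R Y j - d2 h Y j = g j"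
    "L0 (Y 0, Y 1) = b0" "L1 (Y J, Y (J - 1)) = b1"
proof -
  define S where "S ab = march p h (\<lambda>_. 0) (fst ab) (snd ab)" for ab :: "'a \<times> 'a"
  define \<Phi> where "\<Phi> ab = (L0 ab, L1 (S ab J, S ab (J - 1)))" for ab
  have S_add: "S (ab + cd) n = S ab n + S cd n" for ab cd n
    using march_add[of p h "\<lambda>_. 0" "\<lambda>_. 0"] by (simp add: S_def)
  have S_scaleR: "S (c *\<^sub>R ab) n = c *\<^sub>R S ab n" for c ab n
    by (simp add: S_def march_scaleR)
  have "linear \<Phi>"
  proof (rule linearI)
    show "\<Phi> (ab + cd) = \<Phi> ab + \<Phi> cd" for ab cd
      using linear_add[OF lin(1), of ab cd] linear_add[OF lin(2), of "(S ab J, S ab (J - 1))" "(S cd J, S cd (J - 1))"]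
      by (simp add: \<Phi>_def S_add)
    show "\<Phi> (c *\<^sub>R ab) = c *\<^sub>R \<Phi> ab" for c ab
      using linear_scale[OF lin(1), of c ab] linear_scale[OF lin(2), of c "(S ab J, S ab (J - 1))"]
      by (simp add: \<Phi>_def S_scaleR)
  qed
  moreover have "inj \<Phi>"
  proof (subst linear_injective_0[OF \<open>linear \<Phi>\<close>], intro allI impI)
    fix ab assume 0: "\<Phi> ab = 0"
    have "S ab 0 = 0 \<and> S ab 1 = 0"
    proof (rule inj)
      show "p j *\<^sub>R S ab j - d2 h (S ab) j = 0" if "j \<in> {1..<J}" for j
        using march_solves[OF h, of j p "\<lambda>_. 0" "fst ab" "snd ab"] that by (simp add: S_def)
    qed (use 0 in \<open>auto simp: \<Phi>_def S_def zero_prod_def\<close>)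
    then show "ab = 0" by (simp add: S_def prod_eq_iff)
  qed
  ultimately have "surj \<Phi>" by (rule linear_injective_imp_surjective) simp
  \<comment> \<open>A particular solution with the right-hand side \<open>g\<close>; the homogeneous
    march then corrects its boundary values.\<close>
  define Y0 where "Y0 = march p h g 0 0"
  obtain ab where ab: "\<Phi> ab = (b0 - L0 (Y0 0, Y0 1), b1 - L1 (Y0 J, Y0 (J - 1)))"
    using \<open>surj \<Phi>\<close> by (metis surjE)
  define Y where "Y = march p h g (fst ab) (snd ab)"
  have Y: "Y n = Y0 n + S ab n" for n
    using march_add[of p h g "\<lambda>_. 0" 0 "fst ab" 0 "snd ab" n] by (simp add: Y_def Y0_def S_def)
  show thesis
  proof (rule that[of Y])
    show "p j *\<^sub>R Y j - d2 h Y j = g j" if "j \<in> {1..<J}" for j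
      using march_solves[OF h, of j] that by (simp add: Y_def)
    have "L0 (Y 0, Y 1) = L0 (Y0 0, Y0 1) + L0 (S ab 0, S ab 1)"
      using linear_add[OF lin(1), of "(Y0 0, Y0 1)" "(S ab 0, S ab 1)"] by (simp add: Y)
    then show "L0 (Y 0, Y 1) = b0" using ab by (simp add: \<Phi>_def S_def)
    have "L1 (Y J, Y (J - 1)) = L1 (Y0 J, Y0 (J - 1)) + L1 (S ab J, S ab (J - 1))"
      using linear_add[OF lin(2), of "(Y0 J, Y0 (J - 1))" "(S ab J, S ab (J - 1))"] by (simp add: Y)
    then show "L1 (Y J, Y (J - 1)) = b1" using ab by (simp add: \<Phi>_def)
  qed
qed

text \<open>The left-hand sides of the boundary equations in the unknown \<open>e = X - x\<^sup>0\<close> at an end point, where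
  \<open>d0\<close> and \<open>d\<close> are the difference quotients of \<open>x\<^sup>0\<close> and \<open>X\<close> into the interval (so with
  the opposite sign of \<open>\<delta>\<^sup>-\<close> at \<open>\<rho> = 1\<close>). The tangential equation is multiplied by \<open>h / 2\<close>.\<close>

definition bnormal :: "('a \<Rightarrow> 'a) \<Rightarrow> 'a::real_inner \<Rightarrow> 'a \<Rightarrow> real \<Rightarrow> real \<Rightarrow> 'a \<Rightarrow> real" where
  "bnormal A \<nu> d0 dt h e = e \<bullet> (\<nu> + (2 * dt / (h * (norm d0)\<^sup>2)) *\<^sub>R A d0)"

definition btangent :: "('a \<Rightarrow> 'a) \<Rightarrow> 'a::real_inner \<Rightarrow> 'a \<Rightarrow> real \<Rightarrow> real \<Rightarrow> 'a \<Rightarrow> 'a \<Rightarrow> 'a" where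
  "btangent A \<nu> d0 dt h e d =
     (h * (norm d0)\<^sup>2 / (2 * dt)) *\<^sub>R proj \<nu> e + (d0 \<bullet> \<nu>) *\<^sub>R A (proj \<nu> e) - proj \<nu> d"

text \<open>What stability needs to know about one end point, with bounds uniform in h. The first
  bound by \<open>K\<close> contains 1 / h; it is attainable since \<open>d0\<close> is normal up to
  O(h) and A annihilates normal vectors.\<close>

definition end_ok :: "real \<Rightarrow> real \<Rightarrow> real \<Rightarrow> ('a \<Rightarrow> 'a) \<Rightarrow> 'a::real_inner \<Rightarrow> 'a \<Rightarrow> bool" where
  "end_ok m K h A \<nu> d0 \<longleftrightarrow> linear A \<and> norm \<nu> = 1 \<and> (\<forall>v. A v \<bullet> \<nu> = 0) \<and> m \<le> (norm d0)\<^sup>2 \<and>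
     norm ((2 / (h * (norm d0)\<^sup>2)) *\<^sub>R A d0) \<le> K \<and> (\<forall>v. norm ((d0 \<bullet> \<nu>) *\<^sub>R A v) \<le> K * norm v)"

lemma bnormal_add: "bnormal A \<nu> d0 dt h (e + e') = bnormal A \<nu> d0 dt h e + bnormal A \<nu> d0 dt h e'"
  by (simp add: bnormal_def inner_add_left)

lemma bnormal_diff: "bnormal A \<nu> d0 dt h (e - e') = bnormal A \<nu> d0 dt h e - bnormal A \<nu> d0 dt h e'"
  by (simp add: bnormal_def inner_diff_left)

lemma bnormal_scaleR: "bnormal A \<nu> d0 dt h (c *\<^sub>R e) = c * bnormal A \<nu> d0 dt h e"
  by (simp add: bnormal_def)

lemma btangent_add: "linear A \<Longrightarrow>
    btangent A \<nu> d0 dt h (e + e') (d + d') = btangent A \<nu> d0 dt h e d + btangent A \<nu> d0 dt h e' d'"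
  by (simp add: btangent_def proj_add linear_add scaleR_right_distrib)

lemma btangent_diff: "linear A \<Longrightarrow>
    btangent A \<nu> d0 dt h (e - e') (d - d') = btangent A \<nu> d0 dt h e d - btangent A \<nu> d0 dt h e' d'"
  by (simp add: btangent_def proj_diff linear_diff scaleR_right_diff_distrib)

lemma btangent_scaleR: "linear A \<Longrightarrow>
    btangent A \<nu> d0 dt h (c *\<^sub>R e) (c *\<^sub>R d) = c *\<^sub>R btangent A \<nu> d0 dt h e d"
  by (simp add: btangent_def proj_scaleR linear_scale algebra_simps)

text \<open>As \<open>btangent\<close> is tangential, it can be added to a multiple of \<nu>
  carrying \<open>bnormal\<close> without loss: both conditions fit into one vector
  equation.\<close>

lemma btangent_normal:
  assumes "norm \<nu> = 1" "\<And>v. A v \<bullet> \<nu> = 0"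
  shows "btangent A \<nu> d0 dt h e d \<bullet> \<nu> = 0"
  using assms by (simp add: btangent_def inner_add_left inner_diff_left inner_proj_normal)

text \<open>Moving the curvature terms to the right turns the two boundary expressions into the
  hypotheses of \<open>boundary_coercive\<close>, with the values of \<open>bnormal\<close> and
  \<open>btangent\<close> as residuals.\<close>

lemma end_coercive:
  fixes e d :: "'a::real_inner"
  assumes ok: "end_ok m K h A \<nu> d0" and h: "0 < h" "h \<le> 1" and dt: "0 < dt" "dt \<le> \<gamma> * h"
    and \<gamma>: "0 < \<gamma>" "\<gamma> \<le> 1" and K: "K * dt \<le> 1/2" "K + 3/2 + 8 * K\<^sup>2 \<le> m / (2 * \<gamma>)"
    and N: "\<bar>bnormal A \<nu> d0 dt h e\<bar> \<le> Rn" and T: "norm (btangent A \<nu> d0 dt h e d) \<le> Rt"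
  shows "e \<bullet> d \<ge> (norm (proj \<nu> e))\<^sup>2 - h / 4 * (norm d)\<^sup>2 - (Rt\<^sup>2 / 2 + 8 * Rn\<^sup>2 / h)"
    and "norm e \<le> 2 * norm (proj \<nu> e) + 2 * Rn"
proof -
  have \<nu>: "norm \<nu> = 1" and m: "m \<le> (norm d0)\<^sup>2"
    and K1: "norm ((2 / (h * (norm d0)\<^sup>2)) *\<^sub>R A d0) \<le> K"
    and K2: "\<And>v. norm ((d0 \<bullet> \<nu>) *\<^sub>R A v) \<le> K * norm v"
    using ok by (auto simp: end_ok_def)
  have K0: "0 \<le> K" using K1 norm_ge_zero order_trans by blast
  have Rn0: "0 \<le> Rn" using N by linarith
  have N': "\<bar>e \<bullet> \<nu>\<bar> \<le> K * dt * norm e + Rn"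
  proof -
    have "e \<bullet> \<nu> = bnormal A \<nu> d0 dt h e - dt * (e \<bullet> ((2 / (h * (norm d0)\<^sup>2)) *\<^sub>R A d0))"
      by (simp add: bnormal_def inner_add_right)
    moreover have "\<bar>e \<bullet> ((2 / (h * (norm d0)\<^sup>2)) *\<^sub>R A d0)\<bar> \<le> norm e * K"
      using Cauchy_Schwarz_ineq2 mult_left_mono[OF K1, of "norm e"] order_trans by (metis norm_ge_zero)
    then have "dt * \<bar>e \<bullet> ((2 / (h * (norm d0)\<^sup>2)) *\<^sub>R A d0)\<bar> \<le> dt * (norm e * K)"
      using dt by (intro mult_left_mono) auto
    then have "\<bar>dt * (e \<bullet> ((2 / (h * (norm d0)\<^sup>2)) *\<^sub>R A d0))\<bar> \<le> K * dt * norm e"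
      using dt by (simp add: abs_mult mult_ac)
    ultimately show ?thesis using N by linarith
  qed
  have T': "proj \<nu> d = (h * (norm d0)\<^sup>2 / (2 * dt)) *\<^sub>R proj \<nu> e + (d0 \<bullet> \<nu>) *\<^sub>R A (proj \<nu> e)
      + (- btangent A \<nu> d0 dt h e d)"
    by (simp add: btangent_def)
  show "e \<bullet> d \<ge> (norm (proj \<nu> e))\<^sup>2 - h / 4 * (norm d)\<^sup>2 - (Rt\<^sup>2 / 2 + 8 * Rn\<^sup>2 / h)"
    and "norm e \<le> 2 * norm (proj \<nu> e) + 2 * Rn"
    using boundary_coercive[OF \<nu> h dt \<gamma> K0 N' K(1) Rn0 T' K2 _ m K(2), of Rt] T by auto
qed

text \<open>The a priori bound behind both uniqueness and convergence. Since dt \<le> 1, the mass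
  term is weakened from m / (2 dt) to m / 2. The factor 18 is 16 from the two boundary losses plus 2
  from recovering the full end values from their projections.\<close>

lemma scheme_stability:
  fixes E :: "nat \<Rightarrow> 'a::real_inner"
  assumes J: "J \<ge> 1" "h = 1 / real J" and dt: "0 < dt" "dt \<le> \<gamma> * h"
    and \<gamma>: "0 < \<gamma>" "\<gamma> \<le> 1" and K: "K * dt \<le> 1/2" "K + 3/2 + 8 * K\<^sup>2 \<le> m / (2 * \<gamma>)" and m: "m > 0"
    and ok: "end_ok m K h A0 \<nu>0 d0" "end_ok m K h A1 \<nu>1 d1"
    and p: "\<And>j. j \<in> {1..<J} \<Longrightarrow> m \<le> p j"
    and r: "\<And>j. j \<in> {1..<J} \<Longrightarrow> norm ((p j / dt) *\<^sub>R E j - d2 h E j) \<le> \<epsilon>"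
    and N: "\<bar>bnormal A0 \<nu>0 d0 dt h (E 0)\<bar> \<le> Rn" "\<bar>bnormal A1 \<nu>1 d1 dt h (E J)\<bar> \<le> Rn"
    and T: "norm (btangent A0 \<nu>0 d0 dt h (E 0) (dplus h E 0)) \<le> Rt"
      "norm (btangent A1 \<nu>1 d1 dt h (E J) (- dminus h E J)) \<le> Rt"
  shows "m / 2 * (\<Sum>j\<in>{1..<J}. h * (norm (E j))\<^sup>2) + 1/2 * (\<Sum>j\<in>{1..J}. h * (norm (dminus h E j))\<^sup>2)
      + (norm (E 0))\<^sup>2 / 8 + (norm (E J))\<^sup>2 / 8 \<le> \<epsilon>\<^sup>2 / (2 * m) + Rt\<^sup>2 + 18 * Rn\<^sup>2 / h"
proof -
  have h: "0 < h" "h \<le> 1" "h * real J = 1" using J by auto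
  have dt1: "dt \<le> 1" using dt(2) \<gamma> h mult_mono[of \<gamma> 1 h 1] by linarith
  note c0 = end_coercive[OF ok(1) h(1,2) dt \<gamma> K N(1) T(1)]
  note c1 = end_coercive[OF ok(2) h(1,2) dt \<gamma> K N(2) T(2)]
  define S where "S = (\<Sum>j\<in>{1..<J}. h * (norm (E j))\<^sup>2)"
  define G where "G = 1/2 * (\<Sum>j\<in>{1..J}. h * (norm (dminus h E j))\<^sup>2)"
  have en: "m / (2 * dt) * S + G + (norm (proj \<nu>0 (E 0)))\<^sup>2 + (norm (proj \<nu>1 (E J)))\<^sup>2
    \<le> dt / (2 * m) * (h * real J) * \<epsilon>\<^sup>2 + 2 * (Rt\<^sup>2 / 2 + 8 * Rn\<^sup>2 / h)"
    unfolding S_def G_def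
    by (rule energy_estimate[OF h(1) dt(1) m J(1) refl p r c0(1) c1(1)])
  have "0 \<le> S" unfolding S_def using h by (intro sum_nonneg) auto
  moreover have "m / 2 \<le> m / (2 * dt)" using dt1 dt m by (simp add: field_simps)
  ultimately have "m / 2 * S \<le> m / (2 * dt) * S" by (rule mult_right_mono[rotated])
  moreover have "dt / (2 * m) * (h * real J) * \<epsilon>\<^sup>2 \<le> \<epsilon>\<^sup>2 / (2 * m)"
    using mult_right_mono[OF dt1, of "\<epsilon>\<^sup>2 / (2 * m)"] m h(3) by simp
  moreover have sq: "(norm e)\<^sup>2 / 8 \<le> t\<^sup>2 + Rn\<^sup>2" if "norm e \<le> 2 * t + 2 * Rn" for e :: 'a and t
  proof -
    have "(norm e)\<^sup>2 \<le> (2 * t + 2 * Rn)\<^sup>2" using that by (intro power_mono) auto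
    also have "\<dots> \<le> 8 * t\<^sup>2 + 8 * Rn\<^sup>2"
      using zero_le_power2[of "t - Rn"] by (simp add: power2_diff power2_sum power_mult_distrib)
    finally show ?thesis by simp
  qed
  note sq[OF c0(2)] sq[OF c1(2)]
  moreover have "Rn\<^sup>2 \<le> Rn\<^sup>2 / h" using h mult_right_mono[OF h(2), of "Rn\<^sup>2"] by (simp add: field_simps)
  moreover have "2 * (Rt\<^sup>2 / 2 + 8 * Rn\<^sup>2 / h) = Rt\<^sup>2 + 16 * (Rn\<^sup>2 / h)" "18 * Rn\<^sup>2 / h = 18 * (Rn\<^sup>2 / h)"
    by simp_all
  ultimately show ?thesis unfolding S_def[symmetric] G_def[symmetric] using en by linarith
qed

section \<open>Taylor expansion and consistency\<close>

lemma norm_divideR: "h > 0 \<Longrightarrow> norm (v /\<^sub>R h) = norm v / h"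
  by (simp add: divide_inverse mult.commute)

lemma vector_derivative_bound:
  fixes f :: "real \<Rightarrow> 'a::real_normed_vector"
  assumes "convex S" "\<And>s. s \<in> S \<Longrightarrow> (f has_vector_derivative f' s) (at s within S)"
    "\<And>s. s \<in> S \<Longrightarrow> norm (f' s) \<le> B" "a \<in> S" "b \<in> S"
  shows "norm (f b - f a) \<le> B * \<bar>b - a\<bar>"
proof -
  have "norm (f b - f a) \<le> B * norm (b - a)"
  proof (rule differentiable_bound[OF assms(1), of f "\<lambda>s h. h *\<^sub>R f' s"])
    show "(f has_derivative (\<lambda>h. h *\<^sub>R f' s)) (at s within S)" if "s \<in> S" for s
      using assms(2)[OF that] by (simp add: has_vector_derivative_def)
    show "onorm (\<lambda>h. h *\<^sub>R f' s) \<le> B" if "s \<in> S" for s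
      using mult_left_mono[OF assms(3)[OF that], of "\<bar>h\<bar>" for h]
      by (intro onorm_le) (auto simp: mult.commute)
  qed (use assms in auto)
  then show ?thesis by simp
qed

text \<open>Induction on the order: the derivative of the remainder is the remainder of one order
  less for the shifted family, and the mean value inequality adds a factor |b - a|. The gain of 1 /
  n! is given up.\<close>

lemma taylor_bound:
  fixes D :: "nat \<Rightarrow> real \<Rightarrow> 'a::real_normed_vector"
  assumes "\<And>k s. k < n \<Longrightarrow> s \<in> {l..u} \<Longrightarrow> (D k has_vector_derivative D (Suc k) s) (at s within {l..u})"
    and "\<And>s. s \<in> {l..u} \<Longrightarrow> norm (D n s) \<le> C" and "a \<in> {l..u}" "b \<in> {l..u}"
  shows "norm (D 0 b - (\<Sum>k<n. ((b - a) ^ k / fact k) *\<^sub>R D k a)) \<le> C * \<bar>b - a\<bar> ^ n"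
  using assms
proof (induction n arbitrary: D b)
  case 0
  then show ?case by simp
next
  case (Suc n)
  define f where "f s = D 0 s - (\<Sum>k<Suc n. ((s - a) ^ k / fact k) *\<^sub>R D k a)" for s
  define f' where "f' s = D (Suc 0) s - (\<Sum>k<n. ((s - a) ^ k / fact k) *\<^sub>R D (Suc k) a)" for s
  let ?S = "closed_segment a b"
  have S: "?S \<subseteq> {l..u}" using Suc.prems(3,4) by (auto simp: closed_segment_eq_real_ivl split: if_splits)
  have C0: "0 \<le> C" using Suc.prems(2)[OF Suc.prems(3)] norm_ge_zero order_trans by blast
  have "(f has_vector_derivative f' s) (at s within ?S)" if "s \<in> ?S" for s
  proof -
    have "((\<lambda>s. \<Sum>k<Suc n. ((s - a) ^ k / fact k) *\<^sub>R D k a) has_vector_derivative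
        (\<Sum>k<Suc n. (real k * (s - a) ^ (k - 1) / fact k) *\<^sub>R D k a)) (at s within ?S)"
      by (rule has_vector_derivative_sum) (auto intro!: derivative_eq_intros)
    also have "(\<Sum>k<Suc n. (real k * (s - a) ^ (k - 1) / fact k) *\<^sub>R D k a) =
        (\<Sum>k<n. ((s - a) ^ k / fact k) *\<^sub>R D (Suc k) a)"
      by (subst sum.lessThan_Suc_shift) (simp add: fact_Suc del: of_nat_Suc)
    finally show ?thesis unfolding f_def[abs_def] f'_def
      using that S has_vector_derivative_within_subset[OF Suc.prems(1)[of 0 s] S]
      by (intro has_vector_derivative_diff) auto
  qed
  moreover have "norm (f' s) \<le> C * \<bar>b - a\<bar> ^ n" if "s \<in> ?S" for s
  proof -
    have "norm (f' s) \<le> C * \<bar>s - a\<bar> ^ n"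
      unfolding f'_def using Suc.prems S that by (intro Suc.IH[of "\<lambda>k. D (Suc k)"]) auto
    also have "\<dots> \<le> C * \<bar>b - a\<bar> ^ n"
      using C0 that by (intro mult_left_mono power_mono) (auto simp: closed_segment_eq_real_ivl split: if_splits)
    finally show ?thesis .
  qed
  ultimately have "norm (f b - f a) \<le> C * \<bar>b - a\<bar> ^ n * \<bar>b - a\<bar>"
    by (intro vector_derivative_bound[of ?S]) auto
  moreover have "f a = 0" unfolding f_def by (subst sum.lessThan_Suc_shift) simp
  ultimately show ?case by (simp add: f_def mult_ac)
qed

text \<open>The derivatives are given as an explicit family, as in \<open>smooth_evolution\<close>,
  one-sided at the end points and with one bound \<open>C\<close> for all orders up to
  \<open>n\<close>.\<close>

definition jet :: "nat \<Rightarrow> real \<Rightarrow> (nat \<Rightarrow> real \<Rightarrow> 'a::real_normed_vector) \<Rightarrow> bool" where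
  "jet n C D \<longleftrightarrow> (\<forall>k<n. \<forall>s\<in>{0..1}. (D k has_vector_derivative D (Suc k) s) (at s within {0..1})) \<and>
     (\<forall>k\<le>n. \<forall>s\<in>{0..1}. norm (D k s) \<le> C)"

lemma jet_bound: "jet n C D \<Longrightarrow> k \<le> n \<Longrightarrow> s \<in> {0..1} \<Longrightarrow> norm (D k s) \<le> C"
  by (simp add: jet_def)

lemma jet_taylor:
  assumes "jet n C D" "m \<le> n" "a \<in> {0..1}" "b \<in> {0..1}"
  shows "norm (D 0 b - (\<Sum>k<m. ((b - a) ^ k / fact k) *\<^sub>R D k a)) \<le> C * \<bar>b - a\<bar> ^ m"
  using assms by (intro taylor_bound[of m 0 1]) (auto simp: jet_def)

lemma jet_quotient0:
  assumes "jet n C D" "1 \<le> n" "a \<in> {0..1}" "b \<in> {0..1}" "h > 0" "\<bar>b - a\<bar> = h"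
  shows "norm ((D 0 b - D 0 a) /\<^sub>R h) \<le> C"
  using jet_taylor[OF assms(1,2,3,4)] assms(5,6) by (simp add: norm_divideR pos_divide_le_eq del: norm_scaleR)

text \<open>The sign \<sigma> is the direction of the step, so that one statement serves both ends
  of the interval. The quotient divides by h rather than \<sigma> h, which leaves \<sigma> on the
  odd derivative.\<close>

lemma jet_quotient1:
  assumes "jet n C D" "2 \<le> n" "a \<in> {0..1}" "b \<in> {0..1}" "h > 0" "b = a + \<sigma> * h" "\<bar>\<sigma>\<bar> = 1"
  shows "norm ((D 0 b - D 0 a) /\<^sub>R h - \<sigma> *\<^sub>R D 1 a) \<le> C * h"
proof -
  have "(D 0 b - D 0 a) /\<^sub>R h - \<sigma> *\<^sub>R D 1 a = (D 0 b - (\<Sum>k<2. ((b - a) ^ k / fact k) *\<^sub>R D k a)) /\<^sub>R h"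
    using assms(5,6) by (simp add: numeral_2_eq_2 algebra_simps)
  also have "norm \<dots> \<le> C * h\<^sup>2 / h"
    using jet_taylor[OF assms(1,2,3,4)] assms(5,6,7)
    by (simp add: abs_mult divide_inverse mult.commute mult_left_mono)
  finally show ?thesis using assms(5) by (simp add: power2_eq_square)
qed

lemma jet_quotient2:
  assumes "jet n C D" "3 \<le> n" "a \<in> {0..1}" "b \<in> {0..1}" "h > 0" "b = a + \<sigma> * h" "\<bar>\<sigma>\<bar> = 1"
  shows "norm ((D 0 b - D 0 a) /\<^sub>R h - (\<sigma> *\<^sub>R D 1 a + (h / 2) *\<^sub>R D 2 a)) \<le> C * h\<^sup>2"
proof -
  have s: "\<sigma> * \<sigma> = 1" using assms(7) by (metis abs_mult_self_eq mult_1)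
  have "(D 0 b - D 0 a) /\<^sub>R h - (\<sigma> *\<^sub>R D 1 a + (h / 2) *\<^sub>R D 2 a) =
      (D 0 b - (\<Sum>k<3. ((b - a) ^ k / fact k) *\<^sub>R D k a)) /\<^sub>R h"
  proof -
    have "(\<Sum>k<3. ((b - a) ^ k / fact k) *\<^sub>R D k a) = D 0 a + (\<sigma> * h) *\<^sub>R D 1 a + ((\<sigma> * h)\<^sup>2 / 2) *\<^sub>R D 2 a"
      using assms(6) by (simp add: numeral_3_eq_3 numeral_2_eq_2)
    moreover have "(\<sigma> * h)\<^sup>2 = h * h" using s by (simp add: power2_eq_square algebra_simps)
    ultimately show ?thesis using assms(5) by (simp add: algebra_simps)
  qed
  also have "norm \<dots> \<le> C * h ^ 3 / h"
    using jet_taylor[OF assms(1,2,3,4)] assms(5,6,7)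
    by (simp add: abs_mult divide_inverse mult.commute mult_left_mono)
  finally show ?thesis using assms(5) by (simp add: power2_eq_square power3_eq_cube)
qed

text \<open>The odd Taylor terms at a + h and a - h cancel, so the remainder is of fourth order
  before the division by h^2.\<close>

lemma jet_second_difference:
  assumes "jet n C D" "4 \<le> n" "a \<in> {0..1}" "a + h \<in> {0..1}" "a - h \<in> {0..1}" "h > 0"
  shows "norm ((D 0 (a + h) - 2 *\<^sub>R D 0 a + D 0 (a - h)) /\<^sub>R h\<^sup>2 - D 2 a) \<le> 2 * C * h\<^sup>2"
proof -
  let ?R = "\<lambda>b. D 0 b - (\<Sum>k<4. ((b - a) ^ k / fact k) *\<^sub>R D k a)"
  have four: "{..<4::nat} = {0, 1, 2, 3}" by auto
  have "(D 0 (a + h) - 2 *\<^sub>R D 0 a + D 0 (a - h)) - h\<^sup>2 *\<^sub>R D 2 a = ?R (a + h) + ?R (a - h)"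
  proof -
    have "h\<^sup>2 *\<^sub>R D 2 a = (h\<^sup>2 / 2) *\<^sub>R D 2 a + (h\<^sup>2 / 2) *\<^sub>R D 2 a" by (simp flip: scaleR_left_distrib)
    then show ?thesis by (simp add: four scaleR_2 fact_numeral)
  qed
  also have "norm \<dots> \<le> C * h ^ 4 + C * h ^ 4"
    using jet_taylor[OF assms(1,2,3,4)] jet_taylor[OF assms(1,2,3,5)] assms(6)
    by (intro norm_triangle_mono) auto
  finally have "norm ((D 0 (a + h) - 2 *\<^sub>R D 0 a + D 0 (a - h)) - h\<^sup>2 *\<^sub>R D 2 a) / h\<^sup>2 \<le> 2 * C * h ^ 4 / h\<^sup>2"
    by (intro divide_right_mono) auto
  also have "norm ((D 0 (a + h) - 2 *\<^sub>R D 0 a + D 0 (a - h)) - h\<^sup>2 *\<^sub>R D 2 a) / h\<^sup>2 =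
      norm (((D 0 (a + h) - 2 *\<^sub>R D 0 a + D 0 (a - h)) - h\<^sup>2 *\<^sub>R D 2 a) /\<^sub>R h\<^sup>2)"
    by (simp add: divide_inverse mult.commute)
  also have "((D 0 (a + h) - 2 *\<^sub>R D 0 a + D 0 (a - h)) - h\<^sup>2 *\<^sub>R D 2 a) /\<^sub>R h\<^sup>2 =
      (D 0 (a + h) - 2 *\<^sub>R D 0 a + D 0 (a - h)) /\<^sub>R h\<^sup>2 - D 2 a"
    using assms(6) by (simp add: scaleR_diff_right)
  also have "2 * C * h ^ 4 / h\<^sup>2 = 2 * C * h\<^sup>2"
    using assms(6) by (simp add: power4_eq_xxxx power2_eq_square)
  finally show ?thesis .
qed

text \<open>Meant for the correction \<open>w\<close>: its second difference carries a factor dt^2,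
  so boundedness is all that consistency requires of it.\<close>

lemma jet_second_difference_bound:
  assumes "jet n C D" "2 \<le> n" "a \<in> {0..1}" "a + h \<in> {0..1}" "a - h \<in> {0..1}" "h > 0"
  shows "norm ((D 0 (a + h) - 2 *\<^sub>R D 0 a + D 0 (a - h)) /\<^sub>R h\<^sup>2) \<le> 2 * C"
proof -
  let ?R = "\<lambda>b. D 0 b - (\<Sum>k<2. ((b - a) ^ k / fact k) *\<^sub>R D k a)"
  have "D 0 (a + h) - 2 *\<^sub>R D 0 a + D 0 (a - h) = ?R (a + h) + ?R (a - h)"
    by (simp add: numeral_2_eq_2 scaleR_2)
  also have "norm \<dots> \<le> C * h\<^sup>2 + C * h\<^sup>2"
    using jet_taylor[OF assms(1,2,3,4)] jet_taylor[OF assms(1,2,3,5)] assms(6)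
    by (intro norm_triangle_mono) auto
  finally show ?thesis using assms(6) by (simp add: norm_divideR pos_divide_le_eq del: norm_scaleR)
qed

text \<open>Up to O(h^2), \<open>p\<close> is the squared speed, and the second difference of
  \<open>Z\<close> is f0'' + dt f1''. The two equations in \<open>eq\<close> cancel these terms at
  orders 1 and dt; the second one is the defining property of \<open>w\<close>. What is left carries
  h^2 or dt^2 \<le> h^2.\<close>

lemma interior_consistency:
  fixes f0 f1 w :: "nat \<Rightarrow> real \<Rightarrow> 'a::real_inner"
  assumes f0: "jet 4 C f0" and f1: "jet 4 C f1" and w: "jet 2 C w"
    and a: "a \<in> {0..1}" "a + h \<in> {0..1}" "a - h \<in> {0..1}" and h: "0 < h" "h \<le> 1" and dt: "0 < dt" "dt \<le> h"
    and eq: "(norm (f0 1 a))\<^sup>2 *\<^sub>R f1 0 a = f0 2 a" "(norm (f0 1 a))\<^sup>2 *\<^sub>R w 0 a = f1 2 a"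
    and p: "p = 1/2 * ((norm ((f0 0 a - f0 0 (a - h)) /\<^sub>R h))\<^sup>2 + (norm ((f0 0 (a + h) - f0 0 a) /\<^sub>R h))\<^sup>2)"
    and Z: "\<And>b. Z b = f0 0 b + dt *\<^sub>R f1 0 b + dt\<^sup>2 *\<^sub>R w 0 b"
  shows "norm (p *\<^sub>R (f1 0 a + dt *\<^sub>R w 0 a) - (Z (a + h) - 2 *\<^sub>R Z a + Z (a - h)) /\<^sub>R h\<^sup>2) \<le> (10 * C ^ 3 + 6 * C) * h\<^sup>2"
proof -
  define u s where "u = f0 1 a" and "s = f0 2 a"
  have dt1: "dt \<le> 1" using dt h by simp
  have C: "0 \<le> C" using jet_bound[OF w, of 0 a] a norm_ge_zero order_trans by blast
  have us: "norm u \<le> C" "norm s \<le> C" unfolding u_def s_def using f0 a by (auto intro: jet_bound)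
  have b: "norm (f1 0 a) \<le> C" "norm (w 0 a) \<le> C" using f1 w a by (auto intro: jet_bound)
  define R1 where "R1 = (f0 0 (a + h) - f0 0 a) /\<^sub>R h - (u + (h / 2) *\<^sub>R s)"
  define R2 where "R2 = (f0 0 (a - h) - f0 0 a) /\<^sub>R h - (- u + (h / 2) *\<^sub>R s)"
  have R: "norm R1 \<le> C * h\<^sup>2" "norm R2 \<le> C * h\<^sup>2"
    using jet_quotient2[OF f0 _ a(1,2) h(1), of 1] jet_quotient2[OF f0 _ a(1,3) h(1), of "-1"]
    by (simp_all add: R1_def R2_def u_def s_def)
  have q: "(f0 0 a - f0 0 (a - h)) /\<^sub>R h = - (- u + (h / 2) *\<^sub>R s + R2)"
     "(f0 0 (a + h) - f0 0 a) /\<^sub>R h = u + (h / 2) *\<^sub>R s + R1"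
    by (simp_all add: R1_def R2_def scaleR_diff_right)
  define v1 v2 where "v1 = u + (h / 2) *\<^sub>R s" and "v2 = - u + (h / 2) *\<^sub>R s"
  have hs: "norm ((h / 2) *\<^sub>R s) \<le> C / 2"
    using mult_mono[OF h(2) us(2)] h C by simp
  have v: "norm v1 \<le> 3/2 * C" "norm v2 \<le> 3/2 * C"
    unfolding v1_def v2_def using norm_triangle_ineq[of u "(h / 2) *\<^sub>R s"] norm_triangle_ineq[of "-u" "(h / 2) *\<^sub>R s"] us hs by auto
  have expand: "\<bar>(norm (v + R))\<^sup>2 - (norm v)\<^sup>2\<bar> \<le> 4 * C\<^sup>2 * h\<^sup>2" if "norm v \<le> 3/2 * C" "norm R \<le> C * h\<^sup>2" for v R :: 'a
  proof -
    have "(norm (v + R))\<^sup>2 - (norm v)\<^sup>2 = 2 * (v \<bullet> R) + (norm R)\<^sup>2"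
      by (simp add: power2_norm_eq_inner inner_add_left inner_add_right inner_commute)
    moreover have "\<bar>v \<bullet> R\<bar> \<le> (3/2 * C) * (C * h\<^sup>2)"
      using Cauchy_Schwarz_ineq2[of v R] mult_mono[OF that] C by fastforce
    moreover have "(norm R)\<^sup>2 \<le> (C * h\<^sup>2) * (C * 1)"
      unfolding power2_eq_square[of "norm R"] using that C h
      by (intro mult_mono order_trans[OF that(2)] mult_left_mono) (auto simp: power_le_one)
    moreover have "(3/2 * C) * (C * h\<^sup>2) = 3/2 * (C\<^sup>2 * h\<^sup>2)" "(C * h\<^sup>2) * (C * 1) = C\<^sup>2 * h\<^sup>2"
      by (simp_all add: power2_eq_square)
    ultimately show ?thesis using zero_le_power2[of "norm R"] by argo
  qed
  \<comment> \<open>The parallelogram law: averaging the squares of the backward and the forward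
    quotient removes the term linear in h.\<close>
  have "(norm v1)\<^sup>2 + (norm v2)\<^sup>2 = 2 * (norm u)\<^sup>2 + 2 * (norm ((h / 2) *\<^sub>R s))\<^sup>2"
    unfolding v1_def v2_def power2_norm_eq_inner
    by (simp add: inner_add_left inner_add_right inner_diff_left inner_diff_right inner_commute)
  moreover have "(norm ((h / 2) *\<^sub>R s))\<^sup>2 \<le> C\<^sup>2 * h\<^sup>2"
  proof -
    have "norm ((h / 2) *\<^sub>R s) \<le> C * h" using us(2) h C mult_left_mono[OF us(2), of "h/2"] by simp
    then have "(norm ((h / 2) *\<^sub>R s))\<^sup>2 \<le> (C * h)\<^sup>2" by (intro power_mono) auto
    then show ?thesis by (simp add: power_mult_distrib)
  qed
  moreover have "p = 1/2 * ((norm (v2 + R2))\<^sup>2 + (norm (v1 + R1))\<^sup>2)"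
    unfolding p q v1_def v2_def norm_minus_cancel ..
  ultimately have pu: "\<bar>p - (norm u)\<^sup>2\<bar> \<le> 5 * C\<^sup>2 * h\<^sup>2"
    using expand[OF v(1) R(1)] expand[OF v(2) R(2)] zero_le_power2[of "norm ((h / 2) *\<^sub>R s)"] by argo
  define e0 where "e0 = (f0 0 (a + h) - 2 *\<^sub>R f0 0 a + f0 0 (a - h)) /\<^sub>R h\<^sup>2 - f0 2 a"
  define e1 where "e1 = (f1 0 (a + h) - 2 *\<^sub>R f1 0 a + f1 0 (a - h)) /\<^sub>R h\<^sup>2 - f1 2 a"
  define e2 where "e2 = (w 0 (a + h) - 2 *\<^sub>R w 0 a + w 0 (a - h)) /\<^sub>R h\<^sup>2"
  have e0: "norm e0 \<le> 2 * C * h\<^sup>2" unfolding e0_def by (rule jet_second_difference[OF f0 _ a h(1)]) simp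
  have e1: "norm e1 \<le> 2 * C * h\<^sup>2" unfolding e1_def by (rule jet_second_difference[OF f1 _ a h(1)]) simp
  have e2: "norm e2 \<le> 2 * C" unfolding e2_def by (rule jet_second_difference_bound[OF w _ a h(1)]) simp
  have ZZ: "(Z (a + h) - 2 *\<^sub>R Z a + Z (a - h)) /\<^sub>R h\<^sup>2 = (f0 2 a + e0) + dt *\<^sub>R (f1 2 a + e1) + dt\<^sup>2 *\<^sub>R e2"
    unfolding Z e0_def e1_def e2_def by (simp add: algebra_simps)
  have eq': "(norm u)\<^sup>2 *\<^sub>R f1 0 a = f0 2 a" "(norm u)\<^sup>2 *\<^sub>R w 0 a = f1 2 a"
    using eq by (simp_all add: u_def)
  have "p *\<^sub>R (f1 0 a + dt *\<^sub>R w 0 a) - (Z (a + h) - 2 *\<^sub>R Z a + Z (a - h)) /\<^sub>R h\<^sup>2 =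
    (p - (norm u)\<^sup>2) *\<^sub>R (f1 0 a + dt *\<^sub>R w 0 a) - (e0 + dt *\<^sub>R e1 + dt\<^sup>2 *\<^sub>R e2)"
    unfolding ZZ by (simp add: algebra_simps flip: eq')
  also have "norm \<dots> \<le> norm ((p - (norm u)\<^sup>2) *\<^sub>R (f1 0 a + dt *\<^sub>R w 0 a)) + norm (e0 + dt *\<^sub>R e1 + dt\<^sup>2 *\<^sub>R e2)"
    by (rule norm_triangle_ineq4)
  also have "norm ((p - (norm u)\<^sup>2) *\<^sub>R (f1 0 a + dt *\<^sub>R w 0 a)) \<le> 5 * C\<^sup>2 * h\<^sup>2 * (2 * C)"
  proof -
    have "norm (dt *\<^sub>R w 0 a) \<le> 1 * C" unfolding norm_scaleR using dt dt1 b C by (intro mult_mono) auto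
    then have "norm (f1 0 a + dt *\<^sub>R w 0 a) \<le> 2 * C"
      using norm_triangle_ineq[of "f1 0 a" "dt *\<^sub>R w 0 a"] b by linarith
    then show ?thesis unfolding norm_scaleR real_norm_def using pu C by (intro mult_mono) auto
  qed
  also have "norm (e0 + dt *\<^sub>R e1 + dt\<^sup>2 *\<^sub>R e2) \<le> 6 * C * h\<^sup>2"
  proof -
    have "norm (dt *\<^sub>R e1) \<le> 1 * (2 * C * h\<^sup>2)" unfolding norm_scaleR using dt dt1 e1 C by (intro mult_mono) auto
    moreover have "norm (dt\<^sup>2 *\<^sub>R e2) \<le> h\<^sup>2 * (2 * C)"
      unfolding norm_scaleR using dt e2 C by (intro mult_mono) (auto intro: power_mono)
    ultimately show ?thesis
      using e0 norm_triangle_ineq[of "e0 + dt *\<^sub>R e1" "dt\<^sup>2 *\<^sub>R e2"] norm_triangle_ineq[of e0 "dt *\<^sub>R e1"]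
      by (simp add: algebra_simps)
  qed
  finally show ?thesis by (simp add: algebra_simps power2_eq_square power3_eq_cube)
qed

text \<open>Everything follows from d0 = u + (h / 2) |u|^2 x_t + O(h^2) with \<open>u\<close>
  normal. Applying A removes \<open>u\<close>, so 2 A d0 / (h |d0|^2) is A x_t up to O(h), and
  \<open>curv\<close> cancels the leading normal residual. Applying the projection also removes
  \<open>u\<close> and leaves the term that balances the coercive one; the curvature term is matched
  by \<open>neumann_t\<close>. The direction \<sigma> covers both ends.\<close>

lemma boundary_consistency:
  fixes f0 f1 w :: "nat \<Rightarrow> real \<Rightarrow> 'a::real_inner" and A :: "'a \<Rightarrow> 'a"
  assumes f0: "jet 4 C f0" and f1: "jet 4 C f1" and w: "jet 2 C w"
    and e: "e \<in> {0..1}" "b \<in> {0..1}" "b = e + \<sigma> * h" "\<bar>\<sigma>\<bar> = 1"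
    and h: "0 < h" "h \<le> 1" and dt: "0 < dt" "dt \<le> h" and c0: "0 < c0" "c0 \<le> norm (f0 1 e)" "C * h \<le> c0 / 2"
    and A: "linear A" "\<And>v. A v \<bullet> \<nu> = 0" "A \<nu> = 0" "\<And>v. norm (A v) \<le> K * norm v" and \<nu>: "norm \<nu> = 1"
    and neumann: "f0 1 e = (f0 1 e \<bullet> \<nu>) *\<^sub>R \<nu>" and tang: "f1 0 e \<bullet> \<nu> = 0"
    and curv: "w 0 e \<bullet> \<nu> = - (f1 0 e \<bullet> A (f1 0 e))"
    and neumann_t: "proj \<nu> (f1 1 e) = (f0 1 e \<bullet> \<nu>) *\<^sub>R A (f1 0 e)"
    and eq: "(norm (f0 1 e))\<^sup>2 *\<^sub>R f1 0 e = f0 2 e"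
    and Z: "\<And>b. Z b = f0 0 b + dt *\<^sub>R f1 0 b + dt\<^sup>2 *\<^sub>R w 0 b"
    and d0: "d0 = (f0 0 b - f0 0 e) /\<^sub>R h" and K1: "K1 = 8 * K * (C + C ^ 3) / c0\<^sup>2"
  shows "c0\<^sup>2 / 4 \<le> (norm d0)\<^sup>2"
    and "norm ((2 / (h * (norm d0)\<^sup>2)) *\<^sub>R A d0) \<le> K1 + K * C"
    and "norm ((d0 \<bullet> \<nu>) *\<^sub>R A v) \<le> K * C * norm v"
    and "\<bar>bnormal A \<nu> d0 dt h (Z e - f0 0 e)\<bar> \<le> dt\<^sup>2 * h * (2 * C * K1 + K * C\<^sup>2)"
    and "norm (btangent A \<nu> d0 dt h (Z e - f0 0 e) ((Z b - Z e) /\<^sub>R h)) \<le> (2 * C ^ 3 + 2 * K * C\<^sup>2 + 3 * C) * h\<^sup>2"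
proof -
  interpret A: linear A by (rule A)
  define u a1 w0 where "u = \<sigma> *\<^sub>R f0 1 e" and "a1 = f1 0 e" and "w0 = w 0 e"
  define Q where "Q = (norm d0)\<^sup>2"
  define Qu where "Qu = (norm u)\<^sup>2"
  have be: "\<bar>b - e\<bar> = h" using e h by (simp add: abs_mult)
  have C: "0 \<le> C" using jet_bound[OF w, of 0 e] e norm_ge_zero order_trans by blast
  have K: "0 \<le> K" using order_trans[OF norm_ge_zero A(4)[of \<nu>]] \<nu> by simp
  have \<sigma>2: "\<sigma> * \<sigma> = 1" using e(4) by (metis abs_mult_self_eq mult_1)
  have nu: "norm u = norm (f0 1 e)" using e(4) by (simp add: u_def)
  have bd: "norm u \<le> C" "norm a1 \<le> C" "norm w0 \<le> C"
    unfolding nu a1_def w0_def using f0 f1 w e by (auto intro: jet_bound)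
  have u: "u = (u \<bullet> \<nu>) *\<^sub>R \<nu>" using arg_cong[OF neumann, of "\<lambda>v. \<sigma> *\<^sub>R v"]
    unfolding u_def inner_scaleR_left scaleR_scaleR .
  have eq': "Qu *\<^sub>R a1 = f0 2 e" unfolding Qu_def nu a1_def by (rule eq)
  define R where "R = d0 - (u + (h / 2) *\<^sub>R f0 2 e)"
  have R: "norm R \<le> C * h\<^sup>2"
    using jet_quotient2[OF f0 _ e(1,2) h(1) e(3,4)] by (simp add: R_def d0 u_def)
  have d0R: "d0 = u + (h / 2 * Qu) *\<^sub>R a1 + R" by (simp add: R_def flip: eq')
  have d0C: "norm d0 \<le> C" unfolding d0 by (rule jet_quotient0[OF f0 _ e(1,2) h(1) be]) simp
  have d0u: "norm (d0 - u) \<le> C * h"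
    using jet_quotient1[OF f0 _ e(1,2) h(1) e(3,4)] by (simp add: d0 u_def)
  have "c0 / 2 \<le> norm d0" using d0u c0 nu norm_triangle_ineq3[of d0 u] by linarith
  then have "(c0 / 2)\<^sup>2 \<le> Q" unfolding Q_def using c0 by (intro power_mono) auto
  then have Q: "c0\<^sup>2 / 4 \<le> Q" by (simp add: power_divide)
  then show "c0\<^sup>2 / 4 \<le> (norm d0)\<^sup>2" by (simp add: Q_def)
  have Q0: "0 < Q" using Q c0 by (smt (verit) divide_pos_pos zero_less_power)
  have QC: "Q \<le> C\<^sup>2" unfolding Q_def using d0C by (intro power_mono) auto
  have QQ: "\<bar>Q - Qu\<bar> \<le> 2 * C\<^sup>2 * h"
  proof -
    have "\<bar>Q - Qu\<bar> = \<bar>norm d0 - norm u\<bar> * (norm d0 + norm u)"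
      unfolding Q_def Qu_def power2_eq_square by (simp add: square_diff_square_factored abs_mult)
    also have "\<dots> \<le> (C * h) * (C + C)"
      using order_trans[OF norm_triangle_ineq3 d0u] d0C bd(1) C h by (intro mult_mono) auto
    finally show ?thesis by (simp add: power2_eq_square mult_ac)
  qed
  \<comment> \<open>This is what cancels the factor 1 / h in the normal condition.\<close>
  have Au: "A u = 0" by (subst u) (simp add: A.scaleR A(3))
  have Aa1: "norm (A a1) \<le> K * C" using A(4)[of a1] mult_left_mono[OF bd(2) K] by linarith
  define D where "D = (2 / (h * Q)) *\<^sub>R A d0 - A a1"
  have D: "norm D \<le> h * K1"
  proof -
    have "D = (2 / (h * Q)) *\<^sub>R (A R + (h / 2 * (Qu - Q)) *\<^sub>R A a1)"
      using Q0 h by (simp add: D_def d0R A.add A.scaleR Au algebra_simps diff_divide_distrib)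
    also have "norm \<dots> = 2 / (h * Q) * norm (A R + (h / 2 * (Qu - Q)) *\<^sub>R A a1)"
      using Q0 h by simp
    also have "\<dots> \<le> 2 / (h * (c0\<^sup>2 / 4)) * (h\<^sup>2 * K * (C + C ^ 3))"
    proof (rule mult_mono)
      show "2 / (h * Q) \<le> 2 / (h * (c0\<^sup>2 / 4))" using Q c0 h Q0 by (intro divide_left_mono mult_left_mono) auto
      have "norm (A R) \<le> K * (C * h\<^sup>2)" using A(4)[of R] mult_left_mono[OF R K] by linarith
      moreover have "norm ((h / 2 * (Qu - Q)) *\<^sub>R A a1) \<le> (h / 2 * (2 * C\<^sup>2 * h)) * (K * C)"
        unfolding norm_scaleR real_norm_def abs_mult using QQ Aa1 h C by (intro mult_mono) (auto simp: abs_minus_commute)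
      ultimately have "norm (A R + (h / 2 * (Qu - Q)) *\<^sub>R A a1) \<le> K * (C * h\<^sup>2) + (h / 2 * (2 * C\<^sup>2 * h)) * (K * C)"
        by (rule norm_triangle_mono)
      also have "\<dots> = h\<^sup>2 * K * (C + C ^ 3)" by (simp add: power2_eq_square power3_eq_cube algebra_simps)
      finally show "norm (A R + (h / 2 * (Qu - Q)) *\<^sub>R A a1) \<le> h\<^sup>2 * K * (C + C ^ 3)" .
    qed (use h in auto)
    also have "\<dots> = h * K1" using h c0 by (simp add: K1 power2_eq_square field_simps)
    finally show ?thesis .
  qed
  have K10: "0 \<le> K1" unfolding K1 using K C c0 by simp
  have "norm ((2 / (h * Q)) *\<^sub>R A d0) \<le> norm D + norm (A a1)"
    unfolding D_def by (metis diff_add_cancel norm_triangle_ineq)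
  also have "\<dots> \<le> K1 + K * C" using D Aa1 mult_right_mono[OF h(2) K10] by linarith
  finally show "norm ((2 / (h * (norm d0)\<^sup>2)) *\<^sub>R A d0) \<le> K1 + K * C" by (simp add: Q_def)
  have d0\<nu>: "\<bar>d0 \<bullet> \<nu>\<bar> \<le> C" using Cauchy_Schwarz_ineq2[of d0 \<nu>] d0C \<nu> by simp
  show Av: "norm ((d0 \<bullet> \<nu>) *\<^sub>R A v) \<le> K * C * norm v" for v
    using mult_mono[OF d0\<nu> A(4)[of v]] C by (simp add: mult_ac)
  have Ze: "Z e - f0 0 e = dt *\<^sub>R (a1 + dt *\<^sub>R w0)"
    by (simp add: Z a1_def w0_def scaleR_right_distrib power2_eq_square)
  have dtC: "norm (dt *\<^sub>R w0) \<le> C"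
    using mult_mono[of dt 1 "norm w0" C] dt h bd(3) C by simp
  have W: "norm (a1 + dt *\<^sub>R w0) \<le> 2 * C"
    using norm_triangle_mono[OF bd(2) dtC] by simp
  have "bnormal A \<nu> d0 dt h (Z e - f0 0 e) = dt * ((a1 + dt *\<^sub>R w0) \<bullet> (\<nu> + dt *\<^sub>R (D + A a1)))"
    by (simp add: Ze bnormal_scaleR) (simp add: bnormal_def D_def Q_def mult_ac)
  \<comment> \<open>At order 1 the product vanishes since \<open>a1\<close> is tangential. At order
    dt the normal part of \<open>w0\<close> cancels the product of \<open>a1\<close> with
    \<open>A a1\<close>, and only the O(h) quantity \<open>D\<close> and a term with dt^2
    remain.\<close>
  also have "(a1 + dt *\<^sub>R w0) \<bullet> (\<nu> + dt *\<^sub>R (D + A a1)) =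
      dt * ((a1 + dt *\<^sub>R w0) \<bullet> D + dt * (w0 \<bullet> A a1))"
    using tang curv by (simp add: a1_def[symmetric] w0_def[symmetric] inner_add_left inner_add_right algebra_simps)
  finally have bn: "bnormal A \<nu> d0 dt h (Z e - f0 0 e) = dt\<^sup>2 * ((a1 + dt *\<^sub>R w0) \<bullet> D + dt * (w0 \<bullet> A a1))"
    by (simp add: power2_eq_square)
  have "\<bar>(a1 + dt *\<^sub>R w0) \<bullet> D\<bar> \<le> (2 * C) * (h * K1)"
    using order_trans[OF Cauchy_Schwarz_ineq2 mult_mono[OF W D]] C by simp
  moreover have "\<bar>dt * (w0 \<bullet> A a1)\<bar> \<le> h * (C * (K * C))"
    unfolding abs_mult using order_trans[OF Cauchy_Schwarz_ineq2 mult_mono[OF bd(3) Aa1]] C dt h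
    by (intro mult_mono) auto
  ultimately have "\<bar>(a1 + dt *\<^sub>R w0) \<bullet> D + dt * (w0 \<bullet> A a1)\<bar> \<le> h * (2 * C * K1 + K * C\<^sup>2)"
    by (simp add: algebra_simps power2_eq_square)
  then show "\<bar>bnormal A \<nu> d0 dt h (Z e - f0 0 e)\<bar> \<le> dt\<^sup>2 * h * (2 * C * K1 + K * C\<^sup>2)"
    unfolding bn abs_mult using dt mult_left_mono[of _ _ "dt\<^sup>2"] by (simp add: mult_ac)

  define R1 where "R1 = (f1 0 b - f1 0 e) /\<^sub>R h - \<sigma> *\<^sub>R f1 1 e"
  define dw where "dw = (w 0 b - w 0 e) /\<^sub>R h"
  have R1: "norm R1 \<le> C * h" unfolding R1_def by (rule jet_quotient1[OF f1 _ e(1,2) h(1) e(3,4)]) simp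
  have dw: "norm dw \<le> C" unfolding dw_def by (rule jet_quotient0[OF w _ e(1,2) h(1) be]) simp
  have pa1: "proj \<nu> a1 = a1" using tang by (intro proj_tangential) (simp add: a1_def)
  have pu: "proj \<nu> u = 0" unfolding proj_def by (simp flip: u)
  have pd0: "proj \<nu> d0 = (h / 2 * Qu) *\<^sub>R a1 + proj \<nu> R" by (subst d0R) (simp add: proj_add proj_scaleR pu pa1)
  have pf1: "proj \<nu> ((f1 0 b - f1 0 e) /\<^sub>R h) = (u \<bullet> \<nu>) *\<^sub>R A a1 + proj \<nu> R1"
    using neumann_t by (simp add: R1_def proj_diff proj_scaleR u_def a1_def)
  have "(Z b - Z e) /\<^sub>R h = d0 + dt *\<^sub>R ((f1 0 b - f1 0 e) /\<^sub>R h) + dt\<^sup>2 *\<^sub>R dw"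
    by (simp add: Z d0 dw_def algebra_simps)
  then have pdZ: "proj \<nu> ((Z b - Z e) /\<^sub>R h) = (h / 2 * Qu) *\<^sub>R a1 + proj \<nu> R +
      dt *\<^sub>R ((u \<bullet> \<nu>) *\<^sub>R A a1 + proj \<nu> R1) + dt\<^sup>2 *\<^sub>R proj \<nu> dw"
    by (simp only: proj_add proj_scaleR pd0 pf1[unfolded proj_scaleR])
  define t1 where "t1 = (h / 2 * (Q - Qu)) *\<^sub>R a1"
  have s1: "(h / 2 * Q) *\<^sub>R a1 = (h / 2 * Qu) *\<^sub>R a1 + t1"
    unfolding t1_def by (simp only: right_diff_distrib scaleR_left_diff_distrib) simp
  have "btangent A \<nu> d0 dt h (Z e - f0 0 e) ((Z b - Z e) /\<^sub>R h) =
      (h / 2 * Q) *\<^sub>R (a1 + dt *\<^sub>R proj \<nu> w0) + (dt * (d0 \<bullet> \<nu>)) *\<^sub>R A (a1 + dt *\<^sub>R proj \<nu> w0) - proj \<nu> ((Z b - Z e) /\<^sub>R h)"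
    using dt by (simp add: btangent_def Ze proj_add proj_scaleR pa1 A.scaleR Q_def mult_ac)
  \<comment> \<open>After the two leading pairs are cancelled, every remaining summand contains h^2,
    h dt or dt^2.\<close>
  also have "\<dots> = t1 + (h / 2 * Q * dt) *\<^sub>R proj \<nu> w0 + (dt * ((d0 - u) \<bullet> \<nu>)) *\<^sub>R A a1 +
      dt\<^sup>2 *\<^sub>R ((d0 \<bullet> \<nu>) *\<^sub>R A (proj \<nu> w0)) + (- proj \<nu> R) + (- (dt *\<^sub>R proj \<nu> R1)) + (- (dt\<^sup>2 *\<^sub>R proj \<nu> dw))"
    unfolding pdZ scaleR_right_distrib[of "h / 2 * Q"] s1 by (simp add: A.add A.scaleR inner_diff_left algebra_simps power2_eq_square)
  also have "norm \<dots> \<le> h / 2 * (2 * C\<^sup>2 * h) * C + h / 2 * C\<^sup>2 * h * C + (h * (C * h)) * (K * C) +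
      h\<^sup>2 * (K * C * C) + C * h\<^sup>2 + h * (C * h) + h\<^sup>2 * C"
  proof (intro norm_triangle_mono)
    show "norm t1 \<le> h / 2 * (2 * C\<^sup>2 * h) * C"
      unfolding t1_def norm_scaleR real_norm_def abs_mult using QQ bd h C by (intro mult_mono) auto
    have pw: "norm (proj \<nu> w0) \<le> C" using norm_proj_le[OF \<nu>, of w0] bd by linarith
    then show "norm ((h / 2 * Q * dt) *\<^sub>R proj \<nu> w0) \<le> h / 2 * C\<^sup>2 * h * C"
      unfolding norm_scaleR real_norm_def abs_mult using QC Q0 h dt C by (intro mult_mono) auto
    have "\<bar>(d0 - u) \<bullet> \<nu>\<bar> \<le> C * h" using Cauchy_Schwarz_ineq2[of "d0 - u" \<nu>] d0u \<nu> by simp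
    then show "norm ((dt * ((d0 - u) \<bullet> \<nu>)) *\<^sub>R A a1) \<le> (h * (C * h)) * (K * C)"
      unfolding norm_scaleR real_norm_def abs_mult using Aa1 h dt C by (intro mult_mono) auto
    have dt2: "dt\<^sup>2 \<le> h\<^sup>2" using dt by (intro power_mono) auto
    have "norm ((d0 \<bullet> \<nu>) *\<^sub>R A (proj \<nu> w0)) \<le> K * C * C"
      using Av[of "proj \<nu> w0"] mult_left_mono[OF pw, of "K * C"] K C by simp
    then show "norm (dt\<^sup>2 *\<^sub>R ((d0 \<bullet> \<nu>) *\<^sub>R A (proj \<nu> w0))) \<le> h\<^sup>2 * (K * C * C)"
      unfolding norm_scaleR[of "dt\<^sup>2"] using dt2 by (intro mult_mono) auto
    show "norm (- proj \<nu> R) \<le> C * h\<^sup>2" using norm_proj_le[OF \<nu>, of R] R by simp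
    have "norm (proj \<nu> R1) \<le> C * h" using norm_proj_le[OF \<nu>, of R1] R1 by linarith
    then show "norm (- (dt *\<^sub>R proj \<nu> R1)) \<le> h * (C * h)"
      unfolding norm_minus_cancel norm_scaleR using dt h by (intro mult_mono) auto
    have "norm (proj \<nu> dw) \<le> C" using norm_proj_le[OF \<nu>, of dw] dw by linarith
    then show "norm (- (dt\<^sup>2 *\<^sub>R proj \<nu> dw)) \<le> h\<^sup>2 * C"
      unfolding norm_minus_cancel norm_scaleR using dt2 by (intro mult_mono) auto
  qed
  also have "\<dots> \<le> (2 * C ^ 3 + 2 * K * C\<^sup>2 + 3 * C) * h\<^sup>2"
  proof -
    have "0 \<le> C ^ 3 * h\<^sup>2" using C by simp
    then show ?thesis by (simp add: power2_eq_square power3_eq_cube algebra_simps)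
  qed
  finally show "norm (btangent A \<nu> d0 dt h (Z e - f0 0 e) ((Z b - Z e) /\<^sub>R h)) \<le> (2 * C ^ 3 + 2 * K * C\<^sup>2 + 3 * C) * h\<^sup>2" .
qed

section \<open>Initial data of the smooth solution\<close>

lemma jet_mono: "jet n C D \<Longrightarrow> C \<le> C' \<Longrightarrow> jet n C' D"
  unfolding jet_def by (meson order_trans)

lemma continuous_jet:
  fixes D :: "nat \<Rightarrow> real \<Rightarrow> 'a::real_normed_vector"
  assumes "\<And>k s. k < n \<Longrightarrow> s \<in> {0..1} \<Longrightarrow> (D k has_vector_derivative D (Suc k) s) (at s within {0..1})"
    and "\<And>k. k \<le> n \<Longrightarrow> continuous_on {0..1} (D k)"
  obtains C where "jet n C D"
proof -
  have "bounded (\<Union>k\<in>{..n}. D k ` {0..1})"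
    using assms(2) by (intro bounded_UN) (auto intro!: compact_imp_bounded compact_continuous_image)
  then obtain C where "\<forall>v\<in>(\<Union>k\<in>{..n}. D k ` {0..1}). norm v \<le> C" unfolding bounded_iff by blast
  then show thesis using assms(1) by (intro that[of C]) (auto simp: jet_def)
qed

text \<open>Provides the correction \<open>w\<close> with two controlled derivatives. The lower
  bound on the speed keeps the denominator away from zero, and the quotient rule is written out
  twice.\<close>

lemma quotient_jet:
  fixes u v :: "nat \<Rightarrow> real \<Rightarrow> 'a::real_inner"
  assumes du: "\<And>k s. k < 2 \<Longrightarrow> s \<in> {0..1} \<Longrightarrow> (u k has_vector_derivative u (Suc k) s) (at s within {0..1})"
    and dv: "\<And>k s. k < 2 \<Longrightarrow> s \<in> {0..1} \<Longrightarrow> (v k has_vector_derivative v (Suc k) s) (at s within {0..1})"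
    and cu: "\<And>k. k \<le> 2 \<Longrightarrow> continuous_on {0..1} (u k)"
    and cv: "\<And>k. k \<le> 2 \<Longrightarrow> continuous_on {0..1} (v k)"
    and nz: "\<And>s. s \<in> {0..1} \<Longrightarrow> u 0 s \<noteq> 0"
  obtains C W where "jet 2 C W" "\<And>s. W 0 s = v 0 s /\<^sub>R (norm (u 0 s))\<^sup>2"
proof -
  define b where "b s = u 0 s \<bullet> u 1 s" for s
  define b' where "b' s = u 0 s \<bullet> u 2 s + u 1 s \<bullet> u 1 s" for s
  define g where "g s = inverse (u 0 s \<bullet> u 0 s)" for s
  define g' where "g' s = - (2 * b s * (g s)\<^sup>2)" for s
  define g'' where "g'' s = - (2 * b' s * (g s)\<^sup>2 + 4 * b s * g s * g' s)" for s
  define W where "W k = (if k = 0 then (\<lambda>s. g s *\<^sub>R v 0 s)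
      else if k = 1 then (\<lambda>s. g s *\<^sub>R v 1 s + g' s *\<^sub>R v 0 s)
      else (\<lambda>s. (g s *\<^sub>R v 2 s + g' s *\<^sub>R v 1 s) + (g' s *\<^sub>R v 1 s + g'' s *\<^sub>R v 0 s)))" for k :: nat
  note ip = bounded_bilinear.has_vector_derivative[OF bounded_bilinear_inner]
  have d: "(u 0 has_vector_derivative u 1 s) (at s within {0..1})" "(u 1 has_vector_derivative u 2 s) (at s within {0..1})"
     "(v 0 has_vector_derivative v 1 s) (at s within {0..1})" "(v 1 has_vector_derivative v 2 s) (at s within {0..1})"
    if "s \<in> {0..1}" for s
    using du[of 0 s] du[of 1 s] dv[of 0 s] dv[of 1 s] that by (simp_all add: numeral_2_eq_2)
  have db: "(b has_real_derivative b' s) (at s within {0..1})" if "s \<in> {0..1}" for s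
    using ip[OF d(1,2)[OF that]] unfolding b_def[abs_def] b'_def has_real_derivative_iff_has_vector_derivative .
  have dg: "(g has_real_derivative g' s) (at s within {0..1})" if "s \<in> {0..1}" for s
  proof -
    have "((\<lambda>s. u 0 s \<bullet> u 0 s) has_real_derivative u 0 s \<bullet> u 1 s + u 1 s \<bullet> u 0 s) (at s within {0..1})"
      using ip[OF d(1,1)[OF that]] unfolding has_real_derivative_iff_has_vector_derivative .
    from DERIV_inverse'[OF this] show ?thesis
      using nz[OF that] by (simp add: g_def[abs_def] g'_def b_def inner_commute power2_eq_square algebra_simps)
  qed
  have dg': "(g' has_real_derivative g'' s) (at s within {0..1})" if "s \<in> {0..1}" for s
    unfolding g'_def[abs_def] by (rule derivative_eq_intros db[OF that] dg[OF that] refl)+ (simp add: g''_def)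
  have W: "(W k has_vector_derivative W (Suc k) s) (at s within {0..1})" if k: "k < 2" and s: "s \<in> {0..1}" for k s
  proof (cases "k = 0")
    case True
    then show ?thesis using has_vector_derivative_scaleR[OF dg[OF s] d(3)[OF s]] by (simp add: W_def)
  next
    case False
    then have "k = 1" using k by simp
    then show ?thesis
      using has_vector_derivative_add[OF has_vector_derivative_scaleR[OF dg[OF s] d(4)[OF s]]
          has_vector_derivative_scaleR[OF dg'[OF s] d(3)[OF s]]] by (simp add: W_def)
  qed
  have cg: "continuous_on {0..1} g" "continuous_on {0..1} g'"
    using dg dg' by (blast intro: DERIV_continuous_on)+
  have cb: "continuous_on {0..1} b" "continuous_on {0..1} b'"
    unfolding b_def[abs_def] b'_def[abs_def] using cu by (auto intro!: continuous_intros)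
  have "continuous_on {0..1} g''" unfolding g''_def[abs_def] by (intro continuous_intros cg cb)
  then have "continuous_on {0..1} (W k)" for k
    unfolding W_def using cv cg by (auto intro!: continuous_intros)
  then obtain C where "jet 2 C W" using continuous_jet[of 2 W] W by blast
  moreover have "W 0 s = v 0 s /\<^sub>R (norm (u 0 s))\<^sup>2" for s
    by (simp add: W_def g_def power2_norm_eq_inner)
  ultimately show thesis by (rule that)
qed

section \<open>The matrices P and A, and identities along the end point trajectories\<close>

lemma outer_mult: "outer a b *v v = (b \<bullet> v) *\<^sub>R a"
  by (simp add: vec_eq_iff matrix_vector_mult_def outer_def inner_vec_def sum_distrib_left sum_distrib_right mult_ac)

lemma Pmat_mult: "norm (grad F z) = 1 \<Longrightarrow> Pmat F z *v v = proj (grad F z) v"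
  by (simp add: Pmat_def proj_def matrix_vector_mult_diff_rdistrib outer_mult inner_commute)

lemma Amat_mult: "norm (grad F z) = 1 \<Longrightarrow>
    Amat F z *v v = proj (grad F z) (hessian F z *v proj (grad F z) v)"
  by (simp add: Amat_def Pmat_mult flip: matrix_vector_mul_assoc)

text \<open>Here \<open>a\<close> is the trajectory of an end point and \<open>u\<close> is x_\<rho>
  along it. Differentiating F (a) = 0 once and twice in time gives the first two identities;
  differentiating the relation that \<open>u\<close> is normal and projecting gives the
  third.\<close>

lemma level_curve_identities:
  fixes F :: "real^'n::finite \<Rightarrow> real"
  assumes T: "0 < T" and t: "t \<in> {0..T}"
    and level: "\<forall>s\<in>{0..T}. F (a s) = 0 \<and> norm (grad F (a s)) = 1"
    and F: "\<forall>s\<in>{0..T}. F differentiable (at (a s))" "\<forall>i. partial i F differentiable (at (a t))"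
    and a: "\<forall>s\<in>{0..T}. (a has_vector_derivative a' s) (at s within {0..T})"
    and a': "(a' has_vector_derivative a'') (at t within {0..T})"
    and u: "\<forall>s\<in>{0..T}. u s = (u s \<bullet> grad F (a s)) *\<^sub>R grad F (a s)"
    and u': "(u has_vector_derivative u') (at t within {0..T})"
  shows "a' t \<bullet> grad F (a t) = 0"
    and "a'' \<bullet> grad F (a t) = - (a' t \<bullet> (Amat F (a t) *v a' t))"
    and "proj (grad F (a t)) u' = (u t \<bullet> grad F (a t)) *\<^sub>R (Amat F (a t) *v a' t)"
proof -
  define \<nu> where "\<nu> s = grad F (a s)" for s
  let ?H = "hessian F (a t)"
  have nb: "at s within {0..T} \<noteq> bot" if "s \<in> {0..T}" for s
    using T that by (simp add: trivial_limit_within islimpt_Icc)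
  \<comment> \<open>Derivatives within \<open>{0..T}\<close> are unique because T is positive, also
    at the end points, so identities on the interval may be differentiated at time 0.\<close>
  have zero: "d = 0" if "(f has_vector_derivative d) (at s within {0..T})" "\<And>s. s \<in> {0..T} \<Longrightarrow> f s = 0" "s \<in> {0..T}"
    for f :: "real \<Rightarrow> 'b::real_normed_vector" and d s
  proof (rule vector_derivative_unique_within[OF nb[OF that(3)] that(1)])
    show "(f has_vector_derivative 0) (at s within {0..T})"
      by (rule has_vector_derivative_transform[OF that(3) _ has_vector_derivative_const]) (use that(2) in auto)
  qed
  have tang: "a' s \<bullet> \<nu> s = 0" if s: "s \<in> {0..T}" for s
  proof (rule zero[OF _ _ s])
    show "((\<lambda>s. F (a s)) has_vector_derivative a' s \<bullet> \<nu> s) (at s within {0..T})"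
      using has_derivative_compose[OF bspec[OF a s, unfolded has_vector_derivative_def] has_derivative_grad[OF bspec[OF F(1) s]]]
      by (simp add: has_vector_derivative_def \<nu>_def inner_commute)
  qed (use level in auto)
  then show "a' t \<bullet> grad F (a t) = 0" using t by (simp add: \<nu>_def)
  have d\<nu>: "(\<nu> has_vector_derivative ?H *v a' t) (at t within {0..T})"
    using has_derivative_compose[OF bspec[OF a t, unfolded has_vector_derivative_def] has_derivative_grad_hessian[OF F(2)[rule_format]]]
    unfolding has_vector_derivative_def \<nu>_def[abs_def] by (simp add: matrix_vector_mult_scaleR)
  note ip = bounded_bilinear.has_vector_derivative[OF bounded_bilinear_inner]
  have n: "norm (\<nu> t) = 1" using level t by (simp add: \<nu>_def)
  have pa: "proj (\<nu> t) (a' t) = a' t" by (rule proj_tangential[OF tang[OF t]])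
  have A: "Amat F (a t) *v a' t = proj (\<nu> t) (?H *v a' t)"
    using Amat_mult[of F "a t" "a' t"] n pa by (simp add: \<nu>_def)
  have "a' t \<bullet> (?H *v a' t) + a'' \<bullet> \<nu> t = 0"
    by (rule zero[OF ip[OF a' d\<nu>] tang t])
  moreover have "a' t \<bullet> proj (\<nu> t) (?H *v a' t) = a' t \<bullet> (?H *v a' t)"
    using tang[OF t] by (simp add: proj_def inner_diff_right)
  ultimately show "a'' \<bullet> grad F (a t) = - (a' t \<bullet> (Amat F (a t) *v a' t))"
    by (simp add: A) (simp add: \<nu>_def)
  define c where "c s = u s \<bullet> \<nu> s" for s
  obtain c' where c': "(c has_real_derivative c') (at t within {0..T})"
    using ip[OF u' d\<nu>] unfolding c_def[abs_def] has_real_derivative_iff_has_vector_derivative by blast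
  \<comment> \<open>Product rule for u = c \<nu>. The derivative of the scalar \<open>c\<close>
    multiplies \<nu> and disappears under the projection, so its value is irrelevant.\<close>
  have "u' - (c t *\<^sub>R (?H *v a' t) + c' *\<^sub>R \<nu> t) = 0"
    by (rule zero[OF has_vector_derivative_diff[OF u' has_vector_derivative_scaleR[OF c' d\<nu>]] _ t])
       (use u in \<open>auto simp: c_def \<nu>_def\<close>)
  then have "u' = c t *\<^sub>R (?H *v a' t) + c' *\<^sub>R \<nu> t" by simp
  moreover have "proj (\<nu> t) (\<nu> t) = 0" using n by (simp add: proj_def norm_eq_1)
  ultimately have "proj (\<nu> t) u' = c t *\<^sub>R proj (\<nu> t) (?H *v a' t)"
    by (simp add: proj_add proj_scaleR)
  then show "proj (grad F (a t)) u' = (u t \<bullet> grad F (a t)) *\<^sub>R (Amat F (a t) *v a' t)"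
    by (simp add: A) (simp add: \<nu>_def c_def)
qed

section \<open>The initial data on the closed parameter interval\<close>

lemma Ck_on_3D:
  fixes F :: "real^'n::finite \<Rightarrow> real"
  assumes "Ck_on 3 F U"
  shows "z \<in> U \<Longrightarrow> F differentiable (at z)"
    and "z \<in> U \<Longrightarrow> partial i F differentiable (at z)"
    and "continuous_on U (grad F)"
proof -
  show d: "z \<in> U \<Longrightarrow> F differentiable (at z)" "z \<in> U \<Longrightarrow> partial i F differentiable (at z)" for z i
    using assms by (auto simp: numeral_3_eq_3)
  show "continuous_on U (grad F)"
    unfolding grad_def[abs_def]
    by (intro continuous_on_vec_lambda continuous_at_imp_continuous_on ballI
        differentiable_imp_continuous_within[of _ _ UNIV, simplified] d)
qed

lemma closed_closure_property:
  fixes f :: "'a::topological_space \<Rightarrow> 'b::topological_space"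
  assumes "continuous_on (closure S) f" "closed V" "\<And>z. z \<in> S \<Longrightarrow> f z \<in> V" "z \<in> closure S"
  shows "f z \<in> V"
  using image_closure_subset[OF assms(1,2)] assms(3,4) by blast

text \<open>The problem states its equations for t > 0, and the differential equation only for
  interior \<rho>, whereas the scheme starts at t = 0 and includes the end points. All conditions
  are closed and all derivatives continuous up to the boundary, so they pass to the closure.\<close>

lemma csf_extend:
  fixes F :: "real^'n::finite \<Rightarrow> real"
  assumes U: "open U" "frontier \<Omega> \<subseteq> U" "Ck_on 3 F U" "frontier \<Omega> = {z \<in> U. F z = 0}"
      "\<forall>z\<in>frontier \<Omega>. norm (grad F z) = 1"
    and T: "T > 0"
    and smooth: "(\<forall>\<rho>\<in>{0..1}. \<forall>t\<in>{0..T}. D 0 0 \<rho> t = x \<rho> t) \<and>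
     (\<forall>i j. continuous_on ({0..1} \<times> {0..T}) (\<lambda>(\<rho>, t). D i j \<rho> t) \<and>
       (\<forall>\<rho>\<in>{0..1}. \<forall>t\<in>{0..T}.
          ((\<lambda>r. D i j r t) has_vector_derivative D (Suc i) j \<rho> t) (at \<rho> within {0..1}) \<and>
          ((\<lambda>s. D i j \<rho> s) has_vector_derivative D i (Suc j) \<rho> t) (at t within {0..T})))"
    and csf: "solves_csf \<Omega> T x0 x"
    and c0: "\<forall>\<rho>\<in>{0<..<1}. \<forall>t\<in>{0..T}. c0 \<le> norm (d_rho x \<rho> t) \<and> norm (d_rho x \<rho> t) \<le> C0"
  shows "\<And>\<rho> t. \<rho> \<in> {0..1} \<Longrightarrow> t \<in> {0..T} \<Longrightarrow> (norm (D 1 0 \<rho> t))\<^sup>2 *\<^sub>R D 0 1 \<rho> t = D 2 0 \<rho> t"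
    and "\<And>\<rho> t. \<rho> \<in> {0..1} \<Longrightarrow> t \<in> {0..T} \<Longrightarrow> c0 \<le> norm (D 1 0 \<rho> t)"
    and "\<And>\<rho> t. \<rho> \<in> {0, 1} \<Longrightarrow> t \<in> {0..T} \<Longrightarrow> D 0 0 \<rho> t \<in> frontier \<Omega>"
    and "\<And>\<rho> t. \<rho> \<in> {0, 1} \<Longrightarrow> t \<in> {0..T} \<Longrightarrow>
       D 1 0 \<rho> t = (D 1 0 \<rho> t \<bullet> grad F (D 0 0 \<rho> t)) *\<^sub>R grad F (D 0 0 \<rho> t)"
proof -
  have D0: "\<And>\<rho> t. \<rho> \<in> {0..1} \<Longrightarrow> t \<in> {0..T} \<Longrightarrow> D 0 0 \<rho> t = x \<rho> t"
    and contD: "\<And>i j. continuous_on ({0..1} \<times> {0..T}) (\<lambda>(\<rho>, t). D i j \<rho> t)"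
    and D\<rho>: "\<And>i j \<rho> t. \<rho> \<in> {0..1} \<Longrightarrow> t \<in> {0..T} \<Longrightarrow>
        ((\<lambda>r. D i j r t) has_vector_derivative D (Suc i) j \<rho> t) (at \<rho> within {0..1})"
    and Dt: "\<And>i j \<rho> t. \<rho> \<in> {0..1} \<Longrightarrow> t \<in> {0..T} \<Longrightarrow>
        ((\<lambda>s. D i j \<rho> s) has_vector_derivative D i (Suc j) \<rho> t) (at t within {0..T})"
    using smooth by blast+
  have dr: "d_rho x \<rho> t = D 1 0 \<rho> t" if "\<rho> \<in> {0..1}" "t \<in> {0..T}" for \<rho> t
  proof -
    have "((\<lambda>r. x r t) has_vector_derivative D (Suc 0) 0 \<rho> t) (at \<rho> within {0..1})"
      by (rule has_vector_derivative_transform[OF that(1) _ D\<rho>[OF that]]) (use D0 that in auto)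
    then show ?thesis unfolding d_rho_def
      by (subst vector_derivative_within_closed_interval[of 0 1]) (use that in auto)
  qed
  have drr: "d_rho (d_rho x) \<rho> t = D 2 0 \<rho> t" if "\<rho> \<in> {0..1}" "t \<in> {0..T}" for \<rho> t
  proof -
    have "((\<lambda>r. d_rho x r t) has_vector_derivative D (Suc (Suc 0)) 0 \<rho> t) (at \<rho> within {0..1})"
      by (rule has_vector_derivative_transform[OF that(1) _ D\<rho>[OF that]]) (use dr that in auto)
    then show ?thesis unfolding d_rho_def[of "d_rho x"]
      by (subst vector_derivative_within_closed_interval[of 0 1]) (use that in \<open>auto simp: numeral_2_eq_2\<close>)
  qed
  have dt: "d_time T x \<rho> t = D 0 1 \<rho> t" if "\<rho> \<in> {0..1}" "t \<in> {0..T}" for \<rho> t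
  proof -
    have "((\<lambda>s. x \<rho> s) has_vector_derivative D 0 (Suc 0) \<rho> t) (at t within {0..T})"
      by (rule has_vector_derivative_transform[OF that(2) _ Dt[OF that]]) (use D0 that in auto)
    then show ?thesis unfolding d_time_def
      by (subst vector_derivative_within_closed_interval[of 0 T]) (use that T in auto)
  qed
  have cl: "closure ({0<..<1} \<times> {0<..T}) = {0..1::real} \<times> {0..T}" "closure {0<..T} = {0..T}"
    "closure ({0<..<1} \<times> {0..T}) = {0..1::real} \<times> {0..T}"
    using T by (simp_all add: closure_Times closure_greaterThanLessThan closure_greaterThanAtMost)
  have cD: "continuous_on ({0..1} \<times> {0..T}) (\<lambda>z. D i j (fst z) (snd z))" for i j
    using contD[of i j] by (simp add: case_prod_beta')
  show "(norm (D 1 0 \<rho> t))\<^sup>2 *\<^sub>R D 0 1 \<rho> t = D 2 0 \<rho> t" if "\<rho> \<in> {0..1}" "t \<in> {0..T}" for \<rho> t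
  proof -
    have "(\<lambda>z. (norm (D 1 0 (fst z) (snd z)))\<^sup>2 *\<^sub>R D 0 1 (fst z) (snd z) - D 2 0 (fst z) (snd z)) (\<rho>, t) \<in> {0}"
    proof (rule closed_closure_property[of "{0<..<1} \<times> {0<..T}"])
      show "continuous_on (closure ({0<..<1} \<times> {0<..T}))
          (\<lambda>z. (norm (D 1 0 (fst z) (snd z)))\<^sup>2 *\<^sub>R D 0 1 (fst z) (snd z) - D 2 0 (fst z) (snd z))"
        unfolding cl by (intro continuous_intros cD)
      show "(norm (D 1 0 (fst z) (snd z)))\<^sup>2 *\<^sub>R D 0 1 (fst z) (snd z) - D 2 0 (fst z) (snd z) \<in> {0}"
        if "z \<in> {0<..<1} \<times> {0<..T}" for z
      proof -
        have "fst z \<in> {0..1}" "snd z \<in> {0..T}" "fst z \<in> {0<..<1}" "snd z \<in> {0<..T}" using that by auto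
        then show ?thesis using csf dr drr dt unfolding solves_csf_def by fastforce
      qed
    qed (use that cl in auto)
    then show ?thesis by simp
  qed
  show "c0 \<le> norm (D 1 0 \<rho> t)" if "\<rho> \<in> {0..1}" "t \<in> {0..T}" for \<rho> t
  proof -
    have "(\<lambda>z. norm (D 1 0 (fst z) (snd z))) (\<rho>, t) \<in> {c0..}"
    proof (rule closed_closure_property[of "{0<..<1} \<times> {0..T}"])
      show "continuous_on (closure ({0<..<1} \<times> {0..T})) (\<lambda>z. norm (D 1 0 (fst z) (snd z)))"
        unfolding cl by (intro continuous_intros cD)
    qed (use that cl c0 dr in \<open>auto simp: less_imp_le\<close>)
    then show ?thesis by simp
  qed
  have cDt: "continuous_on {0..T} (D i j \<rho>)" if "\<rho> \<in> {0..1}" for i j \<rho>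
    using continuous_on_vector_derivative[of "{0..T}" "D i j \<rho>"] Dt[OF that] by blast
  show fr: "D 0 0 \<rho> t \<in> frontier \<Omega>" if "\<rho> \<in> {0, 1}" "t \<in> {0..T}" for \<rho> t
  proof (rule closed_closure_property[of "{0<..T}"])
    show "continuous_on (closure {0<..T}) (D 0 0 \<rho>)" unfolding cl using that by (intro cDt) auto
    show "D 0 0 \<rho> s \<in> frontier \<Omega>" if "s \<in> {0<..T}" for s
      using csf that \<open>\<rho> \<in> {0, 1}\<close> D0[of \<rho> s] unfolding solves_csf_def by auto
  qed (use that cl in auto)
  show "D 1 0 \<rho> t = (D 1 0 \<rho> t \<bullet> grad F (D 0 0 \<rho> t)) *\<^sub>R grad F (D 0 0 \<rho> t)" if "\<rho> \<in> {0, 1}" "t \<in> {0..T}" for \<rho> t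
  proof -
    have \<rho>: "\<rho> \<in> {0..1}" using that by auto
    let ?f = "\<lambda>t. D 1 0 \<rho> t - (D 1 0 \<rho> t \<bullet> grad F (D 0 0 \<rho> t)) *\<^sub>R grad F (D 0 0 \<rho> t)"
    have "?f t \<in> {0}"
    proof (rule closed_closure_property[of "{0<..T}"])
      have "continuous_on {0..T} (\<lambda>t. grad F (D 0 0 \<rho> t))"
        by (rule continuous_on_compose2[OF Ck_on_3D(3)[OF U(3)] cDt[OF \<rho>]]) (use fr that(1) U(2) in blast)
      then show "continuous_on (closure {0<..T}) ?f" unfolding cl by (intro continuous_intros cDt \<rho>)
      show "?f s \<in> {0}" if s: "s \<in> {0<..T}" for s
      proof -
        define \<nu> where "\<nu> = grad F (D 0 0 \<rho> s)"
        \<comment> \<open>The tangential part of x_\<rho>. It is itself an admissible tangent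
          vector, and testing the boundary condition with it shows that it has length zero.\<close>
        define v where "v = D 1 0 \<rho> s - (D 1 0 \<rho> s \<bullet> \<nu>) *\<^sub>R \<nu>"
        have s': "s \<in> {0..T}" using s by auto
        have p: "D 0 0 \<rho> s \<in> frontier \<Omega>" using fr[OF \<open>\<rho> \<in> {0, 1}\<close> s'] .
        then have n: "norm \<nu> = 1" using U(5) by (simp add: \<nu>_def)
        have \<nu>v: "\<nu> \<bullet> v = 0" using n by (simp add: v_def inner_diff_right norm_eq_1 inner_commute)
        have pF: "D 0 0 \<rho> s \<in> U" "F (D 0 0 \<rho> s) = 0" using p unfolding U(4) by simp_all
        have v: "v \<in> tangent_space (frontier \<Omega>) (x \<rho> s)"
          unfolding U(4) D0[OF \<rho> s', symmetric]
          by (rule tangent_space_level_set[OF U(1) pF(1) Ck_on_3D(1)[OF U(3)] Ck_on_3D(3)[OF U(3)] pF(2)])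
            (use n \<nu>v in \<open>simp_all add: \<nu>_def\<close>)
        have "\<forall>v\<in>tangent_space (frontier \<Omega>) (x \<rho> s). d_rho x \<rho> s \<bullet> v = 0"
          using csf s \<open>\<rho> \<in> {0, 1}\<close> unfolding solves_csf_def by blast
        then have "D 1 0 \<rho> s \<bullet> v = 0" using v dr[OF \<rho> s'] by simp
        moreover have "v \<bullet> v = D 1 0 \<rho> s \<bullet> v - (D 1 0 \<rho> s \<bullet> \<nu>) * (\<nu> \<bullet> v)"
          by (simp add: v_def inner_diff_left)
        ultimately have "v \<bullet> v = 0" using \<nu>v by simp
        then show ?thesis by (simp add: v_def \<nu>_def)
      qed
    qed (use that cl in auto)
    then show ?thesis by simp
  qed
qed

text \<open>The arguments \<open>u\<close>, \<open>a\<close>, \<open>w\<close>, \<open>u'\<close> stand for \<open>x\<^sub>\<rho>\<close>, \<open>x\<^sub>t\<close>, \<open>x\<^sub>\<rho>\<^sub>\<rho>\<^sub>t / |x\<^sub>\<rho>|\<^sup>2\<close>, \<open>x\<^sub>\<rho>\<^sub>t\<close> at an end point.\<close>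

definition end_identities :: "(real^'n::finite \<Rightarrow> real) \<Rightarrow> real^'n \<Rightarrow> real^'n \<Rightarrow> real^'n \<Rightarrow> real^'n \<Rightarrow> real^'n \<Rightarrow> bool" where
  "end_identities F y u a w u' \<longleftrightarrow> norm (grad F y) = 1 \<and> u = (u \<bullet> grad F y) *\<^sub>R grad F y \<and>
     a \<bullet> grad F y = 0 \<and> w \<bullet> grad F y = - (a \<bullet> (Amat F y *v a)) \<and>
     proj (grad F y) u' = (u \<bullet> grad F y) *\<^sub>R (Amat F y *v a)"

text \<open>\<open>f0\<close> and \<open>f1\<close> are the spatial jets of x and x_t at time 0, and
  \<open>w\<close> is the correction. The last two conclusions bound the distance of x from the
  comparison function and its Lipschitz constant in space; the latter is what controls difference
  quotients.\<close>

lemma csf_initial_data: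
  fixes F :: "real^'n::finite \<Rightarrow> real"
  assumes U: "open U" "frontier \<Omega> \<subseteq> U" "Ck_on 3 F U" "frontier \<Omega> = {z \<in> U. F z = 0}"
      "\<forall>z\<in>frontier \<Omega>. norm (grad F z) = 1"
    and T: "T > 0" and smooth: "smooth_evolution T x" and csf: "solves_csf \<Omega> T x0 x" and c0: "c0 > 0"
    "\<forall>\<rho>\<in>{0<..<1}. \<forall>t\<in>{0..T}. c0 \<le> norm (d_rho x \<rho> t) \<and> norm (d_rho x \<rho> t) \<le> C0"
  obtains C f0 f1 w where "jet 4 C f0" "jet 4 C f1" "jet 2 C w"
    and "\<And>s. s \<in> {0..1} \<Longrightarrow> f0 0 s = x0 s" "\<And>s. s \<in> {0..1} \<Longrightarrow> c0 \<le> norm (f0 1 s)"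
    and "\<And>s. s \<in> {0..1} \<Longrightarrow> (norm (f0 1 s))\<^sup>2 *\<^sub>R f1 0 s = f0 2 s"
    and "\<And>s. s \<in> {0..1} \<Longrightarrow> (norm (f0 1 s))\<^sup>2 *\<^sub>R w 0 s = f1 2 s"
    and "\<And>s. s \<in> {0, 1} \<Longrightarrow> end_identities F (x0 s) (f0 1 s) (f1 0 s) (w 0 s) (f1 1 s)"
    and "\<And>dt s. dt \<in> {0..T} \<Longrightarrow> s \<in> {0..1} \<Longrightarrow>
      norm (x s dt - (f0 0 s + dt *\<^sub>R f1 0 s + dt\<^sup>2 *\<^sub>R w 0 s)) \<le> C * dt\<^sup>2"
    and "\<And>dt s s'. dt \<in> {0..T} \<Longrightarrow> s \<in> {0..1} \<Longrightarrow> s' \<in> {0..1} \<Longrightarrow>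
      norm ((x s dt - (f0 0 s + dt *\<^sub>R f1 0 s + dt\<^sup>2 *\<^sub>R w 0 s)) -
        (x s' dt - (f0 0 s' + dt *\<^sub>R f1 0 s' + dt\<^sup>2 *\<^sub>R w 0 s'))) \<le> C * dt\<^sup>2 * \<bar>s - s'\<bar>"
proof -
  obtain D where sm: "(\<forall>\<rho>\<in>{0..1}. \<forall>t\<in>{0..T}. D 0 0 \<rho> t = x \<rho> t) \<and>
     (\<forall>i j. continuous_on ({0..1} \<times> {0..T}) (\<lambda>(\<rho>, t). D i j \<rho> t) \<and>
       (\<forall>\<rho>\<in>{0..1}. \<forall>t\<in>{0..T}.
          ((\<lambda>r. D i j r t) has_vector_derivative D (Suc i) j \<rho> t) (at \<rho> within {0..1}) \<and>
          ((\<lambda>s. D i j \<rho> s) has_vector_derivative D i (Suc j) \<rho> t) (at t within {0..T})))"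
    using smooth unfolding smooth_evolution_def by blast
  then have D0: "\<And>\<rho> t. \<rho> \<in> {0..1} \<Longrightarrow> t \<in> {0..T} \<Longrightarrow> D 0 0 \<rho> t = x \<rho> t"
    and contD: "\<And>i j. continuous_on ({0..1} \<times> {0..T}) (\<lambda>(\<rho>, t). D i j \<rho> t)"
    and D\<rho>: "\<And>i j \<rho> t. \<rho> \<in> {0..1} \<Longrightarrow> t \<in> {0..T} \<Longrightarrow>
        ((\<lambda>r. D i j r t) has_vector_derivative D (Suc i) j \<rho> t) (at \<rho> within {0..1})"
    and Dt: "\<And>i j \<rho> t. \<rho> \<in> {0..1} \<Longrightarrow> t \<in> {0..T} \<Longrightarrow>
        ((\<lambda>s. D i j \<rho> s) has_vector_derivative D i (Suc j) \<rho> t) (at t within {0..T})"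
    by blast+
  note ext = csf_extend[OF U T sm csf c0(2)]
  have T0: "0 \<in> {0..T}" using T by simp
  have cont: "continuous_on {0..1} (\<lambda>s. D i j s 0)" for i j
    using D\<rho>[OF _ T0, of _ i j] by (intro continuous_on_vector_derivative)
  have nz: "D 1 0 s 0 \<noteq> 0" if "s \<in> {0..1}" for s using ext(2)[OF that T0] c0(1) by auto
  obtain C1 where C1: "jet 4 C1 (\<lambda>i s. D i 0 s 0)"
    using continuous_jet[of 4 "\<lambda>i s. D i 0 s 0"] D\<rho>[OF _ T0] cont by blast
  obtain C2 where C2: "jet 4 C2 (\<lambda>i s. D i 1 s 0)"
    using continuous_jet[of 4 "\<lambda>i s. D i 1 s 0"] D\<rho>[OF _ T0] cont by blast
  \<comment> \<open>The index shifts select x_\<rho> for the denominator and x_\<rho>\<rho>t for the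
    numerator.\<close>
  obtain C3 w where C3: "jet 2 C3 w" and w: "\<And>s. w 0 s = D 2 1 s 0 /\<^sub>R (norm (D 1 0 s 0))\<^sup>2"
    using quotient_jet[of "\<lambda>i s. D (i + 1) 0 s 0" "\<lambda>i s. D (i + 2) 1 s 0"] D\<rho>[OF _ T0] cont nz
    by (auto simp: numeral_2_eq_2)
  have "\<exists>B. \<forall>\<rho>\<in>{0..1}. \<forall>t\<in>{0..T}. norm (D i 2 \<rho> t) \<le> B" for i
  proof -
    have "bounded ((\<lambda>(\<rho>, t). D i 2 \<rho> t) ` ({0..1} \<times> {0..T}))"
      by (intro compact_imp_bounded compact_continuous_image contD compact_Times) auto
    then show ?thesis unfolding bounded_iff by fastforce
  qed
  then obtain B where B: "\<And>i \<rho> t. \<rho> \<in> {0..1} \<Longrightarrow> t \<in> {0..T} \<Longrightarrow> norm (D i 2 \<rho> t) \<le> B i" by metis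
  define C where "C = Max {C1, C2, B 0 + C3, B 1 + C3, C3}"
  have C: "C1 \<le> C" "C2 \<le> C" "B 0 + C3 \<le> C" "B 1 + C3 \<le> C" "C3 \<le> C" by (simp_all add: C_def)
  have time: "norm (D i 0 s dt - (D i 0 s 0 + dt *\<^sub>R D i 1 s 0)) \<le> B i * dt\<^sup>2"
    if "s \<in> {0..1}" "dt \<in> {0..T}" for i s dt
    using taylor_bound[of 2 0 T "\<lambda>k t. D i k s t" "B i" 0 dt] Dt[OF that(1)] B[OF that(1)] that(2) T0
    by (simp add: numeral_2_eq_2)
  have corr: "norm (D i 0 s dt - (D i 0 s 0 + dt *\<^sub>R D i 1 s 0 + dt\<^sup>2 *\<^sub>R w i s)) \<le> C * dt\<^sup>2"
    if "s \<in> {0..1}" "dt \<in> {0..T}" "i \<in> {0, 1}" for i s dt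
  proof -
    have "norm (dt\<^sup>2 *\<^sub>R w i s) \<le> dt\<^sup>2 * C3"
      unfolding norm_scaleR using jet_bound[OF C3, of i s] that by (auto intro!: mult_left_mono)
    then have "norm (D i 0 s dt - (D i 0 s 0 + dt *\<^sub>R D i 1 s 0) - dt\<^sup>2 *\<^sub>R w i s) \<le> B i * dt\<^sup>2 + dt\<^sup>2 * C3"
      using time[OF that(1,2), of i] by (meson add_mono norm_triangle_ineq4 order_trans)
    also have "\<dots> = (B i + C3) * dt\<^sup>2" by (simp add: algebra_simps)
    also have "\<dots> \<le> C * dt\<^sup>2" using C that(3) by (intro mult_right_mono) auto
    finally show ?thesis by (simp add: algebra_simps)
  qed
  define G where "G dt s = x s dt - (D 0 0 s 0 + dt *\<^sub>R D 0 1 s 0 + dt\<^sup>2 *\<^sub>R w 0 s)" for dt s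
  have G': "((\<lambda>s. G dt s) has_vector_derivative
      D 1 0 s dt - (D 1 0 s 0 + dt *\<^sub>R D 1 1 s 0 + dt\<^sup>2 *\<^sub>R w 1 s)) (at s within {0..1})"
    if s: "s \<in> {0..1}" and dt: "dt \<in> {0..T}" for dt s
  proof -
    have "((\<lambda>s. x s dt) has_vector_derivative D 1 0 s dt) (at s within {0..1})"
      using has_vector_derivative_transform[OF s _ D\<rho>[OF s dt, of 0 0]] D0 dt by auto
    moreover have "(w 0 has_vector_derivative w 1 s) (at s within {0..1})"
      using C3 s by (simp add: jet_def)
    ultimately show ?thesis unfolding G_def
      using D\<rho>[OF s T0, of 0 0] D\<rho>[OF s T0, of 0 1]
      by (auto intro!: derivative_eq_intros)
  qed
  have Gdiff: "norm (G dt s - G dt s') \<le> C * dt\<^sup>2 * \<bar>s - s'\<bar>"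
    if "dt \<in> {0..T}" "s \<in> {0..1}" "s' \<in> {0..1}" for dt s s'
    by (rule vector_derivative_bound[of "{0..1}", OF _ G' corr]) (use that in auto)
  have Ge: "norm (G dt s) \<le> C * dt\<^sup>2" if "dt \<in> {0..T}" "s \<in> {0..1}" for dt s
    using corr[OF that(2,1), of 0] D0[OF that(2,1)] by (simp add: G_def)
  have x0: "D 0 0 s 0 = x0 s" if "s \<in> {0..1}" for s
    using D0[OF that T0] csf that unfolding solves_csf_def by simp
  have weq: "(norm (D 1 0 s 0))\<^sup>2 *\<^sub>R w 0 s = D 2 1 s 0" if "s \<in> {0..1}" for s
    using nz[OF that] by (simp add: w)
  have ends: "end_identities F (x0 e) (D 1 0 e 0) (D 0 1 e 0) (w 0 e) (D 1 1 e 0)" if e: "e \<in> {0, 1}" for e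
  proof -
    have e': "e \<in> {0..1}" using e by auto
    define \<nu> where "\<nu> = grad F (x0 e)"
    have fr: "D 0 0 e s \<in> U" "F (D 0 0 e s) = 0" "norm (grad F (D 0 0 e s)) = 1" if "s \<in> {0..T}" for s
    proof -
      have "D 0 0 e s \<in> frontier \<Omega>" using ext(3)[OF e that] .
      then show "D 0 0 e s \<in> U" "F (D 0 0 e s) = 0" "norm (grad F (D 0 0 e s)) = 1" using U(5) unfolding U(4) by simp_all
    qed
    have Dt': "((\<lambda>s. D i j e s) has_vector_derivative D i (Suc j) e t) (at t within {0..T})"
      if "t \<in> {0..T}" for i j t using Dt[OF e' that] .
    have "\<forall>s\<in>{0..T}. F (D 0 0 e s) = 0 \<and> norm (grad F (D 0 0 e s)) = 1"
      "\<forall>s\<in>{0..T}. F differentiable (at (D 0 0 e s))" "\<forall>i. partial i F differentiable (at (D 0 0 e 0))"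
      "\<forall>s\<in>{0..T}. ((\<lambda>s. D 0 0 e s) has_vector_derivative D 0 (Suc 0) e s) (at s within {0..T})"
      "\<forall>s\<in>{0..T}. D 1 0 e s = (D 1 0 e s \<bullet> grad F (D 0 0 e s)) *\<^sub>R grad F (D 0 0 e s)"
      using fr Ck_on_3D(1)[OF U(3) fr(1)] Ck_on_3D(2)[OF U(3) fr(1)[OF T0]] Dt'[of _ 0 0] ext(4)[OF e] by blast+
    note id = level_curve_identities[OF T T0 this(1-4) Dt'[OF T0, of 0 "Suc 0"] this(5) Dt'[OF T0, of 1 0]]
    have n: "norm \<nu> = 1" using fr(3)[OF T0] x0[OF e'] by (simp add: \<nu>_def)
    have id1: "D 0 1 e 0 \<bullet> \<nu> = 0" using id(1) x0[OF e'] by (simp add: \<nu>_def)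
    have id2: "D 0 2 e 0 \<bullet> \<nu> = - (D 0 1 e 0 \<bullet> (Amat F (x0 e) *v D 0 1 e 0))"
      using id(2) x0[OF e'] by (simp add: \<nu>_def numeral_2_eq_2)
    have id3: "proj \<nu> (D 1 1 e 0) = (D 1 0 e 0 \<bullet> \<nu>) *\<^sub>R (Amat F (x0 e) *v D 0 1 e 0)"
      using id(3) x0[OF e'] by (simp add: \<nu>_def)
    have id4: "D 1 0 e 0 = (D 1 0 e 0 \<bullet> \<nu>) *\<^sub>R \<nu>" using ext(4)[OF e T0] x0[OF e'] by (simp add: \<nu>_def)
    note ip = bounded_bilinear.has_vector_derivative[OF bounded_bilinear_inner]
    \<comment> \<open>Time derivative of the evolution equation at the end point. The derivative of
      the squared speed multiplies x_t, which is tangential, so in the normal direction the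
      correction \<open>w\<close> agrees with x_tt.\<close>
    have "((\<lambda>t. D 1 0 e t \<bullet> D 1 0 e t) has_real_derivative D 1 0 e 0 \<bullet> D 1 1 e 0 + D 1 1 e 0 \<bullet> D 1 0 e 0) (at 0 within {0..T})"
      using ip[OF Dt'[OF T0, of 1 0] Dt'[OF T0, of 1 0]] unfolding has_real_derivative_iff_has_vector_derivative by simp
    from has_vector_derivative_scaleR[OF this Dt'[OF T0, of 0 1]]
    have "((\<lambda>t. (D 1 0 e t \<bullet> D 1 0 e t) *\<^sub>R D 0 1 e t) has_vector_derivative
       (D 1 0 e 0 \<bullet> D 1 0 e 0) *\<^sub>R D 0 2 e 0 + (D 1 0 e 0 \<bullet> D 1 1 e 0 + D 1 1 e 0 \<bullet> D 1 0 e 0) *\<^sub>R D 0 1 e 0) (at 0 within {0..T})"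
      by (simp add: numeral_2_eq_2)
    then have "(D 2 0 e has_vector_derivative
       (D 1 0 e 0 \<bullet> D 1 0 e 0) *\<^sub>R D 0 2 e 0 + (D 1 0 e 0 \<bullet> D 1 1 e 0 + D 1 1 e 0 \<bullet> D 1 0 e 0) *\<^sub>R D 0 1 e 0) (at 0 within {0..T})"
      by (rule has_vector_derivative_transform[OF T0, rotated]) (use ext(1)[OF e'] in \<open>simp add: power2_norm_eq_inner\<close>)
    moreover have "(D 2 0 e has_vector_derivative D 2 1 e 0) (at 0 within {0..T})"
      using Dt'[OF T0, of 2 0] by simp
    ultimately have "D 2 1 e 0 = (D 1 0 e 0 \<bullet> D 1 0 e 0) *\<^sub>R D 0 2 e 0 + (D 1 0 e 0 \<bullet> D 1 1 e 0 + D 1 1 e 0 \<bullet> D 1 0 e 0) *\<^sub>R D 0 1 e 0"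
      using T by (intro vector_derivative_unique_within[of 0 "{0..T}"]) (auto simp: trivial_limit_within islimpt_Icc)
    then have "D 2 1 e 0 \<bullet> \<nu> = (D 1 0 e 0 \<bullet> D 1 0 e 0) * (D 0 2 e 0 \<bullet> \<nu>)"
      using id1 by (simp add: inner_add_left)
    then have "w 0 e \<bullet> \<nu> = D 0 2 e 0 \<bullet> \<nu>"
      using nz[OF e'] by (simp add: w power2_norm_eq_inner)
    then show ?thesis using n id1 id2 id3 id4 unfolding end_identities_def \<nu>_def by simp
  qed
  show thesis
    by (rule that[OF jet_mono[OF C1 C(1)] jet_mono[OF C2 C(2)] jet_mono[OF C3 C(5)] x0 ext(2)[OF _ T0] ext(1)[OF _ T0] weq ends
          Ge[unfolded G_def] Gdiff[unfolded G_def]])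
qed

section \<open>The first time step\<close>

text \<open>The case of zero residuals in \<open>scheme_stability\<close>: a sum of nonnegative
  terms with positive weights is at most zero.\<close>

lemma scheme_unique:
  fixes E :: "nat \<Rightarrow> 'a::real_inner"
  assumes J: "J \<ge> 2" "h = 1 / real J" and dt: "0 < dt" "dt \<le> \<gamma> * h"
    and \<gamma>: "0 < \<gamma>" "\<gamma> \<le> 1" and K: "K * dt \<le> 1/2" "K + 3/2 + 8 * K\<^sup>2 \<le> m / (2 * \<gamma>)" and m: "m > 0"
    and ok: "end_ok m K h A0 \<nu>0 d0" "end_ok m K h A1 \<nu>1 d1"
    and p: "\<And>j. j \<in> {1..<J} \<Longrightarrow> m \<le> p j"
    and interior: "\<And>j. j \<in> {1..<J} \<Longrightarrow> (p j / dt) *\<^sub>R E j - d2 h E j = 0"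
    and N: "bnormal A0 \<nu>0 d0 dt h (E 0) = 0" "bnormal A1 \<nu>1 d1 dt h (E J) = 0"
    and T: "btangent A0 \<nu>0 d0 dt h (E 0) (dplus h E 0) = 0" "btangent A1 \<nu>1 d1 dt h (E J) (- dminus h E J) = 0"
    and j: "j \<le> J"
  shows "E j = 0"
proof -
  have h: "0 < h" using J by simp
  define S where "S = (\<Sum>j\<in>{1..<J}. h * (norm (E j))\<^sup>2)"
  define G where "G = (\<Sum>j\<in>{1..J}. h * (norm (dminus h E j))\<^sup>2)"
  have J1: "J \<ge> 1" using J by simp
  have "norm ((p j / dt) *\<^sub>R E j - d2 h E j) \<le> 0" if "j \<in> {1..<J}" for j using interior[OF that] by simp
  then have *: "m / 2 * S + 1/2 * G + (norm (E 0))\<^sup>2 / 8 + (norm (E J))\<^sup>2 / 8 \<le> 0\<^sup>2 / (2 * m) + 0\<^sup>2 + 18 * 0\<^sup>2 / h"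
    unfolding S_def G_def using N T
    by (intro scheme_stability[OF J1 J(2) dt \<gamma> K m ok p]) auto
  have S0: "0 \<le> S" "0 \<le> G" unfolding S_def G_def using h by (intro sum_nonneg; simp)+
  then have "0 \<le> m / 2 * S" using m by simp
  moreover have "m / 2 * S + 1/2 * G + (norm (E 0))\<^sup>2 / 8 + (norm (E J))\<^sup>2 / 8 \<le> 0" using * by simp
  ultimately have "(norm (E 0))\<^sup>2 \<le> 0" "(norm (E J))\<^sup>2 \<le> 0" "m / 2 * S = 0"
    using S0 zero_le_power2[of "norm (E 0)"] zero_le_power2[of "norm (E J)"] by linarith+
  then have "E 0 = 0" "E J = 0" "S = 0" using m by auto
  moreover have "E j = 0" if "j \<in> {1..<J}"
    using \<open>S = 0\<close> that h unfolding S_def by (subst (asm) sum_nonneg_eq_0_iff) auto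
  ultimately show ?thesis using j by (cases "j = 0 \<or> j = J") auto
qed

text \<open>The unknown is the increment E = Y - y. The initial curve then enters only as data,
  through \<open>d2 h y\<close> and its projected end quotients, and \<open>scheme_unique\<close>
  supplies the injectivity that shooting needs.\<close>

lemma scheme_solvable:
  fixes y :: "nat \<Rightarrow> 'a::euclidean_space"
  assumes J: "J \<ge> 2" "h = 1 / real J" and dt: "0 < dt" "dt \<le> \<gamma> * h"
    and \<gamma>: "0 < \<gamma>" "\<gamma> \<le> 1" and K: "K * dt \<le> 1/2" "K + 3/2 + 8 * K\<^sup>2 \<le> m / (2 * \<gamma>)" and m: "m > 0"
    and ok: "end_ok m K h A0 \<nu>0 d0" "end_ok m K h A1 \<nu>1 d1"
    and p: "\<And>j. j \<in> {1..<J} \<Longrightarrow> m \<le> p j"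
  obtains Y where "\<And>j. j \<in> {1..<J} \<Longrightarrow> (p j / dt) *\<^sub>R (Y j - y j) - d2 h Y j = 0"
    "bnormal A0 \<nu>0 d0 dt h (Y 0 - y 0) = 0" "bnormal A1 \<nu>1 d1 dt h (Y J - y J) = 0"
    "btangent A0 \<nu>0 d0 dt h (Y 0 - y 0) (dplus h Y 0) = 0"
    "btangent A1 \<nu>1 d1 dt h (Y J - y J) (- dminus h Y J) = 0"
proof -
  \<comment> \<open>The scalar normal and the tangential condition joined in one vector, as the
    square boundary map requires.\<close>
  define L where "L A \<nu> d ab = bnormal A \<nu> d dt h (fst ab) *\<^sub>R \<nu> + btangent A \<nu> d dt h (fst ab) ((snd ab - fst ab) /\<^sub>R h)"
    for A and \<nu> d :: 'a and ab :: "'a \<times> 'a"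
  have h: "h > 0" using J by simp
  have linA: "linear A0" "linear A1" using ok by (auto simp: end_ok_def)
  have lin: "linear (L A \<nu> d)" if "linear A" for A \<nu> d
  proof (rule linearI)
    show "L A \<nu> d (ab + cd) = L A \<nu> d ab + L A \<nu> d cd" for ab cd
    proof -
      have "(snd ab + snd cd - (fst ab + fst cd)) /\<^sub>R h = (snd ab - fst ab) /\<^sub>R h + (snd cd - fst cd) /\<^sub>R h"
        by (simp add: algebra_simps)
      then show ?thesis
        by (simp only: L_def bnormal_add btangent_add[OF that] fst_add snd_add scaleR_left_distrib) simp
    qed
    show "L A \<nu> d (c *\<^sub>R ab) = c *\<^sub>R L A \<nu> d ab" for c ab
    proof -
      have "(c *\<^sub>R snd ab - c *\<^sub>R fst ab) /\<^sub>R h = c *\<^sub>R ((snd ab - fst ab) /\<^sub>R h)"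
        by (simp add: algebra_simps)
      then show ?thesis
        by (simp only: L_def bnormal_scaleR btangent_scaleR[OF that] fst_scaleR snd_scaleR)
           (simp add: scaleR_right_distrib)
    qed
  qed
  \<comment> \<open>The prescribed value is tangential, so the inner product with \<nu> isolates the
    normal condition.\<close>
  have split: "bnormal A \<nu> d dt h (fst ab) = 0 \<and> btangent A \<nu> d dt h (fst ab) ((snd ab - fst ab) /\<^sub>R h) = proj \<nu> v"
    if "L A \<nu> d ab = proj \<nu> v" "end_ok m K h A \<nu> d" for A \<nu> d ab v
  proof -
    have n: "norm \<nu> = 1" and A: "\<And>v. A v \<bullet> \<nu> = 0" using that(2) by (auto simp: end_ok_def)
    have "L A \<nu> d ab \<bullet> \<nu> = 0" unfolding that(1) by (rule inner_proj_normal[OF n])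
    then have "bnormal A \<nu> d dt h (fst ab) = 0"
      using btangent_normal[of \<nu> A, OF n A] n by (auto simp: L_def inner_add_left norm_eq_1)
    then show ?thesis using that(1) by (simp add: L_def)
  qed
  have dpE: "(E 1 - E 0) /\<^sub>R h = dplus h E 0" and dmE: "(E (J - 1) - E J) /\<^sub>R h = - dminus h E J" for E :: "nat \<Rightarrow> 'a"
    by (simp_all add: dplus_def dminus_def algebra_simps)
  obtain E where E: "\<And>j. j \<in> {1..<J} \<Longrightarrow> (p j / dt) *\<^sub>R E j - d2 h E j = d2 h y j"
    "L A0 \<nu>0 d0 (E 0, E 1) = proj \<nu>0 (dplus h y 0)" "L A1 \<nu>1 d1 (E J, E (J - 1)) = proj \<nu>1 (- dminus h y J)"
  proof (rule two_point_problem_solvable[of h "L A0 \<nu>0 d0" "L A1 \<nu>1 d1" J "\<lambda>j. p j / dt" "d2 h y"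
      "proj \<nu>0 (dplus h y 0)" "proj \<nu>1 (- dminus h y J)"])
    fix E :: "nat \<Rightarrow> 'a"
    assume i: "\<And>j. j \<in> {1..<J} \<Longrightarrow> (p j / dt) *\<^sub>R E j - d2 h E j = 0"
      and l: "L A0 \<nu>0 d0 (E 0, E 1) = 0" "L A1 \<nu>1 d1 (E J, E (J - 1)) = 0"
    have z: "proj \<nu> 0 = 0" for \<nu> :: 'a by (simp add: proj_def)
    have b: "bnormal A0 \<nu>0 d0 dt h (E 0) = 0" "btangent A0 \<nu>0 d0 dt h (E 0) (dplus h E 0) = 0"
      "bnormal A1 \<nu>1 d1 dt h (E J) = 0" "btangent A1 \<nu>1 d1 dt h (E J) (- dminus h E J) = 0"
      using split[OF _ ok(1), of "(E 0, E 1)" 0] split[OF _ ok(2), of "(E J, E (J - 1))" 0] l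
      unfolding z fst_conv snd_conv dpE dmE by blast+
    have "E j = 0" if "j \<le> J" for j
      by (rule scheme_unique[OF J dt \<gamma> K m ok p i b(1,3,2,4) that])
    then show "E 0 = 0 \<and> E 1 = 0" using J by simp
  qed (use h lin linA in auto)
  define Y where "Y j = y j + E j" for j
  have d2: "d2 h Y j = d2 h y j + d2 h E j" for j by (simp add: Y_def d2_def dplus_def dminus_def algebra_simps)
  have dp: "dplus h Y 0 = dplus h E 0 + dplus h y 0" by (simp add: Y_def dplus_def algebra_simps)
  have dm: "- dminus h Y J = - dminus h E J + - dminus h y J" by (simp add: Y_def dminus_def algebra_simps)
  have bt: "btangent A \<nu> d dt h e (d' + d'') = btangent A \<nu> d dt h e d' - proj \<nu> d''" for A \<nu> d e d' and d'' :: 'a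
    by (simp add: btangent_def proj_add)
  note s0 = split[OF E(2) ok(1), unfolded fst_conv snd_conv dpE]
  note s1 = split[OF E(3) ok(2), unfolded fst_conv snd_conv dmE]
  show thesis
  proof (rule that[of Y])
    show "(p j / dt) *\<^sub>R (Y j - y j) - d2 h Y j = 0" if "j \<in> {1..<J}" for j
      unfolding d2 using E(1)[OF that] by (simp add: Y_def algebra_simps)
    show "btangent A0 \<nu>0 d0 dt h (Y 0 - y 0) (dplus h Y 0) = 0" unfolding dp bt using s0 by (simp add: Y_def)
    show "btangent A1 \<nu>1 d1 dt h (Y J - y J) (- dminus h Y J) = 0" unfolding dm bt using s1 by (simp add: Y_def)
  qed (use s0 s1 in \<open>simp_all add: Y_def\<close>)
qed

section \<open>Translation of the linear system into the abstract scheme\<close>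

lemma end_normal_eq:
  assumes "dt > 0"
  shows "(e /\<^sub>R dt) \<bullet> (\<nu> + (2 * dt / (h * (norm d0)\<^sup>2)) *\<^sub>R A d0) = 0 \<longleftrightarrow> bnormal A \<nu> d0 dt h e = 0"
  using assms by (simp add: bnormal_def)

lemma end_tangent_eq:
  fixes F :: "real^'n::finite \<Rightarrow> real"
  assumes dt: "dt > 0" and h: "h > 0" and n: "norm (grad F y) = 1" and d0: "d0 \<noteq> 0"
  shows "(norm d0)\<^sup>2 *\<^sub>R ((mat 1 + (2 * dt / (h * (norm d0)\<^sup>2) * (d0 \<bullet> grad F y)) *\<^sub>R Amat F y) *v
      (Pmat F y *v (e /\<^sub>R dt))) - (2 / h) *\<^sub>R (Pmat F y *v d) = 0 \<longleftrightarrow>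
    btangent ((*v) (Amat F y)) (grad F y) d0 dt h e d = 0"
proof -
  have "(norm d0)\<^sup>2 *\<^sub>R ((mat 1 + (2 * dt / (h * (norm d0)\<^sup>2) * (d0 \<bullet> grad F y)) *\<^sub>R Amat F y) *v
      (Pmat F y *v (e /\<^sub>R dt))) - (2 / h) *\<^sub>R (Pmat F y *v d) =
    (2 / h) *\<^sub>R btangent ((*v) (Amat F y)) (grad F y) d0 dt h e d"
  proof -
    let ?q = "(norm d0)\<^sup>2" and ?v = "proj (grad F y) e"
    define k where "k = 2 * dt / (h * ?q) * (d0 \<bullet> grad F y)"
    have q: "?q \<noteq> 0" using d0 by simp
    have c: "?q * (1 / dt) = 2 / h * (h * ?q / (2 * dt))" "?q * (1 / dt * k) = 2 / h * (d0 \<bullet> grad F y)"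
      using q h dt by (simp_all add: k_def field_simps)
    have M: "(mat 1 + k *\<^sub>R Amat F y) *v w = w + k *\<^sub>R (Amat F y *v w)" for w
      by (simp add: matrix_vector_mult_add_rdistrib scaleR_matrix_vector_assoc)
    have "?q *\<^sub>R ((mat 1 + k *\<^sub>R Amat F y) *v ((1 / dt) *\<^sub>R ?v)) =
        (?q * (1 / dt)) *\<^sub>R ?v + (?q * (1 / dt * k)) *\<^sub>R (Amat F y *v ?v)"
      by (simp only: M matrix_vector_mult_scaleR scaleR_right_distrib scaleR_scaleR)
    also have "\<dots> = (2 / h) *\<^sub>R ((h * ?q / (2 * dt)) *\<^sub>R ?v + (d0 \<bullet> grad F y) *\<^sub>R (Amat F y *v ?v))"
      by (simp only: c scaleR_right_distrib scaleR_scaleR)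
    finally show ?thesis
      unfolding Pmat_mult[OF n] btangent_def proj_scaleR k_def[symmetric] scaleR_right_diff_distrib
      by (simp add: inverse_eq_divide)
  qed
  then show ?thesis using h by simp
qed

text \<open>At \<rho> = 1 the inward quotient is the negative of \<open>dminus\<close>; inserting it
  turns the signs of the right-hand conditions into those of the left-hand ones, so both ends share
  \<open>bnormal\<close> and \<open>btangent\<close>.\<close>

lemma linear_system_iff:
  fixes F :: "real^'n::finite \<Rightarrow> real"
  assumes y_def: "y = (\<lambda>j. x0 (node J j))" and J: "J \<ge> 1" and h: "h = 1 / real J" and dt: "dt > 0"
    and n: "norm (grad F (x0 0)) = 1" "norm (grad F (x0 1)) = 1"
    and nz: "dplus h y 0 \<noteq> 0" "dminus h y J \<noteq> 0"
  shows "linear_system F x0 J dt X \<longleftrightarrow>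
    (\<forall>j\<in>{1..<J}. (1/2 * ((norm (dminus h y j))\<^sup>2 + (norm (dminus h y (j + 1)))\<^sup>2) / dt) *\<^sub>R (X (node J j) - y j)
        - d2 h (\<lambda>j. X (node J j)) j = 0) \<and>
    bnormal ((*v) (Amat F (x0 0))) (grad F (x0 0)) (dplus h y 0) dt h (X (node J 0) - y 0) = 0 \<and>
    bnormal ((*v) (Amat F (x0 1))) (grad F (x0 1)) (- dminus h y J) dt h (X (node J J) - y J) = 0 \<and>
    btangent ((*v) (Amat F (x0 0))) (grad F (x0 0)) (dplus h y 0) dt h (X (node J 0) - y 0)
      (dplus h (\<lambda>j. X (node J j)) 0) = 0 \<and>
    btangent ((*v) (Amat F (x0 1))) (grad F (x0 1)) (- dminus h y J) dt h (X (node J J) - y J)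
      (- dminus h (\<lambda>j. X (node J j)) J) = 0"
proof -
  have hp: "h > 0" using J h by simp
  have y0: "y 0 = x0 0" "y J = x0 1" using J by (simp_all add: y_def)
  have q1: "norm (dminus h y 1) = norm (dplus h y 0)" by (simp add: dminus_def dplus_def)
  have sets: "{1..J - 1} = {1..<J}" using J by auto
  have int: "(1/2 * (a + b)) *\<^sub>R (v /\<^sub>R dt) = (1/2 * (a + b) / dt) *\<^sub>R v" for a b and v :: "real^'n"
    by (simp only: scaleR_scaleR divide_inverse)
  have N1: "((X (node J J) - y J) /\<^sub>R dt) \<bullet> (grad F (y J) - (2 * dt / (h * (norm (dminus h y J))\<^sup>2)) *\<^sub>R
      (Amat F (y J) *v dminus h y J)) = 0 \<longleftrightarrow>
    bnormal ((*v) (Amat F (x0 1))) (grad F (x0 1)) (- dminus h y J) dt h (X (node J J) - y J) = 0"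
    using end_normal_eq[OF dt, of "X (node J J) - y J" "grad F (x0 1)" h "- dminus h y J" "(*v) (Amat F (x0 1))"]
    by (simp add: y0 linear_neg[OF matrix_vector_mul_linear])
  have T1: "(norm (dminus h y J))\<^sup>2 *\<^sub>R ((mat 1 - (2 * dt / (h * (norm (dminus h y J))\<^sup>2) *
      (dminus h y J \<bullet> grad F (y J))) *\<^sub>R Amat F (y J)) *v (Pmat F (y J) *v ((X (node J J) - y J) /\<^sub>R dt)))
        + (2 / h) *\<^sub>R (Pmat F (y J) *v dminus h (\<lambda>j. X (node J j)) J) = 0 \<longleftrightarrow>
    btangent ((*v) (Amat F (x0 1))) (grad F (x0 1)) (- dminus h y J) dt h (X (node J J) - y J)
      (- dminus h (\<lambda>j. X (node J j)) J) = 0"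
    using end_tangent_eq[OF dt hp n(2), of "- dminus h y J" "X (node J J) - y J" "- dminus h (\<lambda>j. X (node J j)) J"] nz(2)
    by (simp add: y0 linear_neg[OF matrix_vector_mul_linear])
  have N0: "((X (node J 0) - y 0) /\<^sub>R dt) \<bullet> (grad F (y 0) + (2 * dt / (h * (norm (dplus h y 0))\<^sup>2)) *\<^sub>R
      (Amat F (y 0) *v dplus h y 0)) = 0 \<longleftrightarrow>
    bnormal ((*v) (Amat F (x0 0))) (grad F (x0 0)) (dplus h y 0) dt h (X (node J 0) - y 0) = 0"
    using end_normal_eq[OF dt, of "X (node J 0) - y 0" "grad F (x0 0)" h "dplus h y 0" "(*v) (Amat F (x0 0))"]
    unfolding y0 .
  have T0: "(norm (dplus h y 0))\<^sup>2 *\<^sub>R ((mat 1 + (2 * dt / (h * (norm (dplus h y 0))\<^sup>2) *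
      (dplus h y 0 \<bullet> grad F (y 0))) *\<^sub>R Amat F (y 0)) *v (Pmat F (y 0) *v ((X (node J 0) - y 0) /\<^sub>R dt)))
        - (2 / h) *\<^sub>R (Pmat F (y 0) *v dplus h (\<lambda>j. X (node J j)) 0) = 0 \<longleftrightarrow>
    btangent ((*v) (Amat F (x0 0))) (grad F (x0 0)) (dplus h y 0) dt h (X (node J 0) - y 0)
      (dplus h (\<lambda>j. X (node J j)) 0) = 0"
    using end_tangent_eq[OF dt hp n(1) nz(1), of "X (node J 0) - y 0" "dplus h (\<lambda>j. X (node J j)) 0"]
    unfolding y0 .
  show ?thesis
    unfolding linear_system_def Let_def h[symmetric] sets int q1[unfolded y_def] y_def
      N0[unfolded y_def] N1[unfolded y_def] T0[unfolded y_def] T1[unfolded y_def] ..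
qed

lemma sum_neighbours:
  fixes a :: "nat \<Rightarrow> real"
  assumes "J \<ge> 1"
  shows "(\<Sum>j\<in>{1..J}. a (j - 1) + a j) = a 0 + a J + 2 * (\<Sum>j\<in>{1..<J}. a j)"
  using assms
proof (induction J rule: nat_induct_at_least)
  case base
  then show ?case by simp
next
  case (Suc J)
  have "{1..Suc J} = insert (Suc J) {1..J}" "{1..<Suc J} = insert J {1..<J}" using Suc by auto
  then show ?case using Suc.IH by simp
qed

lemma norm_diff_sq_le: "(norm (a - b))\<^sup>2 \<le> 2 * (norm a)\<^sup>2 + 2 * (norm b)\<^sup>2"
  for a b :: "'a::real_normed_vector"
proof -
  have "(norm (a - b))\<^sup>2 \<le> (norm a + norm b)\<^sup>2" by (intro power_mono norm_triangle_ineq4) simp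
  also have "\<dots> \<le> 2 * (norm a)\<^sup>2 + 2 * (norm b)\<^sup>2"
    using zero_le_power2[of "norm a - norm b"] by (simp add: power2_sum power2_diff)
  finally show ?thesis .
qed

text \<open>In the application \<open>G\<close> is the exact solution minus the comparison function,
  bounded node by node, and \<open>E\<close> is the discrete solution minus the comparison function,
  bounded only in the sums that stability controls. The constant 6 is 4 from the values plus 2 from
  the quotients of \<open>G\<close>.\<close>

lemma H1_norm_nodal_le:
  fixes f :: "real \<Rightarrow> 'a::euclidean_space"
  assumes J: "J \<ge> 1" and h: "h = 1 / real J"
    and f: "\<And>j. j \<le> J \<Longrightarrow> f (node J j) = G j - E j"
    and G: "\<And>j. j \<le> J \<Longrightarrow> norm (G j) \<le> B" "\<And>j. j \<in> {1..J} \<Longrightarrow> norm (dminus h G j) \<le> B"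
  shows "(H1_norm (interp J f))\<^sup>2 \<le> 6 * B\<^sup>2 + 2 * ((norm (E 0))\<^sup>2 + (norm (E J))\<^sup>2 + 2 * (\<Sum>j\<in>{1..<J}. h * (norm (E j))\<^sup>2))
      + 2 * (\<Sum>j\<in>{1..J}. h * (norm (dminus h E j))\<^sup>2)"
proof -
  have hp: "0 < h" "h \<le> 1" "real J * h = 1" using J h by auto
  have v: "(norm (f (node J j)))\<^sup>2 \<le> 2 * B\<^sup>2 + 2 * (norm (E j))\<^sup>2" if "j \<le> J" for j
    using norm_diff_sq_le[of "G j" "E j"] power_mono[OF G(1)[OF that], of 2] f[OF that] by simp
  have d: "(norm (dminus h (\<lambda>j. f (node J j)) j))\<^sup>2 \<le> 2 * B\<^sup>2 + 2 * (norm (dminus h E j))\<^sup>2" if "j \<in> {1..J}" for j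
  proof -
    have "dminus h (\<lambda>j. f (node J j)) j = dminus h G j - dminus h E j"
    proof -
      have "f (node J j) = G j - E j" "f (node J (j - 1)) = G (j - 1) - E (j - 1)"
        using that by (intro f; auto)+
      then show ?thesis unfolding dminus_def by (simp add: scaleR_diff_right)
    qed
    then show ?thesis
      using norm_diff_sq_le[of "dminus h G j" "dminus h E j"] power_mono[OF G(2)[OF that], of 2] by simp
  qed
  have "(\<Sum>j\<in>{1..J}. ((norm (f (node J (j - 1))))\<^sup>2 + (norm (f (node J j)))\<^sup>2) / real J)
      \<le> (\<Sum>j\<in>{1..J}. 4 * B\<^sup>2 * h + 2 * (h * (norm (E (j - 1)))\<^sup>2 + h * (norm (E j))\<^sup>2))"
  proof (rule sum_mono)
    fix j assume j: "j \<in> {1..J}"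
    have "((norm (f (node J (j - 1))))\<^sup>2 + (norm (f (node J j)))\<^sup>2) * h
       \<le> ((2 * B\<^sup>2 + 2 * (norm (E (j - 1)))\<^sup>2) + (2 * B\<^sup>2 + 2 * (norm (E j))\<^sup>2)) * h"
      using v[of "j - 1"] v[of j] j hp by (intro mult_right_mono add_mono) auto
    then show "((norm (f (node J (j - 1))))\<^sup>2 + (norm (f (node J j)))\<^sup>2) / real J
        \<le> 4 * B\<^sup>2 * h + 2 * (h * (norm (E (j - 1)))\<^sup>2 + h * (norm (E j))\<^sup>2)"
      by (simp add: h algebra_simps add_divide_distrib)
  qed
  also have "\<dots> = 4 * B\<^sup>2 + 2 * (h * (norm (E 0))\<^sup>2 + h * (norm (E J))\<^sup>2 + 2 * (\<Sum>j\<in>{1..<J}. h * (norm (E j))\<^sup>2))"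
  proof -
    have "(\<Sum>j\<in>{1..J}. 4 * B\<^sup>2 * h + 2 * (h * (norm (E (j - 1)))\<^sup>2 + h * (norm (E j))\<^sup>2)) =
      (\<Sum>j\<in>{1..J}. 4 * B\<^sup>2 * h) + 2 * (\<Sum>j\<in>{1..J}. h * (norm (E (j - 1)))\<^sup>2 + h * (norm (E j))\<^sup>2)"
      by (subst sum.distrib) (simp only: sum_distrib_left)
    moreover have "(\<Sum>j\<in>{1..J}. 4 * B\<^sup>2 * h) = 4 * B\<^sup>2 * (real J * h)" by simp
    ultimately show ?thesis
      unfolding sum_neighbours[OF J, of "\<lambda>j. h * (norm (E j))\<^sup>2"] hp(3) by simp
  qed
  also have "h * (norm (E 0))\<^sup>2 \<le> (norm (E 0))\<^sup>2" using hp mult_right_mono[of h 1 "(norm (E 0))\<^sup>2"] by simp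
  also have "h * (norm (E J))\<^sup>2 \<le> (norm (E J))\<^sup>2" using hp mult_right_mono[of h 1 "(norm (E J))\<^sup>2"] by simp
  finally have a: "(\<Sum>j\<in>{1..J}. ((norm (f (node J (j - 1))))\<^sup>2 + (norm (f (node J j)))\<^sup>2) / real J)
      \<le> 4 * B\<^sup>2 + 2 * ((norm (E 0))\<^sup>2 + (norm (E J))\<^sup>2 + 2 * (\<Sum>j\<in>{1..<J}. h * (norm (E j))\<^sup>2))" by simp
  have "(\<Sum>j\<in>{1..J}. (norm (dminus (1 / real J) (\<lambda>j. f (node J j)) j))\<^sup>2 / real J)
      \<le> (\<Sum>j\<in>{1..J}. 2 * B\<^sup>2 * h + 2 * (h * (norm (dminus h E j))\<^sup>2))"
  proof (rule sum_mono)
    fix j assume j: "j \<in> {1..J}"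
    have "(norm (dminus h (\<lambda>j. f (node J j)) j))\<^sup>2 * h \<le> (2 * B\<^sup>2 + 2 * (norm (dminus h E j))\<^sup>2) * h"
      using d[OF j] hp by (intro mult_right_mono) auto
    then show "(norm (dminus (1 / real J) (\<lambda>j. f (node J j)) j))\<^sup>2 / real J \<le> 2 * B\<^sup>2 * h + 2 * (h * (norm (dminus h E j))\<^sup>2)"
      unfolding h[symmetric] by (simp add: h algebra_simps)
  qed
  also have "\<dots> = 2 * B\<^sup>2 + 2 * (\<Sum>j\<in>{1..J}. h * (norm (dminus h E j))\<^sup>2)"
    using hp(3) by (simp add: sum.distrib flip: sum_distrib_left)
  finally show ?thesis using a H1_norm_interp_le[of J f] J by simp
qed

lemma Amat_inner_normal: "norm (grad F y) = 1 \<Longrightarrow> (Amat F y *v v) \<bullet> grad F y = 0"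
  by (simp add: Amat_mult inner_proj_normal)

lemma Amat_normal: "norm (grad F y) = 1 \<Longrightarrow> Amat F y *v grad F y = 0"
  by (simp add: Amat_mult proj_def norm_eq_1)

lemma d2_diff: "d2 h (\<lambda>j. u j - v j) j = d2 h u j - d2 h v j"
  by (simp add: d2_def dplus_def dminus_def algebra_simps)

lemma dplus_diff: "dplus h (\<lambda>j. u j - v j) j = dplus h u j - dplus h v j"
  by (simp add: dplus_def algebra_simps)

lemma dminus_diff: "dminus h (\<lambda>j. u j - v j) j = dminus h u j - dminus h v j"
  by (simp add: dminus_def algebra_simps)

lemma d2_eq: "d2 h v j = (v (j + 1) - 2 *\<^sub>R v j + v (j - 1)) /\<^sub>R h\<^sup>2"
  by (simp add: d2_def dplus_def dminus_def power2_eq_square scaleR_2 algebra_simps)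

lemma inj_node: "J > 0 \<Longrightarrow> inj_on (node J) {..J}"
  by (auto simp: inj_on_def node_def)

theorem lemmaA1:
  fixes \<Omega> U :: "(real^'n::finite) set"
    and F :: "real^'n \<Rightarrow> real"
    and T c0 C0 :: real
    and x0 :: "real \<Rightarrow> real^'n"
    and x :: "real \<Rightarrow> real \<Rightarrow> real^'n"
  assumes "CARD('n) \<ge> 2"
    and "open \<Omega>" and "connected \<Omega>" and "\<Omega> \<noteq> {}"
    and "open U" and "frontier \<Omega> \<subseteq> U"
    and "Ck_on 3 F U"
    and "frontier \<Omega> = {z \<in> U. F z = 0}"
    and "\<forall>z\<in>frontier \<Omega>. norm (grad F z) = 1"
    and "T > 0"
    and "F (x0 0) = 0" and "F (x0 1) = 0"
    and "smooth_evolution T x"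
    and "solves_csf \<Omega> T x0 x"
    and "c0 > 0" and "C0 > 0"
    and "\<forall>\<rho>\<in>{0<..<1}. \<forall>t\<in>{0..T}. c0 \<le> norm (d_rho x \<rho> t) \<and> norm (d_rho x \<rho> t) \<le> C0"
  shows "\<exists>\<gamma> h0 c :: real. 0 < \<gamma> \<and> \<gamma> \<le> 1 \<and> 0 < h0 \<and> 0 < c \<and>
    (\<forall>J M :: nat. \<forall>h dt :: real.
       2 \<le> J \<and> 1 \<le> M \<and> h = 1 / real J \<and> dt = T / real M \<and>
       0 < dt \<and> dt \<le> \<gamma> * h \<and> 0 < h \<and> h \<le> h0 \<longrightarrow>
       (\<exists>X \<in> fe_space_vec J. linear_system F x0 J dt X \<and>
          (\<forall>Y \<in> fe_space_vec J. linear_system F x0 J dt Y \<longrightarrow> (\<forall>\<rho>\<in>{0..1}. Y \<rho> = X \<rho>)) \<and>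
          (H1_norm (\<lambda>\<rho>. interp J (\<lambda>r. x r dt) \<rho> - X \<rho>))\<^sup>2 \<le> c * (h ^ 4 + dt ^ 4)))"
proof -
  obtain C f0 f1 w where f0: "jet 4 C f0" and f1: "jet 4 C f1" and w: "jet 2 C w"
    and fx0: "\<And>s. s \<in> {0..1} \<Longrightarrow> f0 0 s = x0 s" and speed: "\<And>s. s \<in> {0..1} \<Longrightarrow> c0 \<le> norm (f0 1 s)"
    and pde: "\<And>s. s \<in> {0..1} \<Longrightarrow> (norm (f0 1 s))\<^sup>2 *\<^sub>R f1 0 s = f0 2 s"
      "\<And>s. s \<in> {0..1} \<Longrightarrow> (norm (f0 1 s))\<^sup>2 *\<^sub>R w 0 s = f1 2 s"
    and ends: "\<And>s. s \<in> {0, 1} \<Longrightarrow> end_identities F (x0 s) (f0 1 s) (f1 0 s) (w 0 s) (f1 1 s)"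
    and close: "\<And>dt s. dt \<in> {0..T} \<Longrightarrow> s \<in> {0..1} \<Longrightarrow>
      norm (x s dt - (f0 0 s + dt *\<^sub>R f1 0 s + dt\<^sup>2 *\<^sub>R w 0 s)) \<le> C * dt\<^sup>2"
    and close': "\<And>dt s s'. dt \<in> {0..T} \<Longrightarrow> s \<in> {0..1} \<Longrightarrow> s' \<in> {0..1} \<Longrightarrow>
      norm ((x s dt - (f0 0 s + dt *\<^sub>R f1 0 s + dt\<^sup>2 *\<^sub>R w 0 s)) -
        (x s' dt - (f0 0 s' + dt *\<^sub>R f1 0 s' + dt\<^sup>2 *\<^sub>R w 0 s'))) \<le> C * dt\<^sup>2 * \<bar>s - s'\<bar>"
  proof -
    show thesis by (rule csf_initial_data[OF assms(5-10,13-15,17)]) (fact that)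
  qed
  define \<nu> where "\<nu> e = grad F (x0 e)" for e
  define A where "A e = (*v) (Amat F (x0 e))" for e
  have n: "norm (\<nu> e) = 1" if "e \<in> {0, 1}" for e using ends[OF that] by (simp add: end_identities_def \<nu>_def)
  have linA: "linear (A e)" for e by (simp add: A_def)
  obtain B0 B1 where B: "\<And>v. norm (A 0 v) \<le> B0 * norm v" "\<And>v. norm (A 1 v) \<le> B1 * norm v"
    using linear_bounded[OF linA[of 0]] linear_bounded[OF linA[of 1]] by blast
  define KA where "KA = max B0 B1"
  have KA: "norm (A e v) \<le> KA * norm v" if "e \<in> {0, 1}" for e v
    using that B[of v] mult_right_mono[of B0 KA "norm v"] mult_right_mono[of B1 KA "norm v"] by (force simp: KA_def)
  have KA0: "0 \<le> KA" using order_trans[OF norm_ge_zero KA[of 0 "\<nu> 0"]] n[of 0] by simp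
  have C: "0 \<le> C" using order_trans[OF norm_ge_zero jet_bound[OF w, of 0 0]] by simp
  have c0: "0 < c0" by fact
  define K1 where "K1 = 8 * KA * (C + C ^ 3) / c0\<^sup>2"
  define K where "K = K1 + KA * C"
  define N2 where "N2 = 2 * C * K1 + KA * C\<^sup>2"
  define T2 where "T2 = 2 * C ^ 3 + 2 * KA * C\<^sup>2 + 3 * C"
  define r2 where "r2 = 10 * C ^ 3 + 6 * C"
  \<comment> \<open>Difference quotients of the initial curve keep at least half of the minimal
    speed once C h \<le> c0 / 2.\<close>
  define m where "m = c0\<^sup>2 / 4"
  define L where "L = K + 3/2 + 8 * K\<^sup>2"
  \<comment> \<open>\<open>L\<close> is the coercivity threshold of
    \<open>boundary_coercive\<close>, and this \<gamma> makes m / (2 \<gamma>) reach it.\<close>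
  define \<gamma> where "\<gamma> = min 1 (m / (2 * L))"
  \<comment> \<open>The entries ensure C h \<le> c0 / 2 and K dt \<le> 1/2; the added ones keep the
    denominators positive.\<close>
  define h0 where "h0 = min (c0 / (2 * (C + 1))) (1 / (2 * (K + 1)))"
  define Mc where "Mc = r2\<^sup>2 / (2 * m) + T2\<^sup>2 + 18 * N2\<^sup>2"
  \<comment> \<open>The first term comes from \<open>G\<close>, the second from stability, and the
    last merely makes \<open>c\<close> visibly positive.\<close>
  define c where "c = 6 * C\<^sup>2 + (36 + 8 / m) * Mc + 1"
  have K10: "0 \<le> K1" unfolding K1_def using KA0 C by simp
  have K0: "0 \<le> K" unfolding K_def using K10 KA0 C by simp
  have m: "0 < m" using c0 by (simp add: m_def)
  have L: "0 < L" unfolding L_def using K0 zero_le_power2[of K] by linarith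
  have \<gamma>: "0 < \<gamma>" "\<gamma> \<le> 1" using m L by (auto simp: \<gamma>_def)
  have h0: "0 < h0" using c0 C K0 by (simp add: h0_def)
  have Mc: "0 \<le> Mc" using m by (simp add: Mc_def)
  have c: "0 < c" unfolding c_def using m Mc by (intro add_nonneg_pos add_nonneg_nonneg mult_nonneg_nonneg) auto
  have KL: "K + 3/2 + 8 * K\<^sup>2 \<le> m / (2 * \<gamma>)"
  proof -
    have "\<gamma> \<le> m / (2 * L)" by (simp add: \<gamma>_def)
    then have "L * (2 * \<gamma>) \<le> m" using L by (simp add: field_simps)
    then show ?thesis using \<gamma> by (simp add: L_def[symmetric] pos_le_divide_eq)
  qed
  show ?thesis
  proof (rule exI[of _ \<gamma>], rule exI[of _ h0], rule exI[of _ c], intro conjI allI impI \<gamma> h0 c)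
    fix J M :: nat and h dt :: real
    assume asm: "2 \<le> J \<and> 1 \<le> M \<and> h = 1 / real J \<and> dt = T / real M \<and>
       0 < dt \<and> dt \<le> \<gamma> * h \<and> 0 < h \<and> h \<le> h0"
    then have J: "2 \<le> J" "1 \<le> J" "0 < J" and h: "h = 1 / real J" "0 < h" "h \<le> h0" and dt: "0 < dt" "dt \<le> \<gamma> * h" by auto
    have dtT: "dt \<in> {0..T}" using asm assms(10) by (auto simp: field_simps)
    have h1: "h \<le> 1" using J h by simp
    have dth: "dt \<le> h" using dt(2) \<gamma> h mult_right_mono[of \<gamma> 1 h] by linarith
    have Ch: "C * h \<le> c0 / 2"
    proof -
      have "h \<le> c0 / (2 * (C + 1))" using h(3) by (simp add: h0_def)
      then have "h * (2 * (C + 1)) \<le> c0" using C by (simp add: pos_le_divide_eq)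
      then show ?thesis using h(2) by (simp add: algebra_simps)
    qed
    have Kdt: "K * dt \<le> 1 / 2"
    proof -
      have "h \<le> 1 / (2 * (K + 1))" using h(3) by (simp add: h0_def)
      then have "h * (2 * (K + 1)) \<le> 1" using K0 by (simp add: pos_le_divide_eq)
      then have "K * h \<le> 1 / 2" using h(2) by (simp add: algebra_simps)
      then show ?thesis using mult_left_mono[OF dth K0] by linarith
    qed
    define Z where "Z s = f0 0 s + dt *\<^sub>R f1 0 s + dt\<^sup>2 *\<^sub>R w 0 s" for s
    define y where "y = (\<lambda>j. x0 (node J j))"
    define z where "z j = Z (node J j)" for j
    have nodes: "node J j \<in> {0..1}" if "j \<le> J" for j using node_in[OF that J(3)] .
    have yf: "y j = f0 0 (node J j)" if "j \<le> J" for j using fx0[OF nodes[OF that]] by (simp add: y_def)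
    have nd: "node J 1 = h" "node J (J - 1) = 1 - h"
      using J h by (simp_all add: node_def of_nat_diff field_simps)
    have zero_jet: "f0 0 e = x0 e" if "e \<in> {0, 1}" for e using fx0 that by auto
    have bdry: "end_ok m K h (A e) (\<nu> e) d0 \<and>
        \<bar>bnormal (A e) (\<nu> e) d0 dt h (Z e - x0 e)\<bar> \<le> dt\<^sup>2 * h * N2 \<and>
        norm (btangent (A e) (\<nu> e) d0 dt h (Z e - x0 e) ((Z b - Z e) /\<^sub>R h)) \<le> T2 * h\<^sup>2"
      if e: "e \<in> {0, 1}" and b: "b \<in> {0..1}" "b = e + \<sigma> * h" "\<bar>\<sigma>\<bar> = 1" and d0: "d0 = (f0 0 b - f0 0 e) /\<^sub>R h"
      for e b \<sigma> d0
    proof -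
      have e': "e \<in> {0..1}" using e by auto
      have id: "norm (\<nu> e) = 1" "f0 1 e = (f0 1 e \<bullet> \<nu> e) *\<^sub>R \<nu> e" "f1 0 e \<bullet> \<nu> e = 0"
        "w 0 e \<bullet> \<nu> e = - (f1 0 e \<bullet> A e (f1 0 e))" "proj (\<nu> e) (f1 1 e) = (f0 1 e \<bullet> \<nu> e) *\<^sub>R A e (f1 0 e)"
        using ends[OF e] unfolding end_identities_def \<nu>_def A_def by blast+
      have An: "A e v \<bullet> \<nu> e = 0" "A e (\<nu> e) = 0" for v
        using id(1) by (simp_all add: A_def \<nu>_def Amat_inner_normal Amat_normal)
      note bc = boundary_consistency[OF f0 f1 w e' b h(2) h1 dt(1) dth c0 speed[OF e'] Ch linA An KA[OF e] id pde(1)[OF e'] Z_def d0 K1_def]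
      have "K * norm v \<ge> KA * C * norm v" for v :: "real^'n"
        using K10 by (intro mult_right_mono) (auto simp: K_def)
      then have "norm ((d0 \<bullet> \<nu> e) *\<^sub>R A e v) \<le> K * norm v" for v using bc(3)[of v] order_trans by blast
      then have "end_ok m K h (A e) (\<nu> e) d0"
        unfolding end_ok_def using linA id(1) An bc(1,2) by (simp add: m_def K_def)
      then show ?thesis using bc(4,5) zero_jet[OF e] by (simp add: N2_def T2_def)
    qed
    define d0 d1 where "d0 = dplus h y 0" and "d1 = - dminus h y J"
    have d01: "d0 = (f0 0 h - f0 0 0) /\<^sub>R h" "d1 = (f0 0 (1 - h) - f0 0 1) /\<^sub>R h"
      using yf[of 0] yf[of 1] yf[of J] yf[of "J - 1"] J nd by (simp_all add: d0_def d1_def dplus_def dminus_def flip: scaleR_minus_right)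
    have b0: "end_ok m K h (A 0) (\<nu> 0) d0" "\<bar>bnormal (A 0) (\<nu> 0) d0 dt h (Z 0 - x0 0)\<bar> \<le> dt\<^sup>2 * h * N2"
        "norm (btangent (A 0) (\<nu> 0) d0 dt h (Z 0 - x0 0) ((Z h - Z 0) /\<^sub>R h)) \<le> T2 * h\<^sup>2"
      using bdry[of 0 h 1 d0] d01 h h1 by auto
    have b1: "end_ok m K h (A 1) (\<nu> 1) d1" "\<bar>bnormal (A 1) (\<nu> 1) d1 dt h (Z 1 - x0 1)\<bar> \<le> dt\<^sup>2 * h * N2"
        "norm (btangent (A 1) (\<nu> 1) d1 dt h (Z 1 - x0 1) ((Z (1 - h) - Z 1) /\<^sub>R h)) \<le> T2 * h\<^sup>2"
      using bdry[of 1 "1 - h" "-1" d1] d01 h h1 by auto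
    define p where "p j = 1/2 * ((norm (dminus h y j))\<^sup>2 + (norm (dminus h y (j + 1)))\<^sup>2)" for j
    have q: "m \<le> (norm (dminus h y j))\<^sup>2" if j: "j \<in> {1..J}" for j
    proof -
      let ?a = "node J (j - 1)" and ?b = "node J j"
      have "j - 1 \<le> J" "j \<le> J" using j by auto
      then have ab: "?a \<in> {0..1}" "?b \<in> {0..1}" using nodes by blast+
      have "?b = ?a + 1 * h" using node_step[of j J] j J h by simp
      from jet_quotient1[OF f0 _ ab h(2) this]
      have "norm ((f0 0 ?b - f0 0 ?a) /\<^sub>R h - f0 1 ?a) \<le> C * h" by simp
      moreover have "dminus h y j = (f0 0 ?b - f0 0 ?a) /\<^sub>R h"
        unfolding dminus_def using yf[of j] yf[of "j - 1"] j by auto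
      ultimately have "norm (dminus h y j - f0 1 ?a) \<le> C * h" by simp
      then have "c0 / 2 \<le> norm (dminus h y j)"
        using Ch speed[OF ab(1)] norm_triangle_ineq3[of "dminus h y j" "f0 1 ?a"] by linarith
      then have "(c0 / 2)\<^sup>2 \<le> (norm (dminus h y j))\<^sup>2" using c0 by (intro power_mono) auto
      then show ?thesis by (simp add: m_def power_divide)
    qed
    have p: "m \<le> p j" if "j \<in> {1..<J}" for j using q[of j] q[of "j + 1"] that by (simp add: p_def)
    have nz: "dplus h y 0 \<noteq> 0" "dminus h y J \<noteq> 0"
      using q[of 1] q[of J] m J by (auto simp: dplus_def dminus_def)
    obtain Yn where Yn: "\<And>j. j \<in> {1..<J} \<Longrightarrow> (p j / dt) *\<^sub>R (Yn j - y j) - d2 h Yn j = 0"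
      "bnormal (A 0) (\<nu> 0) d0 dt h (Yn 0 - y 0) = 0" "bnormal (A 1) (\<nu> 1) d1 dt h (Yn J - y J) = 0"
      "btangent (A 0) (\<nu> 0) d0 dt h (Yn 0 - y 0) (dplus h Yn 0) = 0"
      "btangent (A 1) (\<nu> 1) d1 dt h (Yn J - y J) (- dminus h Yn J) = 0"
    proof -
      show thesis by (rule scheme_solvable[where p = p and y = y, OF J(1) h(1) dt \<gamma> Kdt KL m b0(1) b1(1)])
        (fact p, fact that)
    qed
    \<comment> \<open>Any function with the nodal values \<open>Yn\<close> serves for interpolation;
      distinct nodes make the inverse well defined.\<close>
    define f where "f r = Yn (inv_into {..J} (node J) r)" for r
    have fn: "f (node J j) = Yn j" if "j \<le> J" for j
      using inv_into_f_f[OF inj_node[OF J(3)], of j] that by (simp add: f_def)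
    define X where "X = interp J f"
    have Xn: "X (node J j) = Yn j" if "j \<le> J" for j
      using interp_node[OF that J(3), of f] fn[OF that] by (simp add: X_def)
    have X: "X \<in> fe_space_vec J" unfolding X_def by (rule interp_in_fe_space_vec)
    have n01: "norm (grad F (x0 0)) = 1" "norm (grad F (x0 1)) = 1" using n[of 0] n[of 1] by (simp_all add: \<nu>_def)
    note ls = linear_system_iff[OF y_def J(2) h(1) dt(1) n01 nz, folded \<nu>_def A_def d0_def d1_def p_def]
    have lsX: "linear_system F x0 J dt X"
    proof -
      have d2X: "d2 h (\<lambda>j. X (node J j)) j = d2 h Yn j" if j: "j \<in> {1..<J}" for j
      proof -
        have "X (node J j) = Yn j" "X (node J (j + 1)) = Yn (j + 1)" "X (node J (j - 1)) = Yn (j - 1)"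
          using j by (intro Xn; auto)+
        then show ?thesis by (simp add: d2_eq)
      qed
      have "dplus h (\<lambda>j. X (node J j)) 0 = dplus h Yn 0" "dminus h (\<lambda>j. X (node J j)) J = dminus h Yn J"
        unfolding dplus_def dminus_def using Xn[of 0] Xn[of 1] Xn[of J] Xn[of "J - 1"] J by simp_all
      then show ?thesis unfolding ls using Yn Xn[of 0] Xn[of J] d2X Xn by simp
    qed
    have unique: "Y \<rho> = X \<rho>" if Y: "Y \<in> fe_space_vec J" "linear_system F x0 J dt Y" and \<rho>: "\<rho> \<in> {0..1}" for Y \<rho>
    proof -
      define E where "E = (\<lambda>j. Y (node J j) - X (node J j))"
      note lY = Y(2)[unfolded ls] and lX = lsX[unfolded ls]
      have e: "E j = (Y (node J j) - y j) - (X (node J j) - y j)" for j by (simp add: E_def)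
      have "E j = 0" if "j \<le> J" for j
      proof (rule scheme_unique[where p = p, OF J(1) h(1) dt \<gamma> Kdt KL m b0(1) b1(1) _ _ _ _ _ _ that])
        show "m \<le> p j" if "j \<in> {1..<J}" for j by (rule p[OF that])
        show "(p j / dt) *\<^sub>R E j - d2 h E j = 0" if "j \<in> {1..<J}" for j
        proof -
          have "(p j / dt) *\<^sub>R (Y (node J j) - y j) - d2 h (\<lambda>j. Y (node J j)) j = 0"
            "(p j / dt) *\<^sub>R (X (node J j) - y j) - d2 h (\<lambda>j. X (node J j)) j = 0"
            using lY lX that by blast+
          then show ?thesis unfolding e scaleR_diff_right[of "p j / dt"] by (simp add: E_def d2_diff)
        qed
        show "bnormal (A 0) (\<nu> 0) d0 dt h (E 0) = 0" "bnormal (A 1) (\<nu> 1) d1 dt h (E J) = 0"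
          unfolding e by (subst bnormal_diff, use lY lX in simp)+
        have "dplus h E 0 = dplus h (\<lambda>j. Y (node J j)) 0 - dplus h (\<lambda>j. X (node J j)) 0"
          by (simp add: E_def dplus_diff)
        then show "btangent (A 0) (\<nu> 0) d0 dt h (E 0) (dplus h E 0) = 0"
          unfolding e by (simp only: btangent_diff[OF linA]) (use lY lX in simp)
        have "- dminus h E J = - dminus h (\<lambda>j. Y (node J j)) J - (- dminus h (\<lambda>j. X (node J j)) J)"
          by (simp add: E_def dminus_diff)
        then show "btangent (A 1) (\<nu> 1) d1 dt h (E J) (- dminus h E J) = 0"
          unfolding e by (simp only: btangent_diff[OF linA]) (use lY lX in simp)
      qed
      then have "interp J Y = interp J X" by (intro interp_cong J(3)) (simp add: E_def)
      then show ?thesis using fe_space_vec_eq_interp[OF Y(1) J(3) \<rho>] fe_space_vec_eq_interp[OF X J(3) \<rho>] by simp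
    qed
    define E where "E = (\<lambda>j. Yn j - z j)"
    define S where "S = m / 2 * (\<Sum>j\<in>{1..<J}. h * (norm (E j))\<^sup>2) + 1/2 * (\<Sum>j\<in>{1..J}. h * (norm (dminus h E j))\<^sup>2)
      + (norm (E 0))\<^sup>2 / 8 + (norm (E J))\<^sup>2 / 8"
    have z01: "z 0 = Z 0" "z 1 = Z h" "z J = Z 1" "z (J - 1) = Z (1 - h)" using J nd by (simp_all add: z_def)
    have y01: "y 0 = x0 0" "y J = x0 1" using J by (simp_all add: y_def)
    have S: "S \<le> (r2 * h\<^sup>2)\<^sup>2 / (2 * m) + (T2 * h\<^sup>2)\<^sup>2 + 18 * (dt\<^sup>2 * h * N2)\<^sup>2 / h"
      unfolding S_def
    proof (rule scheme_stability[where p = p, OF J(2) h(1) dt \<gamma> Kdt KL m b0(1) b1(1)])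
      show "m \<le> p j" if "j \<in> {1..<J}" for j by (rule p[OF that])
      show "norm ((p j / dt) *\<^sub>R E j - d2 h E j) \<le> r2 * h\<^sup>2" if j: "j \<in> {1..<J}" for j
      proof -
        let ?a = "node J j"
        have nn: "node J (j + 1) = ?a + h" "node J (j - 1) = ?a - h"
          using j h(1) by (simp_all add: node_def of_nat_diff field_simps)
        have jj: "j \<le> J" "j + 1 \<le> J" "j - 1 \<le> J" using j by auto
        have a: "?a \<in> {0..1}" "?a + h \<in> {0..1}" "?a - h \<in> {0..1}"
          using nodes[OF jj(1)] nodes[OF jj(2)] nodes[OF jj(3)] unfolding nn .
        have pj: "p j = 1/2 * ((norm ((f0 0 ?a - f0 0 (?a - h)) /\<^sub>R h))\<^sup>2 + (norm ((f0 0 (?a + h) - f0 0 ?a) /\<^sub>R h))\<^sup>2)"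
          unfolding p_def dminus_def using yf[OF jj(1)] yf[OF jj(2)] yf[OF jj(3)] by (simp add: nn[simplified])
        have "norm (p j *\<^sub>R (f1 0 ?a + dt *\<^sub>R w 0 ?a) - (Z (?a + h) - 2 *\<^sub>R Z ?a + Z (?a - h)) /\<^sub>R h\<^sup>2) \<le> r2 * h\<^sup>2"
          unfolding r2_def by (rule interior_consistency[OF f0 f1 w a h(2) h1 dt(1) dth pde[OF a(1)] pj Z_def])
        moreover have "(p j / dt) *\<^sub>R (z j - y j) = p j *\<^sub>R (f1 0 ?a + dt *\<^sub>R w 0 ?a)"
        proof -
          have "z j - y j = dt *\<^sub>R (f1 0 ?a + dt *\<^sub>R w 0 ?a)"
            unfolding z_def Z_def yf[OF jj(1)] by (simp add: scaleR_right_distrib power2_eq_square)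
          then show ?thesis using dt(1) by simp
        qed
        moreover have "d2 h z j = (Z (?a + h) - 2 *\<^sub>R Z ?a + Z (?a - h)) /\<^sub>R h\<^sup>2"
          unfolding d2_eq z_def nn ..
        moreover have "(p j / dt) *\<^sub>R E j - d2 h E j = - ((p j / dt) *\<^sub>R (z j - y j) - d2 h z j)"
        proof -
          have "(p j / dt) *\<^sub>R E j - d2 h E j =
              ((p j / dt) *\<^sub>R (Yn j - y j) - d2 h Yn j) - ((p j / dt) *\<^sub>R (z j - y j) - d2 h z j)"
            by (simp add: E_def d2_diff scaleR_diff_right)
          then show ?thesis using Yn(1)[OF j] by simp
        qed
        ultimately show ?thesis by (simp only: norm_minus_cancel)
      qed
      have e: "E j = (Yn j - y j) - (z j - y j)" for j by (simp add: E_def)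
      show "\<bar>bnormal (A 0) (\<nu> 0) d0 dt h (E 0)\<bar> \<le> dt\<^sup>2 * h * N2" "\<bar>bnormal (A 1) (\<nu> 1) d1 dt h (E J)\<bar> \<le> dt\<^sup>2 * h * N2"
        unfolding e by (subst bnormal_diff, use Yn(2,3) b0(2) b1(2) z01 y01 in simp)+
      have "dplus h E 0 = dplus h Yn 0 - (Z h - Z 0) /\<^sub>R h"
        unfolding E_def dplus_diff by (simp add: dplus_def z01[simplified])
      then show "norm (btangent (A 0) (\<nu> 0) d0 dt h (E 0) (dplus h E 0)) \<le> T2 * h\<^sup>2"
        unfolding e by (simp only: btangent_diff[OF linA] Yn(4)) (use b0(3) z01 y01 in simp)
      have "- dminus h E J = - dminus h Yn J - (Z (1 - h) - Z 1) /\<^sub>R h"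
        unfolding E_def dminus_diff by (simp add: dminus_def z01[simplified] scaleR_diff_right)
      then show "norm (btangent (A 1) (\<nu> 1) d1 dt h (E J) (- dminus h E J)) \<le> T2 * h\<^sup>2"
        unfolding e by (simp only: btangent_diff[OF linA] Yn(5)) (use b1(3) z01 y01 in simp)
    qed
    also have "18 * (dt\<^sup>2 * h * N2)\<^sup>2 / h = 18 * N2\<^sup>2 * (dt ^ 4 * h)"
      using h(2) by (simp add: power2_eq_square power4_eq_xxxx)
    \<comment> \<open>The normal residual of size dt^2 h, squared and divided by h, still leaves a
      spare factor h.\<close>
    also have "dt ^ 4 * h \<le> h ^ 4 * 1" using dt(1) dth h1 h(2) by (intro mult_mono power_mono) auto
    then have "18 * N2\<^sup>2 * (dt ^ 4 * h) \<le> 18 * N2\<^sup>2 * (h ^ 4 * 1)" by (intro mult_left_mono) auto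
    finally have S: "S \<le> Mc * h ^ 4"
      by (simp add: Mc_def power_mult_distrib algebra_simps flip: power_mult)
    have err: "(H1_norm (\<lambda>\<rho>. interp J (\<lambda>r. x r dt) \<rho> - X \<rho>))\<^sup>2 \<le> c * (h ^ 4 + dt ^ 4)"
    proof -
      define G where "G j = x (node J j) dt - z j" for j
      have dt2: "C * dt\<^sup>2 \<le> C * h\<^sup>2" using dt(1) dth C by (intro mult_left_mono power_mono) auto
      have G1: "norm (G j) \<le> C * h\<^sup>2" if "j \<le> J" for j
        unfolding G_def z_def Z_def using close[OF dtT nodes[OF that]] dt2 by linarith
      have G2: "norm (dminus h G j) \<le> C * h\<^sup>2" if j: "j \<in> {1..J}" for j
      proof -
        have jj: "j \<le> J" "j - 1 \<le> J" using j by auto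
        have "\<bar>node J j - node J (j - 1)\<bar> = h" using node_step[of j J] j J h by simp
        then have "norm (G j - G (j - 1)) \<le> C * dt\<^sup>2 * h"
          using close'[OF dtT nodes[OF jj(1)] nodes[OF jj(2)]] unfolding G_def z_def Z_def by simp
        then have "norm (G j - G (j - 1)) / h \<le> C * dt\<^sup>2" using h(2) by (simp add: pos_divide_le_eq)
        then show ?thesis unfolding dminus_def norm_divideR[OF h(2)] using dt2 by linarith
      qed
      have "(\<lambda>\<rho>. interp J (\<lambda>r. x r dt) \<rho> - X \<rho>) = interp J (\<lambda>r. x r dt - f r)"
        by (simp add: X_def interp_diff fun_eq_iff)
      moreover have "x (node J j) dt - f (node J j) = G j - E j" if "j \<le> J" for j
        using fn[OF that] by (simp add: G_def E_def)
      note H1_norm_nodal_le[where f = "\<lambda>r. x r dt - f r", OF J(2) h(1) this G1 G2]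
      ultimately have "(H1_norm (\<lambda>\<rho>. interp J (\<lambda>r. x r dt) \<rho> - X \<rho>))\<^sup>2 \<le> 6 * (C * h\<^sup>2)\<^sup>2 +
          2 * ((norm (E 0))\<^sup>2 + (norm (E J))\<^sup>2 + 2 * (\<Sum>j\<in>{1..<J}. h * (norm (E j))\<^sup>2))
          + 2 * (\<Sum>j\<in>{1..J}. h * (norm (dminus h E j))\<^sup>2)" by simp
      also have "\<dots> \<le> 6 * (C * h\<^sup>2)\<^sup>2 + (36 + 8 / m) * S"
      proof -
        define s0 where "s0 = (\<Sum>j\<in>{1..<J}. h * (norm (E j))\<^sup>2)"
        define s1 where "s1 = (\<Sum>j\<in>{1..J}. h * (norm (dminus h E j))\<^sup>2)"
        have s: "0 \<le> s0" "0 \<le> s1" unfolding s0_def s1_def using h(2) by (intro sum_nonneg; simp)+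
        define t where "t = m / 2 * s0"
        have S': "S = t + 1/2 * s1 + (norm (E 0))\<^sup>2 / 8 + (norm (E J))\<^sup>2 / 8" by (simp add: S_def s0_def s1_def t_def)
        have ms: "0 \<le> t" using m s by (simp add: t_def)
        note nonneg = ms s zero_le_power2[of "norm (E 0)"] zero_le_power2[of "norm (E J)"]
        \<comment> \<open>Each part of \<open>S\<close> is bounded by the whole. The resulting
          factor is 2 (8 + 8) + 2 * 2 = 36 for the end values and the gradient, and 8 / m for the
          interior values.\<close>
        have le: "t \<le> S" "s1 \<le> 2 * S" "(norm (E 0))\<^sup>2 \<le> 8 * S" "(norm (E J))\<^sup>2 \<le> 8 * S"
          by (insert nonneg S', linarith+)
        define k where "k = 2 / m * S"
        have "s0 \<le> k" using le(1) m by (simp add: t_def k_def field_simps)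
        then have "2 * ((norm (E 0))\<^sup>2 + (norm (E J))\<^sup>2 + 2 * s0) + 2 * s1 \<le> 2 * (8 * S + 8 * S + 2 * k) + 2 * (2 * S)"
          using le by (intro add_mono mult_left_mono) simp_all
        also have "\<dots> = (36 + 8 / m) * S" by (simp add: k_def algebra_simps)
        finally show ?thesis unfolding s0_def s1_def by simp
      qed
      also have "\<dots> \<le> 6 * (C * h\<^sup>2)\<^sup>2 + (36 + 8 / m) * (Mc * h ^ 4)"
        using S m by (intro add_left_mono mult_left_mono) auto
      also have "\<dots> = (6 * C\<^sup>2 + (36 + 8 / m) * Mc) * h ^ 4"
        by (simp add: power_mult_distrib algebra_simps flip: power_mult)
      also have "\<dots> \<le> c * (h ^ 4 + dt ^ 4)"
        using m Mc c by (intro mult_mono) (auto simp: c_def)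
      finally show ?thesis .
    qed
    show "\<exists>X \<in> fe_space_vec J. linear_system F x0 J dt X \<and>
          (\<forall>Y \<in> fe_space_vec J. linear_system F x0 J dt Y \<longrightarrow> (\<forall>\<rho>\<in>{0..1}. Y \<rho> = X \<rho>)) \<and>
          (H1_norm (\<lambda>\<rho>. interp J (\<lambda>r. x r dt) \<rho> - X \<rho>))\<^sup>2 \<le> c * (h ^ 4 + dt ^ 4)"
      using X lsX unique err by blast
  qed
qed

end
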